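(* Let $\mathfrak g$ be the simple Lie algebra of type $G_2$, and let the Segal--Sugawara vectors $S_2,\dots,S_6\in\mathfrak z(\widehat{\mathfrak g})$, the affine Harish-Chandra homomorphism $\mathfrak f$ and the elements $w_2,w_6\in\mathrm U(t^{-1}\mathfrak h[t^{-1}])$ be as in the context. Then, under $\mathfrak f$, $$S_2\mapsto -6\,w_2,\qquad S_3\mapsto 18\,w_2',\qquad S_4\mapsto 9\,w_2^2-36\,w_2'',\qquad S_5\mapsto -63\,w_2w_2'+72\,w_2''',$$ $$S_6\mapsto 162\,w_6-\tfrac{33}{2}\,w_2^3+\tfrac{63}{2}\,(w_2')^2+90\,w_2w_2''-576\,w_2^{(4)}.$$
   Context: Realization of $\mathfrak g$. For $1\le i,j\le 7$ put $i'=8-i$ and $F_{ij}=E_{ij}-E_{j'i'}\in\mathfrak{gl}_7$, where the $E_{ij}$ are the matrix units; the $F_{ij}$ span $\mathfrak o_7$. Define elements $G_{ij}$, $1\le i,j\le 7$, by $G_{11}=2F_{11}-F_{22}-F_{33}$, $G_{22}=2F_{22}-F_{11}-F_{33}$, $G_{33}=2F_{33}-F_{11}-F_{22}$; $G_{ij}=3F_{ij}$ for $1\le i\ne j\le 3$; $G_{14}=2F_{14}-\sqrt2F_{3'2}$, $G_{24}=2F_{24}-\sqrt2F_{1'3}$, $G_{34}=2F_{34}-\sqrt2F_{2'1}$; $G_{41}=2F_{41}-\sqrt2F_{23'}$, $G_{42}=2F_{42}-\sqrt2F_{31'}$, $G_{43}=2F_{43}-\sqrt2F_{12'}$; the remaining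 $G_{ij}$ are determined by $G_{ij}+G_{j'i'}=0$ for all $i,j$ together with $G_{14}=-\sqrt2G_{3'2}$, $G_{24}=-\sqrt2G_{1'3}$, $G_{34}=-\sqrt2G_{2'1}$, $G_{41}=-\sqrt2G_{23'}$, $G_{42}=-\sqrt2G_{31'}$, $G_{43}=-\sqrt2G_{12'}$. The span $\mathfrak g$ of the $G_{ij}$ is a 14-dimensional Lie subalgebra of $\mathfrak o_7\subset\mathfrak{gl}_7$ over $\mathbb C$, simple of type $G_2$. Equip $\mathfrak g$ with the form $\langle X,Y\rangle=\frac16\mathrm{tr}\,XY$ (trace of $7\times7$ matrices). Triangular decomposition: $\mathfrak g=\mathfrak n_-\oplus\mathfrak h\oplus\mathfrak n_+$ with $\mathfrak h=\langle G_{11},G_{22}\rangle$, $\mathfrak n_+=\langle G_{12},G_{24},G_{14},G_{43},G_{23},G_{13}\rangle$, $\mathfrak n_-=\langle G_{21},G_{42},G_{41},G_{34},G_{32},G_{31}\rangle$. Affine algebra. $\widehat{\mathfrak g}=\mathfrak g[t,t^{-1}]\oplus\mathbb CK$ with $K$ central and $[X[r],Y[s]]=[X,Y][r+s]+r\,\delta_{r,-s}\langle X,Y\rangle K$, where $X[r]=X\,t^r$. The vacuum module at the critical level $V(\mathfrak g)_{\mathrm{cri}}$ is the quotient of $\mathrm U(\widehat{\mathfrak g})$ by the left ideal generated by $K+12$ and $\mathfrak g[t]$, identified as a vector space with $\mathrm U(t^{-1}\mathfrak g[t^{-1}])$. The Feigin--Frenkel center $\mathfrak z(\widehat{\mathfrak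 g})=\{v\in V(\mathfrak g)_{\mathrm{cri}}\mid\mathfrak g[t]v=0\}$ is a commutative subalgebra of $\mathrm U(t^{-1}\mathfrak g[t^{-1}])$; its elements are called Segal--Sugawara vectors. The vectors $S_a$. $G[r]=\sum_{i,j=1}^7e_{ji}\otimes G_{ij}[r]\in\mathrm{End}\,\mathbb C^7\otimes\mathrm U(\widehat{\mathfrak g})$, where $e_{ij}$ are the matrix units; $\mathrm{tr}$ is the trace over $\mathrm{End}\,\mathbb C^7$. Set $S_2=\mathrm{tr}\,G[-1]^2$, $S_3=\mathrm{tr}\,G[-1]^3$, $S_4=\mathrm{tr}\,G[-1]^4+\mathrm{tr}\,G[-2]G[-1]^2$, $S_5=\mathrm{tr}\,G[-1]^5+\mathrm{tr}\,G[-2]G[-1]^3$, $S_6=\mathrm{tr}\, G[-1]^6+5\,\mathrm{tr}\, G[-2]G[-1]^4+14\,\mathrm{tr}\, G[-3]G[-1]^3+456\,\mathrm{tr}\, G[-3]^2-639\,\mathrm{tr}\, G[-2]^3+31\,\mathrm{tr}\, G[-2]^2G[-1]^2-312\,\mathrm{tr}\, G[-3]G[-2]G[-1]$. All of these belong to $\mathfrak z(\widehat{\mathfrak g})$. Harish-Chandra homomorphism. Let $\mathfrak h$ act on $\mathrm U(t^{-1}\mathfrak g[t^{-1}])$ by the adjoint action of $H[0]$, $H\in\mathfrak h$. The $\mathfrak h$-centralizer decomposes as $\mathrm U(t^{-1}\mathfrak g[t^{-1}])^{\mathfrak h}=\mathrm U(t^{-1}\mathfrak h[t^{-1}])\oplus\mathrm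 J$, where $\mathrm J$ is the intersection of the centralizer with the left ideal of $\mathrm U(t^{-1}\mathfrak g[t^{-1}])$ generated by $t^{-1}\mathfrak n_-[t^{-1}]$. The projection onto the first summand is an algebra homomorphism $\mathfrak f:\mathrm U(t^{-1}\mathfrak g[t^{-1}])^{\mathfrak h}\to\mathrm U(t^{-1}\mathfrak h[t^{-1}])$; its restriction to $\mathfrak z(\widehat{\mathfrak g})$ (which lies in the centralizer) is the affine Harish-Chandra isomorphism of $\mathfrak z(\widehat{\mathfrak g})$ onto the classical $\mathcal W$-algebra $\mathcal W({}^L\mathfrak g)\subset\mathrm U(t^{-1}\mathfrak h[t^{-1}])$. The elements $w_i$. Put $g_1[r]=\frac13G_{11}[r]$, $g_2[r]=\frac13G_{22}[r]$ for $r<0$. Let $\tau=-d/dt$ regarded as a differential operator, i.e. adjoin $\tau$ to $\mathrm U(t^{-1}\mathfrak h[t^{-1}])$ with relations $\tau H[r]-H[r]\tau=-rH[r-1]$ for $H\in\mathfrak h$. The elements $w_i\in\mathrm U(t^{-1}\mathfrak h[t^{-1}])$ are defined by $$\big(\tau-2g_1[-1]-g_2[-1]\big)\big(\tau-g_1[-1]-2g_2[-1]\big)\big(\tau-g_1[-1]+g_2[-1]\big)\,\tau\,\big(\tau+g_1[-1]-g_2[-1]\big)\big(\tau+g_1[-1]+2g_2[-1]\big)\big(\tau+2g_1[-1]+g_2[-1]\big)=\tau^7+w_2\tau^5+w_3\tau^4+w_4\tau^3+w_5\tau^2+w_6\tau+w_7.$$ Primes denote the derivation $D$, where $D:H[r]\mapsto-rH[r-1]$: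 $w_2'=Dw_2$, $w_2''=D^2w_2$, $w_2'''=D^3w_2$, $w_2^{(4)}=D^4w_2$. *)

theory Defs
  imports "HOL-Analysis.Analysis" "HOL-Library.Poly_Mapping"
begin

section \<open>The Lie algebra of type $G_2$ inside $\mathfrak{gl}_7$\<close>

text \<open>
  Row and column indices are the elements \<open>1, \<dots>, 7\<close> of the numeral type \<open>7\<close> (the integers modulo
  seven, so \<open>7 = 0\<close> there).  The involution $i' = 8 - i$ is plain subtraction in that type.
\<close>

type_synonym mat7 = "complex^7^7"

definition mscale :: "complex \<Rightarrow> mat7 \<Rightarrow> mat7" where
  "mscale c A = (\<chi> i j. c * A $ i $ j)"

interpretation mat7: vector_space mscale
  by unfold_locales (simp_all add: mscale_def vec_eq_iff algebra_simps)

definition E :: "7 \<Rightarrow> 7 \<Rightarrow> mat7" where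
  "E i j = (\<chi> k l. if k = i \<and> l = j then 1 else 0)"

definition F :: "7 \<Rightarrow> 7 \<Rightarrow> mat7" where
  "F i j = E i j - E (8 - j) (8 - i)"

abbreviation rt2 :: real where "rt2 \<equiv> sqrt 2"

text \<open>
  The table lists one index pair out of each pair $\{(i,j), (j',i')\}$ with $G_{ij} \neq 0$.  Its last
  six entries solve the relations $G_{14} = -\sqrt2\, G_{3'2}$ etc.; the lemmas below confirm that the
  resulting \<open>G\<close> satisfies all the defining relations.
\<close>

definition G_table :: "((7 \<times> 7) \<times> mat7) list" where
  "G_table =
    [((1,1), 2 *\<^sub>R F 1 1 - F 2 2 - F 3 3),
     ((2,2), 2 *\<^sub>R F 2 2 - F 1 1 - F 3 3),
     ((3,3), 2 *\<^sub>R F 3 3 - F 1 1 - F 2 2),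
     ((1,2), 3 *\<^sub>R F 1 2), ((1,3), 3 *\<^sub>R F 1 3), ((2,3), 3 *\<^sub>R F 2 3),
     ((2,1), 3 *\<^sub>R F 2 1), ((3,1), 3 *\<^sub>R F 3 1), ((3,2), 3 *\<^sub>R F 3 2),
     ((1,4), 2 *\<^sub>R F 1 4 - rt2 *\<^sub>R F (8-3) 2),
     ((2,4), 2 *\<^sub>R F 2 4 - rt2 *\<^sub>R F (8-1) 3),
     ((3,4), 2 *\<^sub>R F 3 4 - rt2 *\<^sub>R F (8-2) 1),
     ((4,1), 2 *\<^sub>R F 4 1 - rt2 *\<^sub>R F 2 (8-3)),
     ((4,2), 2 *\<^sub>R F 4 2 - rt2 *\<^sub>R F 3 (8-1)),
     ((4,3), 2 *\<^sub>R F 4 3 - rt2 *\<^sub>R F 1 (8-2)),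
     ((8-3,2), (- 1 / rt2) *\<^sub>R (2 *\<^sub>R F 1 4 - rt2 *\<^sub>R F (8-3) 2)),
     ((8-1,3), (- 1 / rt2) *\<^sub>R (2 *\<^sub>R F 2 4 - rt2 *\<^sub>R F (8-1) 3)),
     ((8-2,1), (- 1 / rt2) *\<^sub>R (2 *\<^sub>R F 3 4 - rt2 *\<^sub>R F (8-2) 1)),
     ((2,8-3), (- 1 / rt2) *\<^sub>R (2 *\<^sub>R F 4 1 - rt2 *\<^sub>R F 2 (8-3))),
     ((3,8-1), (- 1 / rt2) *\<^sub>R (2 *\<^sub>R F 4 2 - rt2 *\<^sub>R F 3 (8-1))),
     ((1,8-2), (- 1 / rt2) *\<^sub>R (2 *\<^sub>R F 4 3 - rt2 *\<^sub>R F 1 (8-2)))]"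

definition G_half :: "7 \<Rightarrow> 7 \<Rightarrow> mat7" where
  "G_half i j = (case map_of G_table (i, j) of None \<Rightarrow> 0 | Some A \<Rightarrow> A)"

definition G :: "7 \<Rightarrow> 7 \<Rightarrow> mat7" where
  "G i j = G_half i j - G_half (8 - j) (8 - i)"

lemma G_skew: "G i j + G (8 - j) (8 - i) = 0"
  by (simp add: G_def)

lemma G_values_diag:
  "G 1 1 = 2 *\<^sub>R F 1 1 - F 2 2 - F 3 3"
  "G 2 2 = 2 *\<^sub>R F 2 2 - F 1 1 - F 3 3"
  "G 3 3 = 2 *\<^sub>R F 3 3 - F 1 1 - F 2 2"
  by (simp_all add: G_def G_half_def G_table_def)

lemma G_values_off_diag:
  assumes "i \<in> {1, 2, 3}" "j \<in> {1, 2, 3}" "i \<noteq> j"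
  shows "G i j = 3 *\<^sub>R F i j"
proof -
  have "(i, j) \<in> {(1,2), (1,3), (2,3), (2,1), (3,1), (3,2)}"
    using assms by blast
  then show ?thesis
    by (elim insertE emptyE) (simp_all add: G_def G_half_def G_table_def)
qed

lemma G_values_middle:
  "G 1 4 = 2 *\<^sub>R F 1 4 - rt2 *\<^sub>R F (8-3) 2"
  "G 2 4 = 2 *\<^sub>R F 2 4 - rt2 *\<^sub>R F (8-1) 3"
  "G 3 4 = 2 *\<^sub>R F 3 4 - rt2 *\<^sub>R F (8-2) 1"
  "G 4 1 = 2 *\<^sub>R F 4 1 - rt2 *\<^sub>R F 2 (8-3)"
  "G 4 2 = 2 *\<^sub>R F 4 2 - rt2 *\<^sub>R F 3 (8-1)"
  "G 4 3 = 2 *\<^sub>R F 4 3 - rt2 *\<^sub>R F 1 (8-2)"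
  by (simp_all add: G_def G_half_def G_table_def)

lemma G_relations:
  "G 1 4 = (- rt2) *\<^sub>R G (8-3) 2"
  "G 2 4 = (- rt2) *\<^sub>R G (8-1) 3"
  "G 3 4 = (- rt2) *\<^sub>R G (8-2) 1"
  "G 4 1 = (- rt2) *\<^sub>R G 2 (8-3)"
  "G 4 2 = (- rt2) *\<^sub>R G 3 (8-1)"
  "G 4 3 = (- rt2) *\<^sub>R G 1 (8-2)"
  by (simp_all add: G_def G_half_def G_table_def del: scaleR_diff_right)

definition lie_g :: "mat7 set" where
  "lie_g = mat7.span (range (\<lambda>(i, j). G i j))"

definition lie_h :: "mat7 set" where
  "lie_h = mat7.span {G 1 1, G 2 2}"

definition lie_n_minus :: "mat7 set" where
  "lie_n_minus = mat7.span {G 2 1, G 4 2, G 4 1, G 3 4, G 3 2, G 3 1}"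

definition bracket :: "mat7 \<Rightarrow> mat7 \<Rightarrow> mat7" where
  "bracket X Y = X ** Y - Y ** X"

definition form :: "mat7 \<Rightarrow> mat7 \<Rightarrow> complex" where
  "form X Y = trace (X ** Y) / 6"


section \<open>The enveloping algebra of the affine algebra extended by $\tau$\<close>

text \<open>
  The ambient associative algebra is the universal enveloping algebra of
  $\widehat{\mathfrak g} \oplus \mathbb C\tau$, where $\tau = -d/dt$ acts on $\widehat{\mathfrak g}$ by
  $[\tau, X[r]] = -r\,X[r-1]$ and $[\tau, K] = 0$.  By Poincare-Birkhoff-Witt it contains
  $\mathrm U(\widehat{\mathfrak g})$, $\mathrm U(t^{-1}\mathfrak g[t^{-1}])$,
  $\mathrm U(t^{-1}\mathfrak h[t^{-1}])$ and the latter's extension by $\tau$ as the subalgebras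
  generated by the corresponding elements.

  It is presented as the free complex algebra on the symbols \<open>Loop X r\<close>, \<open>Cent\<close>, \<open>Tau\<close> modulo a
  two-sided ideal.  The free algebra is the monoid algebra of the free monoid of words, written
  additively because that is what \<open>Poly_Mapping\<close> expects.  A symbol \<open>Loop X r\<close> with
  \<open>X \<notin> lie_g\<close> is meaningless and is set to zero.
\<close>

datatype gen = Loop mat7 int | Cent | Tau

instantiation list :: (type) monoid_add
begin

definition zero_list :: "'a list" where "zero_list = []"
definition plus_list :: "'a list \<Rightarrow> 'a list \<Rightarrow> 'a list" where "plus_list = (@)"

instance by standard (simp_all add: zero_list_def plus_list_def)

end

type_synonym free_alg = "gen list \<Rightarrow>\<^sub>0 complex"

abbreviation const :: "complex \<Rightarrow> free_alg" where
  "const c \<equiv> Poly_Mapping.single [] c"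

abbreviation letter :: "gen \<Rightarrow> free_alg" where
  "letter x \<equiv> Poly_Mapping.single [x] 1"

inductive_set relators :: "free_alg set" where
  outside: "X \<notin> lie_g \<Longrightarrow> letter (Loop X r) \<in> relators"
| additive: "X \<in> lie_g \<Longrightarrow> Y \<in> lie_g \<Longrightarrow>
    letter (Loop (X + Y) r) - (letter (Loop X r) + letter (Loop Y r)) \<in> relators"
| homogeneous: "X \<in> lie_g \<Longrightarrow>
    letter (Loop (mscale c X) r) - const c * letter (Loop X r) \<in> relators"
| loop_loop: "X \<in> lie_g \<Longrightarrow> Y \<in> lie_g \<Longrightarrow>
    letter (Loop X r) * letter (Loop Y s) - letter (Loop Y s) * letter (Loop X r)
    - (letter (Loop (bracket X Y) (r + s))
       + const (if r = - s then of_int r * form X Y else 0) * letter Cent) \<in> relators"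
| cent_loop: "X \<in> lie_g \<Longrightarrow>
    letter Cent * letter (Loop X r) - letter (Loop X r) * letter Cent \<in> relators"
| tau_loop: "X \<in> lie_g \<Longrightarrow>
    letter Tau * letter (Loop X r) - letter (Loop X r) * letter Tau
    - const (- of_int r) * letter (Loop X (r - 1)) \<in> relators"
| tau_cent: "letter Tau * letter Cent - letter Cent * letter Tau \<in> relators"

inductive_set relation_ideal :: "free_alg set" where
  zero: "0 \<in> relation_ideal"
| relator: "x \<in> relators \<Longrightarrow> a * x * b \<in> relation_ideal"
| add: "x \<in> relation_ideal \<Longrightarrow> y \<in> relation_ideal \<Longrightarrow> x + y \<in> relation_ideal"

lemma relation_ideal_mult:
  assumes "x \<in> relation_ideal"
  shows "a * x * b \<in> relation_ideal"
  using assms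
proof induction
  case zero
  show ?case by (simp add: relation_ideal.zero)
next
  case (relator x c d)
  have "a * (c * x * d) * b = (a * c) * x * (d * b)"
    by (simp add: mult.assoc)
  then show ?case using relator by (metis relation_ideal.relator)
next
  case (add x y)
  then show ?case by (simp add: distrib_left distrib_right relation_ideal.add)
qed

lemma relation_ideal_left: "x \<in> relation_ideal \<Longrightarrow> a * x \<in> relation_ideal"
  using relation_ideal_mult[of x a 1] by simp

lemma relation_ideal_right: "x \<in> relation_ideal \<Longrightarrow> x * b \<in> relation_ideal"
  using relation_ideal_mult[of x 1 b] by simp

lemma relation_ideal_uminus: "x \<in> relation_ideal \<Longrightarrow> - x \<in> relation_ideal"
  using relation_ideal_left[of x "- 1"] by simp

lemma relation_ideal_diff:
  "x \<in> relation_ideal \<Longrightarrow> y \<in> relation_ideal \<Longrightarrow> x - y \<in> relation_ideal"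
  using relation_ideal.add[of x "- y"] relation_ideal_uminus[of y] by simp

lemma lookup_Nil_mult:
  fixes a b :: free_alg
  shows "Poly_Mapping.lookup (a * b) [] = Poly_Mapping.lookup a [] * Poly_Mapping.lookup b []"
proof -
  have inner: "(\<Sum>q. (Poly_Mapping.lookup b q when [] = l + q)) = (Poly_Mapping.lookup b [] when l = [])" for l :: "gen list"
    by (cases "l = []") (simp_all add: plus_list_def when_def)
  show ?thesis
    by (simp add: lookup_mult inner mult_when)
qed

lemma relation_ideal_lookup_Nil: "x \<in> relation_ideal \<Longrightarrow> Poly_Mapping.lookup x [] = 0"
proof (induction rule: relation_ideal.induct)
  case (relator x a b)
  then have "Poly_Mapping.lookup x [] = 0"
    by (induction rule: relators.induct) (simp_all add: lookup_minus lookup_add lookup_Nil_mult lookup_single)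
  then show ?case by (simp add: lookup_Nil_mult)
qed (simp_all add: lookup_add)

quotient_type uea = free_alg / "\<lambda>x y. x - y \<in> relation_ideal"
proof (rule equivpI)
  show "reflp (\<lambda>x y. x - y \<in> relation_ideal)"
    by (simp add: reflp_def relation_ideal.zero)
  show "symp (\<lambda>x y. x - y \<in> relation_ideal)"
    unfolding symp_def by (metis minus_diff_eq relation_ideal_uminus)
  show "transp (\<lambda>x y. x - y \<in> relation_ideal)"
    unfolding transp_def
  proof (intro allI impI)
    fix x y z :: free_alg
    assume "x - y \<in> relation_ideal" "y - z \<in> relation_ideal"
    from relation_ideal.add[OF this] show "x - z \<in> relation_ideal" by simp
  qed
qed

instantiation uea :: ring_1
begin

lift_definition zero_uea :: uea is 0 .
lift_definition one_uea :: uea is 1 .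

lift_definition plus_uea :: "uea \<Rightarrow> uea \<Rightarrow> uea" is "(+)"
  by (metis add_diff_add relation_ideal.add)

lift_definition minus_uea :: "uea \<Rightarrow> uea \<Rightarrow> uea" is "(-)"
proof -
  fix a a' b b' :: free_alg
  assume "a - a' \<in> relation_ideal" "b - b' \<in> relation_ideal"
  from relation_ideal_diff[OF this] show "a - b - (a' - b') \<in> relation_ideal"
    by (simp add: algebra_simps)
qed

lift_definition uminus_uea :: "uea \<Rightarrow> uea" is uminus
  by (metis minus_diff_minus relation_ideal_uminus)

lift_definition times_uea :: "uea \<Rightarrow> uea \<Rightarrow> uea" is "(*)"
proof -
  fix a a' b b' :: free_alg
  assume "a - a' \<in> relation_ideal" "b - b' \<in> relation_ideal"
  then have "(a - a') * b + a' * (b - b') \<in> relation_ideal"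
    by (intro relation_ideal.add relation_ideal_left relation_ideal_right)
  then show "a * b - a' * b' \<in> relation_ideal"
    by (simp add: algebra_simps)
qed

instance
proof
  show "(0::uea) \<noteq> 1"
  proof transfer
    show "0 - 1 \<notin> relation_ideal"
      using relation_ideal_lookup_Nil[of "0 - 1"]
      by (auto simp: lookup_minus lookup_one zero_list_def)
  qed
qed (transfer, simp add: algebra_simps relation_ideal.zero)+

end

lift_definition cscale :: "complex \<Rightarrow> uea \<Rightarrow> uea" is "\<lambda>c x. const c * x"
  by (metis relation_ideal_left right_diff_distrib)

lemma const_commute: "const c * x = x * const c"
  for x :: free_alg
proof (rule poly_mapping_eqI)
  fix k
  have inner: "(\<Sum>q. ((c when [] = q) when k = l + q)) = (c when l = k)" for l :: "gen list"
  proof -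
    have "(\<lambda>q. ((c when [] = q) when k = l + q)) = (\<lambda>q. ((c when l = k) when q = []))"
      by (auto simp: fun_eq_iff when_def plus_list_def)
    then show ?thesis by (simp only: Sum_any_when_equal)
  qed
  have "Poly_Mapping.lookup (const c * x) k = c * Poly_Mapping.lookup x k"
    by (simp add: lookup_mult lookup_single when_mult plus_list_def)
  also have "\<dots> = Poly_Mapping.lookup (x * const c) k"
    by (simp add: lookup_mult lookup_single inner mult_when mult.commute)
  finally show "Poly_Mapping.lookup (const c * x) k = Poly_Mapping.lookup (x * const c) k" .
qed

lemma const_plus: "const (a + b) = const a + const b"
  by (simp add: single_add)

lemma const_mult: "const (a * b) = const a * const b"
  by (simp add: mult_single plus_list_def)

lemma const_1: "const 1 = 1"
  by (metis single_one zero_list_def)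

interpretation uea: vector_space cscale
proof
  fix a b :: complex and x y :: uea
  show "cscale a (x + y) = cscale a x + cscale a y"
    by transfer (simp add: distrib_left relation_ideal.zero)
  show "cscale (a + b) x = cscale a x + cscale b x"
    by transfer (simp add: const_plus distrib_right relation_ideal.zero)
  show "cscale a (cscale b x) = cscale (a * b) x"
    by transfer (simp add: const_mult mult.assoc relation_ideal.zero)
  show "cscale 1 x = x"
    by transfer (simp add: const_1 relation_ideal.zero)
qed

instantiation uea :: real_algebra_1
begin

definition scaleR_uea :: "real \<Rightarrow> uea \<Rightarrow> uea" where
  "r *\<^sub>R x = cscale (of_real r) x"

instance
proof
  fix r s :: real and x y :: uea
  show "r *\<^sub>R (x + y) = r *\<^sub>R x + r *\<^sub>R y"
    by (simp add: scaleR_uea_def uea.scale_right_distrib)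
  show "(r + s) *\<^sub>R x = r *\<^sub>R x + s *\<^sub>R x"
    by (simp add: scaleR_uea_def uea.scale_left_distrib)
  show "r *\<^sub>R s *\<^sub>R x = (r * s) *\<^sub>R x"
    by (simp add: scaleR_uea_def)
  show "1 *\<^sub>R x = x"
    by (simp add: scaleR_uea_def)
  show "r *\<^sub>R x * y = r *\<^sub>R (x * y)"
    unfolding scaleR_uea_def by transfer (simp add: mult.assoc relation_ideal.zero)
  show "x * r *\<^sub>R y = r *\<^sub>R (x * y)"
    unfolding scaleR_uea_def
    by transfer (metis const_commute mult.assoc diff_self relation_ideal.zero)
qed

end

lift_definition loop :: "mat7 \<Rightarrow> int \<Rightarrow> uea" is "\<lambda>X r. letter (Loop X r)" .

lift_definition tau :: uea is "letter Tau" .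

lift_definition cent :: uea is "letter Cent" .

lemma relators_ideal: "x \<in> relators \<Longrightarrow> x \<in> relation_ideal"
  using relation_ideal.relator[of x 1 1] by simp

lemma loop_bracket:
  assumes "X \<in> lie_g" "Y \<in> lie_g"
  shows "loop X r * loop Y s - loop Y s * loop X r =
    loop (bracket X Y) (r + s) + cscale (if r = - s then of_int r * form X Y else 0) cent"
  using assms by transfer (intro relators_ideal relators.loop_loop)

lemma tau_bracket:
  assumes "X \<in> lie_g"
  shows "tau * loop X r - loop X r * tau = cscale (- of_int r) (loop X (r - 1))"
  using assms by transfer (intro relators_ideal relators.tau_loop)


section \<open>The Harish-Chandra projection\<close>

inductive_set subalgebra :: "uea set \<Rightarrow> uea set" for S where
  base: "x \<in> S \<Longrightarrow> x \<in> subalgebra S"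
| scalar: "cscale c 1 \<in> subalgebra S"
| add: "x \<in> subalgebra S \<Longrightarrow> y \<in> subalgebra S \<Longrightarrow> x + y \<in> subalgebra S"
| mult: "x \<in> subalgebra S \<Longrightarrow> y \<in> subalgebra S \<Longrightarrow> x * y \<in> subalgebra S"

inductive_set left_ideal :: "uea set \<Rightarrow> uea set \<Rightarrow> uea set" for A S where
  zero: "0 \<in> left_ideal A S"
| base: "a \<in> A \<Longrightarrow> x \<in> S \<Longrightarrow> a * x \<in> left_ideal A S"
| add: "x \<in> left_ideal A S \<Longrightarrow> y \<in> left_ideal A S \<Longrightarrow> x + y \<in> left_ideal A S"

definition neg_modes :: "mat7 set \<Rightarrow> uea set" where
  "neg_modes L = {loop X r | X r. X \<in> L \<and> r < 0}"

definition U_g :: "uea set" where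
  "U_g = subalgebra (neg_modes lie_g)"

definition U_h :: "uea set" where
  "U_h = subalgebra (neg_modes lie_h)"

definition centralizer_h :: "uea set" where
  "centralizer_h = {u \<in> U_g. \<forall>H\<in>lie_h. loop H 0 * u - u * loop H 0 = 0}"

definition J :: "uea set" where
  "J = centralizer_h \<inter> left_ideal U_g (neg_modes lie_n_minus)"

text \<open>
  The projection of \<open>centralizer_h\<close> onto the first summand of its decomposition \<open>U_h \<oplus> J\<close>; outside
  \<open>centralizer_h\<close> the value is meaningless.
\<close>

definition hc :: "uea \<Rightarrow> uea" where
  "hc u = (THE v. v \<in> U_h \<and> u - v \<in> J)"


section \<open>The Segal-Sugawara vectors\<close>

text \<open>
  End $\mathbb C^7 \otimes \mathrm U$ is the algebra of matrices over \<open>uea\<close>; the summand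
  $e_{ji} \otimes G_{ij}[r]$ puts $G_{ij}[r]$ into row \<open>j\<close>, column \<open>i\<close>.  Powers are taken with
  respect to the matrix product, since \<open>^\<close> on vectors is componentwise.
\<close>

definition Gmat :: "int \<Rightarrow> uea^7^7" where
  "Gmat r = (\<chi> j i. loop (G i j) r)"

primrec mpow :: "uea^7^7 \<Rightarrow> nat \<Rightarrow> uea^7^7" where
  "mpow A 0 = mat 1"
| "mpow A (Suc n) = A ** mpow A n"

definition S2 :: uea where
  "S2 = trace (mpow (Gmat (-1)) 2)"

definition S3 :: uea where
  "S3 = trace (mpow (Gmat (-1)) 3)"

definition S4 :: uea where
  "S4 = trace (mpow (Gmat (-1)) 4) + trace (Gmat (-2) ** mpow (Gmat (-1)) 2)"

definition S5 :: uea where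
  "S5 = trace (mpow (Gmat (-1)) 5) + trace (Gmat (-2) ** mpow (Gmat (-1)) 3)"

definition S6 :: uea where
  "S6 = trace (mpow (Gmat (-1)) 6)
      + 5 *\<^sub>R trace (Gmat (-2) ** mpow (Gmat (-1)) 4)
      + 14 *\<^sub>R trace (Gmat (-3) ** mpow (Gmat (-1)) 3)
      + 456 *\<^sub>R trace (mpow (Gmat (-3)) 2)
      - 639 *\<^sub>R trace (mpow (Gmat (-2)) 3)
      + 31 *\<^sub>R trace (mpow (Gmat (-2)) 2 ** mpow (Gmat (-1)) 2)
      - 312 *\<^sub>R trace (Gmat (-3) ** Gmat (-2) ** Gmat (-1))"


section \<open>The elements $w_i$\<close>

abbreviation g1 :: uea where "g1 \<equiv> (1/3) *\<^sub>R loop (G 1 1) (-1)"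
abbreviation g2 :: uea where "g2 \<equiv> (1/3) *\<^sub>R loop (G 2 2) (-1)"

text \<open>Only \<open>w 2, \<dots>, w 7\<close> are meaningful; the other values are fixed to make \<open>w\<close> unique.\<close>

definition w :: "nat \<Rightarrow> uea" where
  "w = (THE w. (\<forall>i\<in>{2..7}. w i \<in> U_h) \<and> (\<forall>i. i \<notin> {2..7} \<longrightarrow> w i = 0) \<and>
      (tau - 2 *\<^sub>R g1 - g2) * (tau - g1 - 2 *\<^sub>R g2) * (tau - g1 + g2) * tau *
      (tau + g1 - g2) * (tau + g1 + 2 *\<^sub>R g2) * (tau + 2 *\<^sub>R g1 + g2) =
      tau ^ 7 + w 2 * tau ^ 5 + w 3 * tau ^ 4 + w 4 * tau ^ 3 + w 5 * tau ^ 2 + w 6 * tau + w 7)"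

text \<open>On \<open>U_h\<close> the commutator with \<open>tau\<close> is the derivation $H[r] \mapsto -r\,H[r-1]$.\<close>

definition D :: "uea \<Rightarrow> uea" where
  "D u = tau * u - u * tau"

end

theory Submission
  imports Defs
begin

text \<open>
  Modulo the left ideal generated by $t^{-1}\mathfrak n_-[t^{-1}]$ an element of
  $t^{-1}\mathfrak n_-[t^{-1}]$ can be moved to the right through any word until it vanishes, so every
  word reduces to words in $t^{-1}\mathfrak n_+[t^{-1}]$ and $t^{-1}\mathfrak h[t^{-1}]$; for a diagonal
  entry of a product of matrices $G[r]$ only the Cartan currents survive.  In a basis with integral
  structure constants this is a finite computation with integers.  The coefficients $w_i$ are found by
  expanding the factorised operator from the right, and the five identities become identities between
  integral polynomials in the Cartan currents.

  Since \<open>hc\<close> and \<open>w\<close> are definite descriptions, it must also be shown that \<open>U_h\<close> meets the left ideal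
  only in \<open>0\<close> and that the powers of $\tau$ are independent over \<open>U_h\<close>.  Both follow from evaluation
  modules: on a tensor product of copies of $\mathbb C^7 \otimes \mathbb C^7$ with coefficients in
  $\mathbb C[[t]]$ let $X[r]$ act by $\sum_p (t + c_p)^r X^{(p)}$, $\tau$ by $-d/dt$ and $K$ by $0$.  Products
  of lowest weight vectors are killed by the left ideal, and the eigenvalues of \<open>U_h\<close> on them, for
  all choices of the points $c_p$, separate the elements of \<open>U_h\<close>.
\<close>

subsection \<open>Linearity of the loop generators\<close>

text \<open>A left ideal is stable under left multiplication only. Matrix products are therefore
  built from the right: a column is multiplied on the left by one matrix after another, and each
  intermediate entry may be reduced at once. No central term arises on the way, since two negative
  modes have r + s < 0. The tensor square of C^7 is there because h has dimension two. The lowest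
  weight vector e_3 of C^7 gives a single functional on h, whereas e_3 (x) e_3 and e_3 (x) e_7 - e_7
  (x) e_3 give two independent ones, so at every point c both coordinates of h can be read off.
  Repeating a site n times multiplies its contribution to the eigenvalue of a current by n, and a
  polynomial that vanishes at all tuples of natural numbers is zero. The power series serve tau: a
  lowest weight vector times t^k / k! isolates the coefficient of tau^k at t = 0. The points c must
  be nonzero for (t + c)^r with r < 0 to exist in C[[t]].\<close>

lemma lie_g_subspace: "mat7.subspace lie_g"
  unfolding lie_g_def by (rule mat7.subspace_span)

lemma G_in_lie_g: "G i j \<in> lie_g"
  unfolding lie_g_def by (rule mat7.span_base) auto

lemma mscale_of_real: "mscale (of_real c) X = c *\<^sub>R X"
  by (simp add: mscale_def vec_eq_iff scaleR_conv_of_real[where 'a = complex])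

lemma scaleR_in_lie_g: "X \<in> lie_g \<Longrightarrow> c *\<^sub>R X \<in> lie_g"
  using mat7.subspace_scale[OF lie_g_subspace] by (metis mscale_of_real)

lemma loop_add:
  assumes "X \<in> lie_g" "Y \<in> lie_g"
  shows "loop (X + Y) r = loop X r + loop Y r"
  using assms by transfer (intro relators_ideal relators.additive)

lemma loop_mscale:
  assumes "X \<in> lie_g"
  shows "loop (mscale c X) r = cscale c (loop X r)"
  using assms by transfer (intro relators_ideal relators.homogeneous)

lemma loop_scaleR: "X \<in> lie_g \<Longrightarrow> loop (c *\<^sub>R X) r = c *\<^sub>R loop X r"
  by (simp add: loop_mscale scaleR_uea_def flip: mscale_of_real)

lemma loop_0: "loop 0 r = 0"
  using loop_scaleR[of 0 0 r] mat7.subspace_0[OF lie_g_subspace] by simp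

lemma loop_sum_list:
  assumes "\<And>z. z \<in> set zs \<Longrightarrow> f z \<in> lie_g"
  shows "(\<Sum>z\<leftarrow>zs. f z) \<in> lie_g \<and> loop (\<Sum>z\<leftarrow>zs. f z) r = (\<Sum>z\<leftarrow>zs. loop (f z) r)"
  using assms
  by (induction zs)
    (auto simp: loop_0 loop_add mat7.subspace_0[OF lie_g_subspace] mat7.subspace_add[OF lie_g_subspace])

lemma cscale_mult_left: "cscale c x * y = cscale c (x * y)"
  by transfer (simp add: mult.assoc relation_ideal.zero)

lemma cscale_mult_right: "x * cscale c y = cscale c (x * y)"
proof transfer
  fix x y :: free_alg and c
  have "x * (const c * y) = const c * (x * y)"
    using const_commute[of c x] by (simp flip: mult.assoc)
  then show "x * (const c * y) - const c * (x * y) \<in> relation_ideal"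
    by (simp add: relation_ideal.zero)
qed

subsection \<open>A basis of $\mathfrak g$ with integral structure constants\<close>

text \<open>
  The structure constants \<open>br\<close> of this basis are integers, and so are the entries of all matrices
  involved after conjugation by \<open>diag (1, 1, 1, \<surd>2, 1, 1, 1)\<close>.  The nonzero conjugated entries of
  \<open>bas x\<close> are listed in \<open>entries x\<close>.  A triple \<open>(c, i, x)\<close> in \<open>g_row j\<close> is a summand \<open>c x\<close> of the
  conjugated entry in row \<open>j\<close>, column \<open>i\<close> of $G[r]$; that entry comes from $G_{ij}$, not $G_{ji}$.
\<close>

datatype basis = P1 | P2 | P3 | P4 | P5 | P6 | H1 | H2 | N1 | N2 | N3 | N4 | N5 | N6

text \<open>For the short roots the choice is \<open>G 7 3\<close>, \<open>G 5 2\<close>,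
  \<open>G 1 6\<close> and \<open>G 3 7\<close>, \<open>G 2 5\<close>, \<open>G 6 1\<close> instead
  of their multiples by -sqrt 2, namely G_{24}, G_{14}, G_{43} and G_{42}, G_{41}, G_{34}. This
  removes sqrt 2 from the structure constants.\<close>

primrec bas :: "basis \<Rightarrow> mat7" where
  "bas P1 = G 1 2"
| "bas P2 = G 7 3"
| "bas P3 = G 5 2"
| "bas P4 = G 1 6"
| "bas P5 = G 2 3"
| "bas P6 = G 1 3"
| "bas H1 = G 1 1"
| "bas H2 = G 2 2"
| "bas N1 = G 2 1"
| "bas N2 = G 3 7"
| "bas N3 = G 2 5"
| "bas N4 = G 6 1"
| "bas N5 = G 3 2"
| "bas N6 = G 3 1"

primrec bas_no :: "basis \<Rightarrow> int" where
  "bas_no P1 = 0"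
| "bas_no P2 = 1"
| "bas_no P3 = 2"
| "bas_no P4 = 3"
| "bas_no P5 = 4"
| "bas_no P6 = 5"
| "bas_no H1 = 6"
| "bas_no H2 = 7"
| "bas_no N1 = 8"
| "bas_no N2 = 9"
| "bas_no N3 = 10"
| "bas_no N4 = 11"
| "bas_no N5 = 12"
| "bas_no N6 = 13"

definition pos :: "basis \<Rightarrow> bool" where "pos x \<longleftrightarrow> bas_no x < 6"

definition neg :: "basis \<Rightarrow> bool" where "neg x \<longleftrightarrow> bas_no x > 7"

text \<open>The table of brackets is split by its first argument, so that each piece is primitive
  recursive in the second.\<close>

primrec brP1 :: "basis \<Rightarrow> (int \<times> basis) list" where
  "brP1 P1 = []"
| "brP1 P2 = [(3, P3)]"
| "brP1 P3 = []"
| "brP1 P4 = []"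
| "brP1 P5 = [(3, P6)]"
| "brP1 P6 = []"
| "brP1 H1 = [(-3, P1)]"
| "brP1 H2 = [(3, P1)]"
| "brP1 N1 = [(3, H1), (-3, H2)]"
| "brP1 N2 = []"
| "brP1 N3 = [(-3, N2)]"
| "brP1 N4 = []"
| "brP1 N5 = []"
| "brP1 N6 = [(-3, N5)]"

primrec brP2 :: "basis \<Rightarrow> (int \<times> basis) list" where
  "brP2 P1 = [(-3, P3)]"
| "brP2 P2 = []"
| "brP2 P3 = [(2, P4)]"
| "brP2 P4 = [(1, P5)]"
| "brP2 P5 = []"
| "brP2 P6 = []"
| "brP2 H1 = [(1, P2)]"
| "brP2 H2 = [(-2, P2)]"
| "brP2 N1 = []"
| "brP2 N2 = [(1, H2)]"
| "brP2 N3 = [(1, N1)]"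
| "brP2 N4 = [(-2, N3)]"
| "brP2 N5 = [(-3, N4)]"
| "brP2 N6 = []"

primrec brP3 :: "basis \<Rightarrow> (int \<times> basis) list" where
  "brP3 P1 = []"
| "brP3 P2 = [(-2, P4)]"
| "brP3 P3 = []"
| "brP3 P4 = [(1, P6)]"
| "brP3 P5 = []"
| "brP3 P6 = []"
| "brP3 H1 = [(-2, P3)]"
| "brP3 H2 = [(1, P3)]"
| "brP3 N1 = [(-3, P2)]"
| "brP3 N2 = [(1, P1)]"
| "brP3 N3 = [(1, H1)]"
| "brP3 N4 = [(2, N2)]"
| "brP3 N5 = []"
| "brP3 N6 = [(-3, N4)]"

primrec brP4 :: "basis \<Rightarrow> (int \<times> basis) list" where
  "brP4 P1 = []"
| "brP4 P2 = [(-1, P5)]"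
| "brP4 P3 = [(-1, P6)]"
| "brP4 P4 = []"
| "brP4 P5 = []"
| "brP4 P6 = []"
| "brP4 H1 = [(-1, P4)]"
| "brP4 H2 = [(-1, P4)]"
| "brP4 N1 = []"
| "brP4 N2 = [(-2, P3)]"
| "brP4 N3 = [(2, P2)]"
| "brP4 N4 = [(1, H1), (1, H2)]"
| "brP4 N5 = [(3, N2)]"
| "brP4 N6 = [(3, N3)]"

primrec brP5 :: "basis \<Rightarrow> (int \<times> basis) list" where
  "brP5 P1 = [(-3, P6)]"
| "brP5 P2 = []"
| "brP5 P3 = []"
| "brP5 P4 = []"
| "brP5 P5 = []"
| "brP5 P6 = []"
| "brP5 H1 = []"
| "brP5 H2 = [(-3, P5)]"
| "brP5 N1 = []"
| "brP5 N2 = [(-3, P4)]"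
| "brP5 N3 = []"
| "brP5 N4 = [(3, P2)]"
| "brP5 N5 = [(3, H1), (6, H2)]"
| "brP5 N6 = [(3, N1)]"

primrec brP6 :: "basis \<Rightarrow> (int \<times> basis) list" where
  "brP6 P1 = []"
| "brP6 P2 = []"
| "brP6 P3 = []"
| "brP6 P4 = []"
| "brP6 P5 = []"
| "brP6 P6 = []"
| "brP6 H1 = [(-3, P6)]"
| "brP6 H2 = []"
| "brP6 N1 = [(-3, P5)]"
| "brP6 N2 = []"
| "brP6 N3 = [(-3, P4)]"
| "brP6 N4 = [(3, P3)]"
| "brP6 N5 = [(3, P1)]"
| "brP6 N6 = [(6, H1), (3, H2)]"

primrec brH1 :: "basis \<Rightarrow> (int \<times> basis) list" where
  "brH1 P1 = [(3, P1)]"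
| "brH1 P2 = [(-1, P2)]"
| "brH1 P3 = [(2, P3)]"
| "brH1 P4 = [(1, P4)]"
| "brH1 P5 = []"
| "brH1 P6 = [(3, P6)]"
| "brH1 H1 = []"
| "brH1 H2 = []"
| "brH1 N1 = [(-3, N1)]"
| "brH1 N2 = [(1, N2)]"
| "brH1 N3 = [(-2, N3)]"
| "brH1 N4 = [(-1, N4)]"
| "brH1 N5 = []"
| "brH1 N6 = [(-3, N6)]"

primrec brH2 :: "basis \<Rightarrow> (int \<times> basis) list" where
  "brH2 P1 = [(-3, P1)]"
| "brH2 P2 = [(2, P2)]"
| "brH2 P3 = [(-1, P3)]"
| "brH2 P4 = [(1, P4)]"
| "brH2 P5 = [(3, P5)]"
| "brH2 P6 = []"
| "brH2 H1 = []"
| "brH2 H2 = []"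
| "brH2 N1 = [(3, N1)]"
| "brH2 N2 = [(-2, N2)]"
| "brH2 N3 = [(1, N3)]"
| "brH2 N4 = [(-1, N4)]"
| "brH2 N5 = [(-3, N5)]"
| "brH2 N6 = []"

primrec brN1 :: "basis \<Rightarrow> (int \<times> basis) list" where
  "brN1 P1 = [(-3, H1), (3, H2)]"
| "brN1 P2 = []"
| "brN1 P3 = [(3, P2)]"
| "brN1 P4 = []"
| "brN1 P5 = []"
| "brN1 P6 = [(3, P5)]"
| "brN1 H1 = [(3, N1)]"
| "brN1 H2 = [(-3, N1)]"
| "brN1 N1 = []"
| "brN1 N2 = [(-3, N3)]"
| "brN1 N3 = []"
| "brN1 N4 = []"
| "brN1 N5 = [(-3, N6)]"
| "brN1 N6 = []"

primrec brN2 :: "basis \<Rightarrow> (int \<times> basis) list" where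
  "brN2 P1 = []"
| "brN2 P2 = [(-1, H2)]"
| "brN2 P3 = [(-1, P1)]"
| "brN2 P4 = [(2, P3)]"
| "brN2 P5 = [(3, P4)]"
| "brN2 P6 = []"
| "brN2 H1 = [(-1, N2)]"
| "brN2 H2 = [(2, N2)]"
| "brN2 N1 = [(3, N3)]"
| "brN2 N2 = []"
| "brN2 N3 = [(-2, N4)]"
| "brN2 N4 = [(-1, N5)]"
| "brN2 N5 = []"
| "brN2 N6 = []"

primrec brN3 :: "basis \<Rightarrow> (int \<times> basis) list" where
  "brN3 P1 = [(3, N2)]"
| "brN3 P2 = [(-1, N1)]"
| "brN3 P3 = [(-1, H1)]"
| "brN3 P4 = [(-2, P2)]"
| "brN3 P5 = []"
| "brN3 P6 = [(3, P4)]"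
| "brN3 H1 = [(2, N3)]"
| "brN3 H2 = [(-1, N3)]"
| "brN3 N1 = []"
| "brN3 N2 = [(2, N4)]"
| "brN3 N3 = []"
| "brN3 N4 = [(-1, N6)]"
| "brN3 N5 = []"
| "brN3 N6 = []"

primrec brN4 :: "basis \<Rightarrow> (int \<times> basis) list" where
  "brN4 P1 = []"
| "brN4 P2 = [(2, N3)]"
| "brN4 P3 = [(-2, N2)]"
| "brN4 P4 = [(-1, H1), (-1, H2)]"
| "brN4 P5 = [(-3, P2)]"
| "brN4 P6 = [(-3, P3)]"
| "brN4 H1 = [(1, N4)]"
| "brN4 H2 = [(1, N4)]"
| "brN4 N1 = []"
| "brN4 N2 = [(1, N5)]"
| "brN4 N3 = [(1, N6)]"
| "brN4 N4 = []"
| "brN4 N5 = []"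
| "brN4 N6 = []"

primrec brN5 :: "basis \<Rightarrow> (int \<times> basis) list" where
  "brN5 P1 = []"
| "brN5 P2 = [(3, N4)]"
| "brN5 P3 = []"
| "brN5 P4 = [(-3, N2)]"
| "brN5 P5 = [(-3, H1), (-6, H2)]"
| "brN5 P6 = [(-3, P1)]"
| "brN5 H1 = []"
| "brN5 H2 = [(3, N5)]"
| "brN5 N1 = [(3, N6)]"
| "brN5 N2 = []"
| "brN5 N3 = []"
| "brN5 N4 = []"
| "brN5 N5 = []"
| "brN5 N6 = []"

primrec brN6 :: "basis \<Rightarrow> (int \<times> basis) list" where
  "brN6 P1 = [(3, N5)]"
| "brN6 P2 = []"
| "brN6 P3 = [(3, N4)]"
| "brN6 P4 = [(-3, N3)]"
| "brN6 P5 = [(-3, N1)]"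
| "brN6 P6 = [(-6, H1), (-3, H2)]"
| "brN6 H1 = [(3, N6)]"
| "brN6 H2 = []"
| "brN6 N1 = []"
| "brN6 N2 = []"
| "brN6 N3 = []"
| "brN6 N4 = []"
| "brN6 N5 = []"
| "brN6 N6 = []"

primrec br :: "basis \<Rightarrow> basis \<Rightarrow> (int \<times> basis) list" where
  "br P1 = brP1"
| "br P2 = brP2"
| "br P3 = brP3"
| "br P4 = brP4"
| "br P5 = brP5"
| "br P6 = brP6"
| "br H1 = brH1"
| "br H2 = brH2"
| "br N1 = brN1"
| "br N2 = brN2"
| "br N3 = brN3"
| "br N4 = brN4"
| "br N5 = brN5"
| "br N6 = brN6"

text \<open>A second copy of the index set, with constructors: tables over it are
  \<open>primrec\<close>, and comparing indices during evaluation uses constructor equations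
  only.\<close>

datatype row = R1 | R2 | R3 | R4 | R5 | R6 | R7

primrec idx :: "row \<Rightarrow> 7" where
  "idx R1 = 1"
| "idx R2 = 2"
| "idx R3 = 3"
| "idx R4 = 4"
| "idx R5 = 5"
| "idx R6 = 6"
| "idx R7 = 7"

primrec entries :: "basis \<Rightarrow> (int \<times> row \<times> row) list" where
  "entries P1 = [(3, R1, R2), (-3, R6, R7)]"
| "entries P2 = [(-1, R2, R4), (2, R4, R6), (-1, R5, R1), (1, R7, R3)]"
| "entries P3 = [(-1, R1, R4), (2, R4, R7), (1, R5, R2), (-1, R6, R3)]"
| "entries P4 = [(1, R1, R6), (-1, R2, R7), (-2, R4, R3), (1, R5, R4)]"
| "entries P5 = [(3, R2, R3), (-3, R5, R6)]"
| "entries P6 = [(3, R1, R3), (-3, R5, R7)]"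
| "entries H1 = [(2, R1, R1), (-1, R2, R2), (-1, R3, R3), (1, R5, R5), (1, R6, R6), (-2, R7, R7)]"
| "entries H2 = [(-1, R1, R1), (2, R2, R2), (-1, R3, R3), (1, R5, R5), (-2, R6, R6), (1, R7, R7)]"
| "entries N1 = [(3, R2, R1), (-3, R7, R6)]"
| "entries N2 = [(-1, R1, R5), (1, R3, R7), (-2, R4, R2), (1, R6, R4)]"
| "entries N3 = [(1, R2, R5), (-1, R3, R6), (-2, R4, R1), (1, R7, R4)]"
| "entries N4 = [(-1, R3, R4), (2, R4, R5), (1, R6, R1), (-1, R7, R2)]"
| "entries N5 = [(3, R3, R2), (-3, R6, R5)]"
| "entries N6 = [(3, R3, R1), (-3, R7, R5)]"

primrec g_row :: "row \<Rightarrow> (int \<times> row \<times> basis) list" where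
  "g_row R1 = [(1, R1, H1), (1, R2, N1), (1, R3, N6), (-1, R4, N3), (-1, R5, P2), (1, R6, N4)]"
| "g_row R2 = [(1, R1, P1), (1, R2, H2), (1, R3, N5), (-1, R4, N2), (1, R5, P3), (-1, R7, N4)]"
| "g_row R3 = [(1, R1, P6), (1, R2, P5), (-1, R3, H1), (-1, R3, H2), (-1, R4, P4), (-1, R6, P3), (1, R7, P2)]"
| "g_row R4 = [(-2, R1, P3), (-2, R2, P2), (-2, R3, N4), (2, R5, P4), (2, R6, N2), (2, R7, N3)]"
| "g_row R5 = [(-1, R1, N2), (1, R2, N3), (1, R4, N4), (1, R5, H1), (1, R5, H2), (-1, R6, N5), (-1, R7, N6)]"
| "g_row R6 = [(1, R1, P4), (-1, R3, N3), (1, R4, P2), (-1, R5, P5), (-1, R6, H2), (-1, R7, N1)]"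
| "g_row R7 = [(-1, R2, P4), (1, R3, N2), (1, R4, P3), (-1, R5, P6), (-1, R6, P1), (-1, R7, H1)]"

section \<open>Integral matrices as lists of entries\<close>

lemma inj_idx: "idx i = idx j \<longleftrightarrow> i = j"
  by (cases i; cases j) simp_all

definition dg :: "7 \<Rightarrow> real" where "dg i = (if i = 4 then rt2 else 1)"

lemma dg_nonzero [simp]: "dg i \<noteq> 0"
  by (simp add: dg_def)

text \<open>With d = diag(dg 1, ..., dg 7) this is d^{-1} E_{ij} d. Conjugated matrix units multiply
  like ordinary ones, so products can be computed on integral entry lists.\<close>

definition unit_mat :: "row \<Rightarrow> row \<Rightarrow> mat7" where
  "unit_mat i j = (dg (idx j) / dg (idx i)) *\<^sub>R E (idx i) (idx j)"

lemma E_mult: "E i j ** E k l = (if j = k then E i l else 0)"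
  by (auto simp: E_def matrix_matrix_mult_def vec_eq_iff if_distrib[of "\<lambda>x. x * _"] cong: if_cong)

lemma unit_mat_mult: "unit_mat i j ** unit_mat k l = (if j = k then unit_mat i l else 0)"
  by (simp add: unit_mat_def E_mult inj_idx scalar_matrix_assoc matrix_scalar_ac flip: scalar_matrix_assoc)

definition mat_of :: "(int \<times> row \<times> row) list \<Rightarrow> mat7" where
  "mat_of es = (\<Sum>(c, i, j)\<leftarrow>es. of_int c *\<^sub>R unit_mat i j)"

lemma mat_of_Nil [simp]: "mat_of [] = 0"
  by (simp add: mat_of_def)

lemma mat_of_Cons [simp]: "mat_of ((c, i, j) # es) = of_int c *\<^sub>R unit_mat i j + mat_of es"
  by (simp add: mat_of_def)

lemma mat_of_append [simp]: "mat_of (es @ fs) = mat_of es + mat_of fs"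
  by (simp add: mat_of_def)

lemma double_mat: "2 * X = 2 *\<^sub>R X" for X :: mat7
  by (simp add: vec_eq_iff scaleR_conv_of_real[where 'a = complex])

lemma mat_of_sparse: "mat_of (entries x) = bas x"
  by (cases x)
    (simp_all add: unit_mat_def dg_def G_def G_half_def G_table_def F_def algebra_simps
      double_mat real_div_sqrt)

definition scale_sparse :: "int \<Rightarrow> (int \<times> row \<times> row) list \<Rightarrow> (int \<times> row \<times> row) list" where
  "scale_sparse a es = map (\<lambda>(c, i, j). (a * c, i, j)) es"

definition mult_sparse ::
    "(int \<times> row \<times> row) list \<Rightarrow> (int \<times> row \<times> row) list \<Rightarrow> (int \<times> row \<times> row) list" where
  "mult_sparse es fs = concat (map (\<lambda>(c, i, j). concat (map (\<lambda>(d, k, l).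
     if j = k then [(c * d, i, l)] else []) fs)) es)"

text \<open>A product of entry lists may name the same position several times; equal positions have
  to be collected before testing for zero.\<close>

fun insert_sparse :: "int \<times> row \<times> row \<Rightarrow> (int \<times> row \<times> row) list \<Rightarrow> (int \<times> row \<times> row) list" where
  "insert_sparse e [] = [e]"
| "insert_sparse (c, i, j) ((d, k, l) # es) =
    (if i = k \<and> j = l then (c + d, i, j) # es else (d, k, l) # insert_sparse (c, i, j) es)"

definition null_sparse :: "(int \<times> row \<times> row) list \<Rightarrow> bool" where
  "null_sparse es = list_all (\<lambda>(c, i, j). c = 0) (foldr insert_sparse es [])"

lemma mat_of_scale_sparse: "mat_of (scale_sparse a es) = of_int a *\<^sub>R mat_of es"
  by (induction es) (auto simp: scale_sparse_def algebra_simps)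

lemma matrix_add_rdistrib: "(A + B) ** C = A ** C + B ** C" for A B :: mat7
  by (simp add: matrix_matrix_mult_def vec_eq_iff distrib_right sum.distrib)

lemma mat_of_mult_sparse: "mat_of (mult_sparse es fs) = mat_of es ** mat_of fs"
proof (induction es)
  case (Cons e es)
  obtain c i j where e: "e = (c, i, j)" by (cases e)
  have "mat_of (concat (map (\<lambda>(d, k, l). if j = k then [(c * d, i, l)] else []) fs)) =
      (of_int c *\<^sub>R unit_mat i j) ** mat_of fs"
  proof (induction fs)
    case (Cons f fs)
    then show ?case
      by (cases f)
        (simp add: matrix_add_ldistrib unit_mat_mult scalar_matrix_assoc matrix_scalar_ac
          flip: scalar_matrix_assoc)
  qed (simp add: matrix_matrix_mult_def vec_eq_iff)
  then show ?case
    using Cons by (simp add: mult_sparse_def e matrix_add_rdistrib)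
qed (simp add: mult_sparse_def matrix_matrix_mult_def vec_eq_iff)

lemma mat_of_insert_sparse: "mat_of (insert_sparse e es) = mat_of (e # es)"
  by (induction e es rule: insert_sparse.induct) (auto simp: algebra_simps)

lemma null_sparse_imp: "null_sparse es \<Longrightarrow> mat_of es = 0"
proof -
  have "mat_of (foldr insert_sparse es []) = mat_of es"
    by (induction es) (auto simp: mat_of_insert_sparse)
  moreover have "list_all (\<lambda>(c, i, j). c = 0) fs \<Longrightarrow> mat_of fs = 0" for fs
    by (induction fs) auto
  ultimately show "null_sparse es \<Longrightarrow> mat_of es = 0"
    by (simp add: null_sparse_def)
qed

definition all_basis :: "basis list" where
  "all_basis = [P1, P2, P3, P4, P5, P6, H1, H2, N1, N2, N3, N4, N5, N6]"

lemma in_all_basis: "x \<in> set all_basis"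
  by (cases x) (simp_all add: all_basis_def)

definition bracket_defect :: "basis \<Rightarrow> basis \<Rightarrow> (int \<times> row \<times> row) list" where
  "bracket_defect x y = mult_sparse (entries x) (entries y)
     @ scale_sparse (-1) (mult_sparse (entries y) (entries x))
     @ scale_sparse (-1) (concat (map (\<lambda>(c, z). scale_sparse c (entries z)) (br x y)))"

lemma bracket_defect_null:
  "list_all (\<lambda>x. list_all (\<lambda>y. null_sparse (bracket_defect x y)) all_basis) all_basis"
  by code_simp

lemma bracket_bas: "bracket (bas x) (bas y) = (\<Sum>(c, z)\<leftarrow>br x y. of_int c *\<^sub>R bas z)"
proof -
  have "mat_of (bracket_defect x y) = 0"
    using bracket_defect_null in_all_basis by (auto simp: list_all_iff intro: null_sparse_imp)
  moreover have "mat_of (concat (map (\<lambda>(c, z). scale_sparse c (entries z)) zs)) =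
      (\<Sum>(c, z)\<leftarrow>zs. of_int c *\<^sub>R bas z)" for zs
    by (induction zs) (auto simp: mat_of_scale_sparse mat_of_sparse)
  ultimately have "bas x ** bas y + (- (bas y ** bas x) - (\<Sum>(c, z)\<leftarrow>br x y. of_int c *\<^sub>R bas z)) = 0"
    by (simp add: bracket_defect_def mat_of_scale_sparse mat_of_mult_sparse mat_of_sparse)
  moreover have "A - B = (A + (- B - C)) + C" for A B C :: mat7
    by simp
  ultimately show ?thesis
    unfolding bracket_def by (metis add_0)
qed

section \<open>All entries of G in terms of the basis\<close>

lemma bas_in_lie_g: "bas x \<in> lie_g"
  by (cases x) (simp_all add: G_in_lie_g)

lemma skew: "G i j = - G (8 - j) (8 - i)"
  using G_skew[of i j] by (simp add: eq_neg_iff_add_eq_0)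

text \<open>For j = i' the relation G_{ij} + G_{j'i'} = 0 reads 2 G_{ij} = 0.\<close>

lemma G_anti_diagonal: "G 1 7 = 0" "G 2 6 = 0" "G 3 5 = 0" "G 4 4 = 0" "G 5 3 = 0" "G 6 2 = 0" "G 7 1 = 0"
proof -
  have "X = 0" if "X = - X" for X :: mat7
    using that by (metis (no_types) scaleR_2 scaleR_eq_0_iff zero_neq_numeral eq_neg_iff_add_eq_0)
  then show "G 1 7 = 0" "G 2 6 = 0" "G 3 5 = 0" "G 4 4 = 0" "G 5 3 = 0" "G 6 2 = 0" "G 7 1 = 0"
    using skew[of 1 7] skew[of 2 6] skew[of 3 5] skew[of 4 4] skew[of 5 3] skew[of 6 2] skew[of 7 1]
    by simp_all
qed

text \<open>Used as rewrite rules together with \<open>G_relations\<close>,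
  \<open>G_anti_diagonal\<close> and \<open>G_3_3\<close>, these reduce all 49 entries to the
  fourteen basis matrices.\<close>

lemma G_reflect:
  "G 7 7 = - G 1 1" "G 6 7 = - G 1 2" "G 5 7 = - G 1 3" "G 4 7 = - G 1 4" "G 2 7 = - G 1 6" "G
  6 6 = - G 2 2" "G 5 6 = - G 2 3" "G 4 6 = - G 2 4" "G 3 6 = - G 2 5" "G 5 5 = - G 3 3" "G 4 5
  = - G 3 4" "G 6 5 = - G 3 2" "G 7 5 = - G 3 1" "G 6 4 = - G 4 2" "G 7 4 = - G 4 1" "G 5 4 = -
  G 4 3" "G 7 6 = - G 2 1" "G 6 3 = - G 5 2" "G 7 2 = - G 6 1" "G 1 5 = - G 3 7" "G 5 1 = - G 7
  3"
  using skew[of 7 7] skew[of 6 7] skew[of 5 7] skew[of 4 7] skew[of 2 7] skew[of 6 6] skew[of 5 6]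
    skew[of 4 6] skew[of 3 6] skew[of 5 5] skew[of 4 5] skew[of 6 5] skew[of 7 5] skew[of 6 4]
    skew[of 7 4] skew[of 5 4] skew[of 7 6] skew[of 6 3] skew[of 7 2] skew[of 1 5] skew[of 5 1]
  by simp_all

lemma G_3_3: "G 3 3 = - G 1 1 - G 2 2"
  by (simp add: G_values_diag scaleR_2)

lemma g_row_correct:
  "(dg (idx j) / dg (idx i)) *\<^sub>R G (idx i) (idx j) =
     (\<Sum>(c, k, x)\<leftarrow>g_row j. if k = i then of_int c *\<^sub>R bas x else 0)"
  by (cases i; cases j)
    (simp_all add: dg_def G_reflect G_anti_diagonal G_3_3 G_relations)

subsection \<open>Subalgebras and left ideals\<close>

lemma subalgebra_of_int: "of_int c \<in> subalgebra S"
  using subalgebra.scalar[of "of_int c" S]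
  by (metis of_real_of_int_eq of_real_def scaleR_uea_def)

lemma subalgebra_0: "0 \<in> subalgebra S"
  using subalgebra_of_int[of 0 S] by simp

lemma subalgebra_cscale: "x \<in> subalgebra S \<Longrightarrow> cscale c x \<in> subalgebra S"
  using subalgebra.mult[OF subalgebra.scalar, of x S c] cscale_mult_left[of c 1 x] by simp

lemma subalgebra_scaleR: "x \<in> subalgebra S \<Longrightarrow> c *\<^sub>R x \<in> subalgebra S"
  by (simp add: scaleR_uea_def subalgebra_cscale)

lemma subalgebra_uminus: "x \<in> subalgebra S \<Longrightarrow> - x \<in> subalgebra S"
  using subalgebra_scaleR[of x S "- 1"] by simp

lemma subalgebra_diff: "x \<in> subalgebra S \<Longrightarrow> y \<in> subalgebra S \<Longrightarrow> x - y \<in> subalgebra S"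
  using subalgebra.add[of x S "- y"] subalgebra_uminus by simp

lemma subalgebra_power: "x \<in> subalgebra S \<Longrightarrow> x ^ n \<in> subalgebra S"
  using subalgebra_of_int[of 1 S] by (induction n) (auto intro: subalgebra.mult)

lemma subalgebra_sum: "(\<And>i. i \<in> A \<Longrightarrow> f i \<in> subalgebra S) \<Longrightarrow> sum f A \<in> subalgebra S"
  by (induction A rule: infinite_finite_induct) (auto intro: subalgebra_0 subalgebra.add)

lemma subalgebra_mono: "x \<in> subalgebra S \<Longrightarrow> S \<subseteq> subalgebra T \<Longrightarrow> x \<in> subalgebra T"
  by (induction x rule: subalgebra.induct) (auto intro: subalgebra.intros)

lemma span_mono_lie:
  "lie_h \<subseteq> lie_g" "lie_n_minus \<subseteq> lie_g"
  unfolding lie_h_def lie_n_minus_def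
  by (rule mat7.span_minimal[OF _ lie_g_subspace]; simp add: G_in_lie_g)+

lemma loop_in_neg_modes: "X \<in> L \<Longrightarrow> r < 0 \<Longrightarrow> loop X r \<in> neg_modes L"
  by (auto simp: neg_modes_def)

lemma neg_modes_mono: "L \<subseteq> M \<Longrightarrow> neg_modes L \<subseteq> neg_modes M"
  by (auto simp: neg_modes_def)

lemma U_h_subset: "x \<in> U_h \<Longrightarrow> x \<in> U_g"
  unfolding U_h_def U_g_def
  using neg_modes_mono[OF span_mono_lie(1)] by (auto elim!: subalgebra_mono intro: subalgebra.base)

abbreviation n_ideal :: "uea set" where
  "n_ideal \<equiv> left_ideal U_g (neg_modes lie_n_minus)"

lemma n_ideal_mult: "x \<in> n_ideal \<Longrightarrow> a \<in> U_g \<Longrightarrow> a * x \<in> n_ideal"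
proof (induction rule: left_ideal.induct)
  case (base b y)
  then show ?case
    using left_ideal.base[of "a * b"] by (simp add: U_g_def subalgebra.mult mult.assoc)
qed (auto simp: distrib_left intro: left_ideal.intros)

lemma n_ideal_uminus: "x \<in> n_ideal \<Longrightarrow> - x \<in> n_ideal"
  using n_ideal_mult[of x "of_int (- 1)"] unfolding U_g_def by (simp add: subalgebra_of_int del: of_int_minus) (simp)

lemma n_ideal_diff: "x \<in> n_ideal \<Longrightarrow> y \<in> n_ideal \<Longrightarrow> x - y \<in> n_ideal"
  using left_ideal.add[of x _ _ "- y"] n_ideal_uminus by simp

definition cong_n :: "uea \<Rightarrow> uea \<Rightarrow> bool" (infix "\<simeq>" 50) where
  "x \<simeq> y \<longleftrightarrow> x - y \<in> n_ideal"

lemma cong_n_refl [simp]: "x \<simeq> x"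
  by (simp add: cong_n_def left_ideal.zero)

lemma cong_n_sym: "x \<simeq> y \<Longrightarrow> y \<simeq> x"
  unfolding cong_n_def by (metis minus_diff_eq n_ideal_uminus)

lemma cong_n_trans [trans]: "x \<simeq> y \<Longrightarrow> y \<simeq> z \<Longrightarrow> x \<simeq> z"
  unfolding cong_n_def by (drule (1) left_ideal.add) simp

lemma cong_n_add: "x \<simeq> y \<Longrightarrow> x' \<simeq> y' \<Longrightarrow> x + x' \<simeq> y + y'"
  unfolding cong_n_def by (metis add_diff_add left_ideal.add)

lemma cong_n_mult: "x \<simeq> y \<Longrightarrow> a \<in> U_g \<Longrightarrow> a * x \<simeq> a * y"
  unfolding cong_n_def by (metis n_ideal_mult right_diff_distrib)

lemma cong_n_of_int: "x \<simeq> y \<Longrightarrow> of_int c * x \<simeq> of_int c * y"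
  by (rule cong_n_mult) (simp_all add: U_g_def subalgebra_of_int)

lemma cong_n_sum: "(\<And>i. i \<in> A \<Longrightarrow> f i \<simeq> g i) \<Longrightarrow> sum f A \<simeq> sum g A"
  by (induction A rule: infinite_finite_induct) (auto intro: cong_n_add)

lemma cong_n_sum_list: "(\<And>i. i \<in> set A \<Longrightarrow> f i \<simeq> g i) \<Longrightarrow> (\<Sum>i\<leftarrow>A. f i) \<simeq> (\<Sum>i\<leftarrow>A. g i)"
  by (induction A) (auto intro: cong_n_add)

subsection \<open>Normal ordering\<close>

definition lp :: "basis \<Rightarrow> num \<Rightarrow> uea" where
  "lp x r = loop (bas x) (- numeral r)"

lemma lp_in_U_g: "lp x r \<in> U_g"
  unfolding U_g_def lp_def by (intro subalgebra.base loop_in_neg_modes) (simp_all add: bas_in_lie_g)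

lemma bas_in_lie_h: "\<not> pos x \<Longrightarrow> \<not> neg x \<Longrightarrow> bas x \<in> lie_h"
  unfolding lie_h_def by (cases x) (auto simp: pos_def neg_def intro: mat7.span_base)

lemma lp_in_U_h: "\<not> pos x \<Longrightarrow> \<not> neg x \<Longrightarrow> lp x r \<in> U_h"
  unfolding U_h_def lp_def by (intro subalgebra.base loop_in_neg_modes) (simp_all add: bas_in_lie_h)

lemma scaleR_mat7_span: "X \<in> mat7.span S \<Longrightarrow> c *\<^sub>R X \<in> mat7.span S"
  by (metis mat7.span_scale mscale_of_real)

text \<open>Translates the spanning set of \<open>lie_n_minus\<close> into the rescaled short root
  vectors of \<open>bas\<close>.\<close>

lemma G_flip_span:
  "G 4 2 \<in> mat7.span S \<Longrightarrow> G 3 7 \<in> mat7.span S"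
  "G 4 1 \<in> mat7.span S \<Longrightarrow> G 2 5 \<in> mat7.span S"
  "G 3 4 \<in> mat7.span S \<Longrightarrow> G 6 1 \<in> mat7.span S"
proof -
  have "G 3 7 = (- 1 / rt2) *\<^sub>R G 4 2" "G 2 5 = (- 1 / rt2) *\<^sub>R G 4 1" "G 6 1 = (- 1 / rt2) *\<^sub>R G 3 4"
    using G_relations by simp_all
  then show
    "G 4 2 \<in> mat7.span S \<Longrightarrow> G 3 7 \<in> mat7.span S"
    "G 4 1 \<in> mat7.span S \<Longrightarrow> G 2 5 \<in> mat7.span S"
    "G 3 4 \<in> mat7.span S \<Longrightarrow> G 6 1 \<in> mat7.span S"
    using scaleR_mat7_span by metis+
qed

lemma bas_in_lie_n_minus: "neg x \<Longrightarrow> bas x \<in> lie_n_minus"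
  unfolding lie_n_minus_def
  by (cases x) (auto simp: neg_def intro: mat7.span_base G_flip_span)

lemma lp_neg: "neg x \<Longrightarrow> lp x r \<simeq> 0"
  using left_ideal.base[of 1 U_g "lp x r" "neg_modes lie_n_minus"] subalgebra_of_int[of 1]
  by (simp add: cong_n_def lp_def U_g_def loop_in_neg_modes bas_in_lie_n_minus)

lemma scaleR_of_int: "of_int c *\<^sub>R x = of_int c * x" for x :: uea
  by (simp add: scaleR_conv_of_real)

text \<open>Both modes are negative, so they never add up to zero and the central term is
  absent.\<close>

lemma lp_commute:
  "lp x r * lp y q = lp y q * lp x r + (\<Sum>(c, z)\<leftarrow>br x y. of_int c * lp z (r + q))"
proof -
  have "lp x r * lp y q - lp y q * lp x r = loop (bracket (bas x) (bas y)) (- numeral (r + q))"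
    using loop_bracket[OF bas_in_lie_g bas_in_lie_g, of x "- numeral r" y "- numeral q"]
    by (simp add: lp_def)
  also have "\<dots> = (\<Sum>(c, z)\<leftarrow>br x y. of_int c * lp z (r + q))"
  proof -
    have "loop (\<Sum>(c, z)\<leftarrow>zs. of_int c *\<^sub>R bas z) m = (\<Sum>(c, z)\<leftarrow>zs. of_int c * loop (bas z) m)" for zs m
      using loop_sum_list[of zs "\<lambda>(c, z). of_int c *\<^sub>R bas z" m]
      by (auto simp: scaleR_in_lie_g bas_in_lie_g loop_scaleR scaleR_of_int case_prod_unfold)
    then show ?thesis by (simp add: bracket_bas lp_def)
  qed
  finally show ?thesis by (simp add: algebra_simps)
qed

text \<open>
  A trie stands for an integral combination of words: \<open>Node x r s t\<close> is $x[-r] \cdot s + t$.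
  The modes have type \<^typ>\<open>num\<close> since only strictly negative powers of $t$ occur.
\<close>

datatype trie = Leaf int | Node basis num trie trie

primrec val :: "trie \<Rightarrow> uea" where
  "val (Leaf c) = of_int c"
| "val (Node x r s t) = lp x r * val s + val t"

text \<open>Siblings are merged in increasing order and empty branches are dropped, so a combination
  that cancels becomes literally \<open>Leaf 0\<close>, the form compared in
  \<open>defects_vanish\<close>.\<close>

fun add :: "trie \<Rightarrow> trie \<Rightarrow> trie" where
  "add (Leaf a) (Leaf b) = Leaf (a + b)"
| "add (Leaf a) (Node x r s t) = Node x r s (add (Leaf a) t)"
| "add (Node x r s t) (Leaf a) = Node x r s (add t (Leaf a))"
| "add (Node x r s t) (Node y q u v) =
    (if x = y \<and> r = q then
       (let z = add s u; w = add t v in if z = Leaf 0 then w else Node x r z w)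
     else if bas_no x < bas_no y \<or> x = y \<and> r < q then Node x r s (add t (Node y q u v))
     else Node y q u (add (Node x r s t) v))"

primrec scale :: "int \<Rightarrow> trie \<Rightarrow> trie" where
  "scale c (Leaf a) = Leaf (c * a)"
| "scale c (Node x r s t) = Node x r (scale c s) (scale c t)"

text \<open>\<open>scale 0\<close> would keep every branch with zero leaves, and zero would no
  longer be \<open>Leaf 0\<close>.\<close>

definition smul :: "int \<Rightarrow> trie \<Rightarrow> trie" where
  "smul c t = (if c = 0 then Leaf 0 else if c = 1 then t else scale c t)"

definition cons :: "basis \<Rightarrow> num \<Rightarrow> trie \<Rightarrow> trie" where
  "cons x r t = (if t = Leaf 0 then t else Node x r t (Leaf 0))"

text \<open>
  Left multiplication modulo the left ideal.  Cartan letters are sorted behind the letters from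
  $\mathfrak n_+$, which keeps the words of weight zero in normal form; the letters from $\mathfrak n_+$
  need no sorting, because no word of weight zero that contains one survives.
\<close>

fun act :: "basis \<Rightarrow> num \<Rightarrow> trie \<Rightarrow> trie" where
  "act x r (Leaf a) = (if neg x \<or> a = 0 then Leaf 0 else Node x r (Leaf a) (Leaf 0))"
| "act x r (Node y q s t) =
    (if pos x then Node x r (Node y q s t) (Leaf 0)
     else if \<not> neg x \<and> \<not> pos y \<and> (bas_no x < bas_no y \<or> x = y \<and> r \<le> q)
       then Node x r (Node y q s t) (Leaf 0)
     else add (foldr (\<lambda>(c, z). add (smul c (act z (r + q) s))) (br x y) (cons y q (act x r s)))
       (act x r t))"

lemma val_add [simp]: "val (add s t) = val s + val t"
  by (induction s t rule: add.induct) (auto simp: Let_def algebra_simps, metis distrib_left mult_zero_right)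

lemma val_scale: "val (scale c t) = of_int c * val t"
proof (induction t)
  case (Node x r s t)
  then show ?case
    by (simp add: algebra_simps) (metis mult.assoc mult_of_int_commute)
qed simp

lemma val_smul [simp]: "val (smul c t) = of_int c * val t"
  by (simp add: smul_def val_scale)

lemma val_cons [simp]: "val (cons x r t) = lp x r * val t"
  by (simp add: cons_def)

lemma val_foldr_add:
  "val (foldr (\<lambda>(c, z). add (smul c (f z))) zs t) = (\<Sum>(c, z)\<leftarrow>zs. of_int c * val (f z)) + val t"
  by (induction zs) (auto simp: algebra_simps)

text \<open>Moving x[-r] past the first letter y[-q] of a word leaves the shorter word with
  [x, y][-(r + q)] in front. A term is discarded only at a leaf, where a letter from n_- meets a
  scalar; everywhere else the two sides are equal, and the induction hypotheses pass through left
  factors.\<close>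

lemma val_act: "val (act x r t) \<simeq> lp x r * val t"
proof (induction x r t rule: act.induct)
  case (1 x r a)
  have "of_int a * lp x r \<simeq> of_int a * 0" if "neg x"
    using lp_neg[OF that] by (rule cong_n_of_int)
  then show ?case
    by (auto intro: cong_n_sym simp: mult_of_int_commute)
next
  case (2 x r y q s t)
  show ?case
  proof (cases "pos x \<or> \<not> neg x \<and> \<not> pos y \<and> (bas_no x < bas_no y \<or> x = y \<and> r \<le> q)")
    case True
    then show ?thesis by auto
  next
    case False
    then have *: "\<not> pos x" "\<not> (\<not> neg x \<and> \<not> pos y \<and> (bas_no x < bas_no y \<or> x = y \<and> r \<le> q))"
      by blast+
    have "act x r (Node y q s t) =
        add (foldr (\<lambda>(c, z). add (smul c (act z (r + q) s))) (br x y) (cons y q (act x r s))) (act x r t)"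
      by (subst act.simps(2)) (simp only: * if_False)
    then have "val (act x r (Node y q s t)) =
        (\<Sum>(c, z)\<leftarrow>br x y. of_int c * val (act z (r + q) s)) + lp y q * val (act x r s) + val (act x r t)"
      by (simp add: val_foldr_add)
    also have "\<dots> \<simeq> (\<Sum>(c, z)\<leftarrow>br x y. of_int c * (lp z (r + q) * val s)) + lp y q * (lp x r * val s)
        + lp x r * val t"
      using 2[OF *]
      by (intro cong_n_add cong_n_mult cong_n_sum_list) (auto intro: cong_n_of_int simp: lp_in_U_g)
    also have "\<dots> = lp x r * val (Node y q s t)"
    proof -
      have "(\<Sum>(c, z)\<leftarrow>zs. of_int c * (lp z (r + q) * val s)) =
          (\<Sum>(c, z)\<leftarrow>zs. of_int c * lp z (r + q)) * val s" for zs
        by (induction zs) (auto simp: algebra_simps)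
      then show ?thesis
        using lp_commute[of x r y q] by (simp add: algebra_simps flip: mult.assoc)
    qed
    finally show ?thesis .
  qed
qed

subsection \<open>Traces of matrix products\<close>

primrec row_no :: "row \<Rightarrow> nat" where
  "row_no R1 = 0"
| "row_no R2 = 1"
| "row_no R3 = 2"
| "row_no R4 = 3"
| "row_no R5 = 4"
| "row_no R6 = 5"
| "row_no R7 = 6"

definition rows :: "row list" where
  "rows = [R1, R2, R3, R4, R5, R6, R7]"

lemma UNIV_row: "UNIV = {R1, R2, R3, R4, R5, R6, R7}"
proof (rule UNIV_eq_I)
  show "j \<in> {R1, R2, R3, R4, R5, R6, R7}" for j
    by (cases j) simp_all
qed

lemma finite_row [simp]: "finite (UNIV :: row set)"
  by (simp add: UNIV_row)

lemma nth_rows: "rows ! row_no j = j"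
  by (cases j) (simp_all add: rows_def)

lemma row_no_less: "row_no j < length rows"
  by (cases j) (simp_all add: rows_def)

lemma range_idx: "range idx = UNIV"
proof -
  have "card (range idx) = card (UNIV :: row set)"
    by (rule card_image) (simp add: inj_def inj_idx)
  also have "\<dots> = CARD(7)"
    by (simp add: UNIV_row)
  finally show ?thesis
    by (simp add: card_eq_UNIV_imp_eq_UNIV)
qed

lemma all_idx: "(\<forall>i. P i) \<longleftrightarrow> (\<forall>k. P (idx k))"
proof -
  have "(\<forall>i. P i) \<longleftrightarrow> (\<forall>i\<in>range idx. P i)"
    by (simp add: range_idx)
  then show ?thesis by simp
qed

lemma sum_idx: "(\<Sum>i\<in>UNIV. f i) = (\<Sum>k\<in>UNIV. f (idx k))"
proof -
  have "sum f (range idx) = (\<Sum>k\<in>UNIV. f (idx k))"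
    by (subst sum.reindex) (simp_all add: inj_def inj_idx)
  then show ?thesis by (simp add: range_idx)
qed

definition conj_dg :: "uea^7^7 \<Rightarrow> uea^7^7" where
  "conj_dg A = (\<chi> j i. (dg j / dg i) *\<^sub>R A $ j $ i)"

lemma conj_dg_mult: "conj_dg (A ** B) = conj_dg A ** conj_dg B"
  by (simp add: conj_dg_def matrix_matrix_mult_def vec_eq_iff scaleR_sum_right)

lemma conj_dg_mat_1: "conj_dg (mat 1) = mat 1"
  by (simp add: conj_dg_def mat_def vec_eq_iff)

lemma trace_conj_dg: "trace (conj_dg A) = trace A"
  by (simp add: conj_dg_def trace_def)

definition Ghat :: "num \<Rightarrow> uea^7^7" where
  "Ghat r = conj_dg (Gmat (- numeral r))"

lemma Ghat_entry:
  "Ghat r $ idx j $ idx i = (\<Sum>(c, k, x)\<leftarrow>g_row j. if k = i then of_int c * lp x r else 0)"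
proof -
  have "Ghat r $ idx j $ idx i = loop ((dg (idx j) / dg (idx i)) *\<^sub>R G (idx i) (idx j)) (- numeral r)"
    by (simp add: Ghat_def conj_dg_def Gmat_def loop_scaleR G_in_lie_g)
  also have "\<dots> = loop (\<Sum>(c, k, x)\<leftarrow>g_row j. if k = i then of_int c *\<^sub>R bas x else 0) (- numeral r)"
    by (simp only: g_row_correct)
  also have "\<dots> = (\<Sum>(c, k, x)\<leftarrow>g_row j. loop (if k = i then of_int c *\<^sub>R bas x else 0) (- numeral r))"
    unfolding case_prod_unfold
    by (rule loop_sum_list[THEN conjunct2])
      (simp add: scaleR_in_lie_g bas_in_lie_g mat7.subspace_0[OF lie_g_subspace])
  also have "\<dots> = (\<Sum>(c, k, x)\<leftarrow>g_row j. if k = i then of_int c * lp x r else 0)"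
    by (rule arg_cong[where f = sum_list], rule map_cong)
      (auto simp: loop_0 loop_scaleR bas_in_lie_g scaleR_of_int lp_def)
  finally show ?thesis .
qed

definition row_act :: "row \<Rightarrow> num \<Rightarrow> trie list \<Rightarrow> trie" where
  "row_act j r v = foldr (\<lambda>(c, k, x). add (smul c (act x r (v ! row_no k)))) (g_row j) (Leaf 0)"

definition step :: "num \<Rightarrow> trie list \<Rightarrow> trie list" where
  "step r v = map (\<lambda>j. row_act j r v) rows"

definition unit_col :: "row \<Rightarrow> trie list" where
  "unit_col i = map (\<lambda>j. Leaf (if j = i then 1 else 0)) rows"

definition repr_col :: "trie list \<Rightarrow> uea^7^7 \<Rightarrow> row \<Rightarrow> bool" where
  "repr_col v M i \<longleftrightarrow> (\<forall>j. val (v ! row_no j) \<simeq> M $ idx j $ idx i)"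

lemma repr_unit_col: "repr_col (unit_col i) (mat 1) i"
  by (simp add: repr_col_def unit_col_def mat_def inj_idx row_no_less nth_rows)

lemma val_row_act:
  assumes "repr_col v M i"
  shows "val (row_act j r v) \<simeq> (Ghat r ** M) $ idx j $ idx i"
proof -
  have "val (row_act j r v) = (\<Sum>(c, k, x)\<leftarrow>g_row j. of_int c * val (act x r (v ! row_no k)))"
  proof -
    have "val (foldr (\<lambda>(c, k, x). add (smul c (act x r (v ! row_no k)))) es (Leaf 0)) =
        (\<Sum>(c, k, x)\<leftarrow>es. of_int c * val (act x r (v ! row_no k)))" for es
      by (induction es) auto
    then show ?thesis by (simp add: row_act_def)
  qed
  also have "\<dots> \<simeq> (\<Sum>(c, k, x)\<leftarrow>g_row j. of_int c * (lp x r * M $ idx k $ idx i))"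
  proof -
    have "val (act x r (v ! row_no k)) \<simeq> lp x r * M $ idx k $ idx i" for x k
      using val_act cong_n_mult[OF _ lp_in_U_g] assms unfolding repr_col_def
      by (meson cong_n_trans)
    then show ?thesis
      by (intro cong_n_sum_list) (auto intro: cong_n_of_int)
  qed
  also have "\<dots> = (\<Sum>k\<in>UNIV. Ghat r $ idx j $ idx k * M $ idx k $ idx i)"
  proof -
    have "(\<Sum>(c, k, x)\<leftarrow>es. of_int c * (lp x r * M $ idx k $ idx i)) =
        (\<Sum>k'\<in>UNIV. (\<Sum>(c, k, x)\<leftarrow>es. if k = k' then of_int c * lp x r else 0) * M $ idx k' $ idx i)" for es
    proof (induction es)
      case (Cons e es)
      obtain c k x where e: "e = (c, k, x)" by (cases e)
      have "(\<Sum>k'\<in>UNIV. (if k = k' then of_int c * lp x r else 0) * M $ idx k' $ idx i) =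
          of_int c * lp x r * M $ idx k $ idx i"
        by (simp add: if_distrib[of "\<lambda>x. x * _"] cong: if_cong)
      with Cons show ?case
        by (simp add: e distrib_right sum.distrib mult.assoc)
    qed simp
    then show ?thesis by (simp add: Ghat_entry)
  qed
  also have "\<dots> = (Ghat r ** M) $ idx j $ idx i"
    by (simp add: matrix_matrix_mult_def sum_idx)
  finally show ?thesis .
qed

lemma repr_step: "repr_col v M i \<Longrightarrow> repr_col (step r v) (Ghat r ** M) i"
  unfolding repr_col_def[of "step r v"] by (simp add: step_def row_no_less nth_rows val_row_act)

lemma trace_repr:
  assumes "\<And>i. repr_col (v i) M i"
  shows "(\<Sum>i\<in>UNIV. val (row_act i r (v i))) \<simeq> trace (Ghat r ** M)"
  unfolding trace_def sum_idx by (intro cong_n_sum val_row_act assms)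

subsection \<open>Invariance under the Cartan subalgebra\<close>

lemma bracket_add: "bracket (X + Y) Z = bracket X Z + bracket Y Z" "bracket Z (X + Y) = bracket Z X + bracket Z Y"
  by (simp_all add: bracket_def matrix_add_rdistrib matrix_add_ldistrib)

lemma bracket_mscale:
  "bracket (mscale c X) Z = mscale c (bracket X Z)" "bracket Z (mscale c X) = mscale c (bracket Z X)"
  by (simp_all add: bracket_def mscale_def matrix_matrix_mult_def vec_eq_iff sum_distrib_left
      right_diff_distrib ac_simps)

lemma bracket_scaleR: "bracket Z (c *\<^sub>R X) = c *\<^sub>R bracket Z X"
  by (simp add: bracket_mscale flip: mscale_of_real)

lemma bracket_diff: "bracket Z (X - Y) = bracket Z X - bracket Z Y"
  using bracket_add(2)[of Z "X - Y" Y] by simp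

lemma bracket_0: "bracket 0 Z = 0" "bracket Z 0 = 0"
  by (simp_all add: bracket_def)

lemma bracket_uminus: "bracket Z (- X) = - bracket Z X"
  using bracket_diff[of Z 0 X] by (simp add: bracket_0)

text \<open>For H in h one has H_11 + H_22 + H_33 = 0 and H_{i'i'} = - H_ii, so for instance F_{14}
  and F_{3'2} have equal weight. Hence G_{ij} has the weight of E_{ij}, although it may mix two root
  vectors of o_7.\<close>

definition is_weight :: "mat7 \<Rightarrow> bool" where
  "is_weight H \<longleftrightarrow> (\<forall>i j. bracket H (G i j) = mscale (H $ i $ i - H $ j $ j) (G i j))"

lemma diag_entries:
  "G 1 1 $ idx k $ idx k = of_int (case k of R1 \<Rightarrow> 2 | R2 \<Rightarrow> -1 | R3 \<Rightarrow> -1 | R4 \<Rightarrow> 0 | R5 \<Rightarrow> 1 | R6 \<Rightarrow> 1 | R7 \<Rightarrow> -2)"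
  "G 2 2 $ idx k $ idx k = of_int (case k of R1 \<Rightarrow> -1 | R2 \<Rightarrow> 2 | R3 \<Rightarrow> -1 | R4 \<Rightarrow> 0 | R5 \<Rightarrow> 1 | R6 \<Rightarrow> -2 | R7 \<Rightarrow> 1)"
  by (cases k; simp add: G_values_diag F_def E_def scaleR_conv_of_real[where 'a = complex])+

lemma mscale_of_int: "mscale (of_int c) X = of_int c *\<^sub>R X"
  using mscale_of_real[of "of_int c" X] by simp

lemma is_weight_Cartan: "is_weight (G 1 1)" "is_weight (G 2 2)"
proof -
  have H: "G 1 1 = bas H1" "G 2 2 = bas H2" by simp_all
  \<comment> \<open>\<open>bracket_bas\<close> with its second argument unfolded: rewriting
    \<open>G (idx i) (idx j)\<close> ends in these fourteen matrices and not in
    \<open>bas x\<close>.\<close>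
  have br: "bracket (bas x) (G 1 1) = (\<Sum>(c, z)\<leftarrow>br x H1. of_int c *\<^sub>R bas z)"
    "bracket (bas x) (G 2 2) = (\<Sum>(c, z)\<leftarrow>br x H2. of_int c *\<^sub>R bas z)"
    "bracket (bas x) (G 1 2) = (\<Sum>(c, z)\<leftarrow>br x P1. of_int c *\<^sub>R bas z)"
    "bracket (bas x) (G 7 3) = (\<Sum>(c, z)\<leftarrow>br x P2. of_int c *\<^sub>R bas z)"
    "bracket (bas x) (G 5 2) = (\<Sum>(c, z)\<leftarrow>br x P3. of_int c *\<^sub>R bas z)"
    "bracket (bas x) (G 1 6) = (\<Sum>(c, z)\<leftarrow>br x P4. of_int c *\<^sub>R bas z)"
    "bracket (bas x) (G 2 3) = (\<Sum>(c, z)\<leftarrow>br x P5. of_int c *\<^sub>R bas z)"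
    "bracket (bas x) (G 1 3) = (\<Sum>(c, z)\<leftarrow>br x P6. of_int c *\<^sub>R bas z)"
    "bracket (bas x) (G 2 1) = (\<Sum>(c, z)\<leftarrow>br x N1. of_int c *\<^sub>R bas z)"
    "bracket (bas x) (G 3 7) = (\<Sum>(c, z)\<leftarrow>br x N2. of_int c *\<^sub>R bas z)"
    "bracket (bas x) (G 2 5) = (\<Sum>(c, z)\<leftarrow>br x N3. of_int c *\<^sub>R bas z)"
    "bracket (bas x) (G 6 1) = (\<Sum>(c, z)\<leftarrow>br x N4. of_int c *\<^sub>R bas z)"
    "bracket (bas x) (G 3 2) = (\<Sum>(c, z)\<leftarrow>br x N5. of_int c *\<^sub>R bas z)"
    "bracket (bas x) (G 3 1) = (\<Sum>(c, z)\<leftarrow>br x N6. of_int c *\<^sub>R bas z)" for x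
    by (simp_all add: bracket_bas flip: bas.simps del: bas.simps)
  have "bracket (bas H1) (G (idx i) (idx j)) = mscale (G 1 1 $ idx i $ idx i - G 1 1 $ idx j $ idx j) (G (idx i) (idx j))"
    "bracket (bas H2) (G (idx i) (idx j)) = mscale (G 2 2 $ idx i $ idx i - G 2 2 $ idx j $ idx j) (G (idx i) (idx j))" for i j
    unfolding diag_entries of_int_diff[symmetric] mscale_of_int
    by (cases i; cases j; simp add: br G_reflect G_anti_diagonal G_3_3 G_relations bracket_uminus
        bracket_scaleR bracket_diff bracket_add bracket_0 del: bas.simps; simp add: scaleR_2)+
  then show "is_weight (G 1 1)" "is_weight (G 2 2)"
    unfolding is_weight_def by (subst all_idx, subst all_idx, simp)+
qed

lemma is_weight_lie_h: "H \<in> lie_h \<Longrightarrow> is_weight H"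
  unfolding lie_h_def
proof (induction rule: mat7.span_induct)
  show "mat7.subspace (Collect is_weight)"
    by (rule mat7.subspaceI)
      (auto simp: is_weight_def bracket_add bracket_mscale bracket_0,
       auto simp: mscale_def vec_eq_iff algebra_simps)
qed (use is_weight_Cartan in auto)

lemma bracket_lie_h:
  assumes "H \<in> lie_h" "X \<in> lie_h"
  shows "bracket H X = 0"
  using assms(2) unfolding lie_h_def
proof (induction rule: mat7.span_induct)
  show "mat7.subspace {X. bracket H X = 0}"
    by (rule mat7.subspaceI) (auto simp: bracket_add bracket_mscale bracket_0)
qed (use is_weight_lie_h[OF assms(1)] in \<open>auto simp: is_weight_def\<close>)

lemma commute_lie_h:
  assumes "H \<in> lie_h" "X \<in> lie_h" "r < 0" "s \<le> 0"
  shows "loop H s * loop X r = loop X r * loop H s"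
  using loop_bracket[of H X s r] assms span_mono_lie(1) by (simp add: bracket_lie_h loop_0 subset_iff)

definition invariant :: "uea^7^7 \<Rightarrow> bool" where
  "invariant A \<longleftrightarrow> (\<forall>j i. A $ j $ i \<in> U_g) \<and> (\<forall>H\<in>lie_h. \<forall>j i.
     loop H 0 * A $ j $ i - A $ j $ i * loop H 0 = cscale (H $ i $ i - H $ j $ j) (A $ j $ i))"

lemma invariant_Gmat: "r < 0 \<Longrightarrow> invariant (Gmat r)"
  using span_mono_lie is_weight_lie_h
  by (auto simp: invariant_def Gmat_def loop_bracket G_in_lie_g is_weight_def loop_mscale U_g_def
      intro!: subalgebra.base loop_in_neg_modes)

lemma invariant_mat_1: "invariant (mat 1)"
  using subalgebra_0 subalgebra_of_int[of 1] by (auto simp: invariant_def mat_def U_g_def)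

text \<open>Weights telescope: the entries (j,k) and (k,i) have weights H_kk - H_jj and H_ii - H_kk,
  whose sum does not depend on k. Diagonal entries thus have weight zero.\<close>

lemma invariant_mult:
  assumes "invariant A" "invariant B"
  shows "invariant (A ** B)"
proof -
  have "loop H 0 * (A ** B) $ j $ i - (A ** B) $ j $ i * loop H 0 =
      cscale (H $ i $ i - H $ j $ j) ((A ** B) $ j $ i)" if "H \<in> lie_h" for H j i
  proof -
    have "loop H 0 * (A $ j $ k * B $ k $ i) - A $ j $ k * B $ k $ i * loop H 0 =
        cscale (H $ i $ i - H $ j $ j) (A $ j $ k * B $ k $ i)" for k
    proof -
      have "loop H 0 * (A $ j $ k * B $ k $ i) - A $ j $ k * B $ k $ i * loop H 0 =
          (loop H 0 * A $ j $ k - A $ j $ k * loop H 0) * B $ k $ i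
          + A $ j $ k * (loop H 0 * B $ k $ i - B $ k $ i * loop H 0)"
        by (simp add: algebra_simps)
      also have "\<dots> = cscale (H $ k $ k - H $ j $ j) (A $ j $ k * B $ k $ i)
          + cscale (H $ i $ i - H $ k $ k) (A $ j $ k * B $ k $ i)"
        using assms that by (simp add: invariant_def cscale_mult_left cscale_mult_right)
      also have "\<dots> = cscale (H $ i $ i - H $ j $ j) (A $ j $ k * B $ k $ i)"
        by (simp flip: uea.scale_left_distrib)
      finally show ?thesis .
    qed
    then show ?thesis
      by (simp add: matrix_matrix_mult_def sum_distrib_left sum_distrib_right uea.scale_sum_right
          flip: sum_subtractf)
  qed
  moreover have "(A ** B) $ j $ i \<in> U_g" for j i
    using assms unfolding invariant_def matrix_matrix_mult_def U_g_def
    by (auto intro!: subalgebra_sum subalgebra.mult)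
  ultimately show ?thesis
    by (simp add: invariant_def)
qed

lemma invariant_mpow: "invariant A \<Longrightarrow> invariant (mpow A n)"
  by (induction n) (auto intro: invariant_mat_1 invariant_mult)

lemma trace_centralizer:
  assumes "invariant A"
  shows "trace A \<in> centralizer_h"
proof -
  have "loop H 0 * A $ n $ n = A $ n $ n * loop H 0" if "H \<in> lie_h" for H n
  proof -
    have "loop H 0 * A $ n $ n - A $ n $ n * loop H 0 = cscale (H $ n $ n - H $ n $ n) (A $ n $ n)"
      using assms that unfolding invariant_def by blast
    then show ?thesis by simp
  qed
  moreover have "trace A \<in> U_g"
    using assms unfolding invariant_def trace_def U_g_def by (auto intro!: subalgebra_sum)
  ultimately show ?thesis
    by (simp add: centralizer_h_def trace_def sum_distrib_left sum_distrib_right)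
qed

lemma centralizer_add: "x \<in> centralizer_h \<Longrightarrow> y \<in> centralizer_h \<Longrightarrow> x + y \<in> centralizer_h"
  by (auto simp: centralizer_h_def U_g_def algebra_simps intro: subalgebra.add)

lemma centralizer_scaleR: "x \<in> centralizer_h \<Longrightarrow> c *\<^sub>R x \<in> centralizer_h"
  by (auto simp: centralizer_h_def U_g_def intro: subalgebra_scaleR)

lemma centralizer_diff: "x \<in> centralizer_h \<Longrightarrow> y \<in> centralizer_h \<Longrightarrow> x - y \<in> centralizer_h"
  using centralizer_add[of x "- 1 *\<^sub>R y"] centralizer_scaleR[of y "- 1"] by simp

lemma U_h_centralizer: "x \<in> U_h \<Longrightarrow> x \<in> centralizer_h"
proof -
  assume x: "x \<in> U_h"
  have "loop H 0 * x = x * loop H 0" if "H \<in> lie_h" for H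
    using x unfolding U_h_def
  proof (induction rule: subalgebra.induct)
    case (base x)
    then show ?case using that commute_lie_h by (auto simp: neg_modes_def)
  next
    case (scalar c)
    show ?case by (simp add: cscale_mult_left cscale_mult_right)
  next
    case (mult x y)
    then show ?case by (metis mult.assoc)
  qed (simp add: algebra_simps)
  then show ?thesis using U_h_subset[OF x] by (simp add: centralizer_h_def)
qed

lemma Segal_Sugawara_centralizer:
  "S2 \<in> centralizer_h" "S3 \<in> centralizer_h" "S4 \<in> centralizer_h" "S5 \<in> centralizer_h" "S6 \<in> centralizer_h"
  unfolding S2_def S3_def S4_def S5_def S6_def
  by (intro centralizer_add centralizer_diff centralizer_scaleR trace_centralizer invariant_mult
      invariant_mpow invariant_Gmat; simp)+

subsection \<open>Evaluation modules\<close>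

text \<open>The excluded evaluation point \<open>0\<close> is replaced by \<open>1\<close>, so that \<open>pt c\<close> is always invertible.\<close>

definition pt :: "complex \<Rightarrow> complex fps" where
  "pt c = fps_const (if c = 0 then 1 else c) + fps_X"

definition zp :: "complex \<Rightarrow> int \<Rightarrow> complex fps" where
  "zp c r = (if r \<ge> 0 then pt c ^ nat r else inverse (pt c) ^ nat (- r))"

lemma pt_inverse: "pt c * inverse (pt c) = 1"
  by (rule inverse_mult_eq_1') (simp add: pt_def)

text \<open>With an integral exponent written as a difference of naturals, \<open>zp_add\<close>
  follows without distinguishing signs.\<close>

lemma zp_of_nat_diff: "zp c (int m - int n) = pt c ^ m * inverse (pt c) ^ n"
proof (cases "n \<le> m")
  case True
  then obtain k where m: "m = k + n" by (metis le_add_diff_inverse2)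
  show ?thesis
    by (simp add: zp_def m power_add mult.assoc pt_inverse flip: power_mult_distrib)
next
  case False
  then obtain k where n: "n = m + k" by (metis le_add_diff_inverse nat_le_linear)
  have "pt c ^ m * inverse (pt c) ^ n = (pt c * inverse (pt c)) ^ m * inverse (pt c) ^ k"
    by (simp only: n power_add power_mult_distrib mult.assoc)
  then show ?thesis
    using False by (auto simp: zp_def n pt_inverse)
qed

lemma int_diff_exhaust:
  obtains m n where "(r :: int) = int m - int n"
  by (metis diff_0_right int_diff_cases)

lemma zp_0 [simp]: "zp c 0 = 1"
  by (simp add: zp_def)

lemma zp_add: "zp c (r + s) = zp c r * zp c s"
proof -
  obtain m n where r: "r = int m - int n" by (rule int_diff_exhaust)
  obtain k l where s: "s = int k - int l" by (rule int_diff_exhaust)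
  have "r + s = int (m + k) - int (n + l)" by (simp add: r s)
  then show ?thesis by (simp only: r s zp_of_nat_diff) (simp add: power_add)
qed

lemma zp_neg: "zp c (- int k) = inverse (pt c) ^ k"
  by (cases k) (simp_all add: zp_def del: of_nat_Suc)

lemma fps_deriv_zp: "fps_deriv (zp c r) = of_int r * zp c (r - 1)"
proof -
  have nz: "fps_nth (pt c) 0 \<noteq> 0" and d: "fps_deriv (pt c) = 1" by (simp_all add: pt_def)
  have pw: "fps_deriv (f ^ k) = of_nat k * f ^ (k - 1) * fps_deriv f" for f :: "complex fps" and k
    by (simp add: fps_deriv_power fps_of_nat)
  show ?thesis
  proof (cases "r \<ge> 0")
    case True
    then show ?thesis
      by (cases "r = 0") (auto simp: zp_def pw d nat_diff_distrib)
  next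
    case False
    then obtain k where r: "r = - int (Suc k)"
      by (metis int_cases nat_le_iff negative_zle not_le zero_le_imp_eq_int of_nat_0_le_iff)
    have "fps_deriv (zp c r) = of_nat (Suc k) * inverse (pt c) ^ k * (- (inverse (pt c))\<^sup>2)"
      using fps_inverse_deriv[OF nz] by (simp add: zp_neg r pw d del: of_nat_Suc power_Suc)
    also have "\<dots> = of_int r * zp c (- int (Suc (Suc k)))"
      unfolding zp_neg by (simp add: r power2_eq_square algebra_simps)
    finally show ?thesis by (simp add: r)
  qed
qed

lemma zp_nth_0: "c \<noteq> 0 \<Longrightarrow> fps_nth (zp c (- int k)) 0 = (1 / c) ^ k"
  by (simp add: zp_neg pt_def fps_nth_power_0 power_divide divide_inverse)

lemma fps_const_sum: "fps_const (sum f A) = (\<Sum>i\<in>A. fps_const (f i))" for f :: "_ \<Rightarrow> complex"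
  by (induction A rule: infinite_finite_induct) (simp_all flip: fps_const_add)

section \<open>The action on coordinate functions\<close>

type_synonym site = "7 \<times> 7"
text \<open>A vector is given by its coordinates; a basis state assigns a pair of indices to every
  natural number, and the operators change only the positions below \<open>length L\<close>. This
  gives one type for all numbers of tensor factors.\<close>

type_synonym vec_fps = "(nat \<Rightarrow> site) \<Rightarrow> complex fps"

text \<open>The matrix of X (x) 1 + 1 (x) X on the tensor square of C^7.\<close>

definition rho :: "mat7 \<Rightarrow> site \<Rightarrow> site \<Rightarrow> complex" where
  "rho X i j = (if snd i = snd j then X $ fst i $ fst j else 0) + (if fst i = fst j then X $ snd i $ snd j else 0)"

text \<open>The cross terms X (x) Y + Y (x) X of the product are symmetric in X and Y and cancel in
  the commutator.\<close>

lemma rho_bracket: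
  "(\<Sum>j\<in>UNIV. rho X i j * rho Y j k) - (\<Sum>j\<in>UNIV. rho Y i j * rho X j k) = rho (bracket X Y) i k"
proof -
  have *: "(\<Sum>j\<in>UNIV. rho X i j * rho Y j k) =
      (if snd i = snd k then (X ** Y) $ fst i $ fst k else 0) + X $ fst i $ fst k * Y $ snd i $ snd k
      + (Y $ fst i $ fst k * X $ snd i $ snd k + (if fst i = fst k then (X ** Y) $ snd i $ snd k else 0))" for X Y
  proof -
    obtain a b where i: "i = (a, b)" by (cases i)
    obtain c d where k: "k = (c, d)" by (cases k)
    have "(\<Sum>j\<in>UNIV. rho X i j * rho Y j k) = (\<Sum>x\<in>UNIV. \<Sum>y\<in>UNIV. rho X (a, b) (x, y) * rho Y (x, y) (c, d))"
      by (simp add: i k sum.cartesian_product flip: UNIV_Times_UNIV)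
    also have "\<dots> = (\<Sum>x\<in>UNIV. \<Sum>y\<in>UNIV.
        (if b = y then (if y = d then X $ a $ x * Y $ x $ c else 0) else 0)
        + (if b = y then (if x = c then X $ a $ x * Y $ y $ d else 0) else 0)
        + ((if a = x then (if y = d then X $ b $ y * Y $ x $ c else 0) else 0)
        + (if a = x then (if x = c then X $ b $ y * Y $ y $ d else 0) else 0)))"
      by (intro sum.cong refl) (simp add: rho_def algebra_simps)
    also have "\<dots> = (if b = d then (X ** Y) $ a $ c else 0) + X $ a $ c * Y $ b $ d
      + (Y $ a $ c * X $ b $ d + (if a = c then (X ** Y) $ b $ d else 0))"
      by (simp add: sum.distrib matrix_matrix_mult_def if_distrib[of "sum _"] mult.commute
          sum.If_cases cong: if_cong)
    finally show ?thesis by (simp add: i k)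
  qed
  show ?thesis
    unfolding * by (simp add: rho_def bracket_def)
qed

lemma rho_add: "rho (X + Y) i j = rho X i j + rho Y i j"
  by (simp add: rho_def)

lemma rho_mscale: "rho (mscale c X) i j = c * rho X i j"
  by (simp add: rho_def mscale_def algebra_simps)

definition site_op :: "nat \<Rightarrow> mat7 \<Rightarrow> vec_fps \<Rightarrow> vec_fps" where
  "site_op p X v s = (\<Sum>j\<in>UNIV. fps_const (rho X (s p) j) * v (s(p := j)))"

lemma site_op_scale: "site_op p X (\<lambda>s. f * v s) s = f * site_op p X v s"
  by (simp add: site_op_def sum_distrib_left ac_simps)

lemma site_op_sum: "site_op p X (\<lambda>s. \<Sum>q\<in>A. v q s) s = (\<Sum>q\<in>A. site_op p X (v q) s)"
  unfolding site_op_def sum_distrib_left by (rule sum.swap)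

lemma site_op_commute:
  assumes "p \<noteq> q"
  shows "site_op p X (site_op q Y v) s = site_op q Y (site_op p X v) s"
  using assms unfolding site_op_def sum_distrib_left
  by (subst sum.swap) (simp add: fun_upd_twist ac_simps)

lemma site_op_bracket:
  "site_op p X (site_op p Y v) s - site_op p Y (site_op p X v) s = site_op p (bracket X Y) v s"
proof -
  have *: "site_op p X (site_op p Y v) s =
      (\<Sum>k\<in>UNIV. fps_const (\<Sum>j\<in>UNIV. rho X (s p) j * rho Y j k) * v (s(p := k)))" for X Y
  proof -
    have "site_op p X (site_op p Y v) s =
        (\<Sum>j\<in>UNIV. \<Sum>k\<in>UNIV. fps_const (rho X (s p) j * rho Y j k) * v (s(p := k)))"
      unfolding site_op_def sum_distrib_left by (simp flip: fps_const_mult add: mult.assoc)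
    also have "\<dots> = (\<Sum>k\<in>UNIV. \<Sum>j\<in>UNIV. fps_const (rho X (s p) j * rho Y j k) * v (s(p := k)))"
      by (rule sum.swap)
    also have "\<dots> = (\<Sum>k\<in>UNIV. fps_const (\<Sum>j\<in>UNIV. rho X (s p) j * rho Y j k) * v (s(p := k)))"
      by (simp add: fps_const_sum flip: sum_distrib_right)
    finally show ?thesis .
  qed
  show ?thesis
    unfolding * unfolding site_op_def
    by (simp flip: sum_subtractf left_diff_distrib rho_bracket add: fps_const_sub)
qed

text \<open>
  A list of sites \<open>(a, c)\<close>: each carries a copy of $\mathbb C^7 \otimes \mathbb C^7$ on which $X[r]$ acts
  by $(t + c)^r X$; \<open>a\<close> selects a lowest weight vector in it.
\<close>

type_synonym config = "(bool \<times> complex) list"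

primrec gen_op :: "config \<Rightarrow> gen \<Rightarrow> vec_fps \<Rightarrow> vec_fps" where
  "gen_op L (Loop X r) v = (\<lambda>s. if X \<in> lie_g then \<Sum>p<length L. zp (snd (L ! p)) r * site_op p X v s else 0)"
| "gen_op L Cent v = (\<lambda>s. 0)"
| "gen_op L Tau v = (\<lambda>s. - fps_deriv (v s))"

lemma gen_op_linear:
  "gen_op L g (\<lambda>s. \<Sum>q\<in>A. fps_const (c q) * v q s) s = (\<Sum>q\<in>A. fps_const (c q) * gen_op L g (v q) s)"
proof (cases g)
  case (Loop X r)
  have "(\<Sum>p<length L. zp (snd (L ! p)) r * (\<Sum>q\<in>A. fps_const (c q) * site_op p X (v q) s)) =
      (\<Sum>q\<in>A. fps_const (c q) * (\<Sum>p<length L. zp (snd (L ! p)) r * site_op p X (v q) s))"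
    unfolding sum_distrib_left by (subst sum.swap) (simp add: ac_simps)
  then show ?thesis
    by (simp add: Loop site_op_sum site_op_scale)
qed (simp_all add: fps_deriv_sum sum_negf)

definition word_op :: "config \<Rightarrow> gen list \<Rightarrow> vec_fps \<Rightarrow> vec_fps" where
  "word_op L ws v = foldr (gen_op L) ws v"

lemma word_op_linear:
  "word_op L ws (\<lambda>s. \<Sum>q\<in>A. fps_const (c q) * v q s) = (\<lambda>s. \<Sum>q\<in>A. fps_const (c q) * word_op L ws (v q) s)"
  by (induction ws) (simp_all add: word_op_def gen_op_linear)

definition free_op :: "config \<Rightarrow> free_alg \<Rightarrow> vec_fps \<Rightarrow> vec_fps" where
  "free_op L x v s = (\<Sum>ws\<in>Poly_Mapping.keys x. fps_const (Poly_Mapping.lookup x ws) * word_op L ws v s)"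

lemma free_op_superset:
  assumes "finite A" "Poly_Mapping.keys x \<subseteq> A"
  shows "free_op L x v s = (\<Sum>ws\<in>A. fps_const (Poly_Mapping.lookup x ws) * word_op L ws v s)"
  unfolding free_op_def using assms by (intro sum.mono_neutral_left) (auto simp: in_keys_iff)

lemma free_op_add: "free_op L (x + y) v s = free_op L x v s + free_op L y v s"
proof -
  let ?A = "Poly_Mapping.keys x \<union> Poly_Mapping.keys y"
  have "Poly_Mapping.keys (x + y) \<subseteq> ?A"
    by (rule Poly_Mapping.keys_add)
  then show ?thesis
    using free_op_superset[of ?A x] free_op_superset[of ?A y] free_op_superset[of ?A "x + y"]
    by (simp add: lookup_add sum.distrib distrib_right flip: fps_const_add)
qed

lemma free_op_0 [simp]: "free_op L 0 v s = 0"
  by (simp add: free_op_def)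

lemma free_op_uminus: "free_op L (- x) v s = - free_op L x v s"
  using free_op_add[of L x "- x" v s] by (simp add: add_eq_0_iff)

lemma free_op_diff: "free_op L (x - y) v s = free_op L x v s - free_op L y v s"
  using free_op_add[of L x "- y" v s] by (simp add: free_op_uminus)

lemma free_op_sum: "free_op L (sum f A) v s = (\<Sum>i\<in>A. free_op L (f i) v s)"
  by (induction A rule: infinite_finite_induct) (simp_all add: free_op_add)

lemma free_op_single: "free_op L (Poly_Mapping.single ws c) v s = fps_const c * word_op L ws v s"
  using free_op_superset[of "{ws}" "Poly_Mapping.single ws c"] by (simp add: keys_single)

lemma sum_singles: "x = (\<Sum>ws\<in>Poly_Mapping.keys x. Poly_Mapping.single ws (Poly_Mapping.lookup x ws))"
  for x :: free_alg
  by (rule poly_mapping_eqI) (simp add: lookup_sum lookup_single when_def in_keys_iff)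

lemma free_op_mult: "free_op L (x * y) v = free_op L x (free_op L y v)"
proof
  fix s
  let ?l = Poly_Mapping.lookup and ?k = Poly_Mapping.keys
  have "x * y = (\<Sum>ws\<in>?k x. Poly_Mapping.single ws (?l x ws)) * (\<Sum>u\<in>?k y. Poly_Mapping.single u (?l y u))"
    by (simp flip: sum_singles)
  also have "\<dots> = (\<Sum>ws\<in>?k x. \<Sum>u\<in>?k y. Poly_Mapping.single (ws @ u) (?l x ws * ?l y u))"
    by (simp add: sum_product mult_single plus_list_def)
  finally have "free_op L (x * y) v s =
      (\<Sum>ws\<in>?k x. \<Sum>u\<in>?k y. fps_const (?l x ws * ?l y u) * word_op L (ws @ u) v s)"
    by (simp add: free_op_sum free_op_single)
  also have "\<dots> = (\<Sum>ws\<in>?k x. fps_const (?l x ws) * word_op L ws (free_op L y v) s)"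
    unfolding free_op_def[of L y v, abs_def] word_op_linear
    by (simp add: sum_distrib_left word_op_def mult.assoc flip: fps_const_mult)
  finally show "free_op L (x * y) v s = free_op L x (free_op L y v) s"
    by (simp add: free_op_def)
qed

lemma lie_g_eq: "lie_g = mat7.span (range bas)"
proof
  have "G i j \<in> mat7.span (range bas)" for i j
  proof -
    obtain i' j' where ij: "i = idx i'" "j = idx j'" using range_idx by (metis UNIV_I imageE)
    have "(\<Sum>(c, k, x)\<leftarrow>es. if k = l then of_int c *\<^sub>R bas x else 0) \<in> mat7.span (range bas)" for es and l :: row
      by (induction es)
        (auto intro!: mat7.span_add scaleR_mat7_span simp: mat7.span_zero mat7.span_base)
    then have "(dg j / dg i) *\<^sub>R G i j \<in> mat7.span (range bas)"
      unfolding ij g_row_correct by blast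
    from scaleR_mat7_span[OF this, of "dg i / dg j"] show ?thesis by simp
  qed
  then show "lie_g \<subseteq> mat7.span (range bas)"
    unfolding lie_g_def by (intro mat7.span_minimal) auto
  show "mat7.span (range bas) \<subseteq> lie_g"
    by (rule mat7.span_minimal) (auto simp: bas_in_lie_g lie_g_subspace)
qed

text \<open>The structure constants give closure on the basis, and bilinearity extends it. The
  module depends on it, because \<open>gen_op\<close> is zero on matrices outside
  \<open>lie_g\<close>.\<close>

lemma bracket_in_lie_g:
  assumes "X \<in> lie_g" "Y \<in> lie_g"
  shows "bracket X Y \<in> lie_g"
proof -
  have *: "bracket (bas x) Y \<in> lie_g" if "Y \<in> lie_g" for x Y
    using that unfolding lie_g_eq
  proof (induction rule: mat7.span_induct)
    show "mat7.subspace {Y. bracket (bas x) Y \<in> mat7.span (range bas)}"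
      by (rule mat7.subspaceI)
        (auto simp: bracket_0 bracket_add bracket_mscale intro: mat7.span_zero mat7.span_add mat7.span_scale)
  next
    fix Z assume "Z \<in> range bas"
    then obtain y where Z: "Z = bas y" by blast
    have "(\<Sum>(c, z)\<leftarrow>zs. of_int c *\<^sub>R bas z) \<in> mat7.span (range bas)" for zs
      by (induction zs) (auto intro!: mat7.span_add scaleR_mat7_span simp: mat7.span_zero mat7.span_base)
    then show "bracket (bas x) Z \<in> mat7.span (range bas)"
      by (simp add: Z bracket_bas)
  qed
  show ?thesis
    using assms(1) unfolding lie_g_eq
  proof (induction rule: mat7.span_induct)
    show "mat7.subspace {X. bracket X Y \<in> mat7.span (range bas)}"
      by (rule mat7.subspaceI)
        (auto simp: bracket_0 bracket_add bracket_mscale intro: mat7.span_zero mat7.span_add mat7.span_scale)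
  qed (use *[OF assms(2)] in \<open>auto simp: lie_g_eq\<close>)
qed

lemma gen_op_commutator:
  assumes "X \<in> lie_g" "Y \<in> lie_g"
  shows "gen_op L (Loop X r) (gen_op L (Loop Y q) v) s - gen_op L (Loop Y q) (gen_op L (Loop X r) v) s
    = gen_op L (Loop (bracket X Y) (r + q)) v s"
proof -
  let ?z = "\<lambda>p. zp (snd (L ! p))" and ?n = "length L"
  have *: "gen_op L (Loop X r) (gen_op L (Loop Y q) v) s =
      (\<Sum>p<?n. \<Sum>p'<?n. ?z p r * ?z p' q * site_op p X (site_op p' Y v) s)"
    if "X \<in> lie_g" "Y \<in> lie_g" for X Y r q
    using that by (simp add: site_op_sum site_op_scale sum_distrib_left mult.assoc)
  have "gen_op L (Loop X r) (gen_op L (Loop Y q) v) s - gen_op L (Loop Y q) (gen_op L (Loop X r) v) s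
      = (\<Sum>p<?n. \<Sum>p'<?n. ?z p r * ?z p' q * (site_op p X (site_op p' Y v) s - site_op p' Y (site_op p X v) s))"
    unfolding *[OF assms] *[OF assms(2,1)]
    by (subst (2) sum.swap) (simp add: right_diff_distrib ac_simps flip: sum_subtractf)
  \<comment> \<open>Operators at different sites commute, so only the terms with p = p' are
    left.\<close>
  also have "\<dots> = (\<Sum>p<?n. \<Sum>p'<?n. if p = p' then ?z p (r + q) * site_op p (bracket X Y) v s else 0)"
    by (intro sum.cong refl) (auto simp: site_op_bracket site_op_commute zp_add)
  also have "\<dots> = gen_op L (Loop (bracket X Y) (r + q)) v s"
    using bracket_in_lie_g[OF assms] by simp
  finally show ?thesis .
qed

lemma free_op_letter: "free_op L (letter g) v = gen_op L g v"
  by (rule ext) (simp add: free_op_single word_op_def)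

lemma free_op_const: "free_op L (const c) v s = fps_const c * v s"
  by (simp add: free_op_single word_op_def)

lemma free_op_relators: "x \<in> relators \<Longrightarrow> free_op L x v s = 0"
proof (induction rule: relators.induct)
  case (additive X Y r)
  then have "X + Y \<in> lie_g" by (simp add: mat7.subspace_add[OF lie_g_subspace])
  with additive show ?case
    by (simp add: free_op_diff free_op_add free_op_letter site_op_def rho_add distrib_right distrib_left
        sum.distrib flip: fps_const_add)
next
  case (homogeneous X c r)
  then have "mscale c X \<in> lie_g" by (simp add: mat7.subspace_scale[OF lie_g_subspace])
  with homogeneous show ?case
    by (simp add: free_op_diff free_op_mult free_op_const free_op_letter site_op_def rho_mscale
        sum_distrib_left ac_simps flip: fps_const_mult)
next
  case (loop_loop X Y r q)
  then show ?case
    using gen_op_commutator[OF loop_loop, of L r q v s]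
    by (simp add: free_op_diff free_op_add free_op_mult free_op_const free_op_letter del: gen_op.simps)
      simp
next
  case (tau_loop X r)
  \<comment> \<open>The product rule: the matrices \<open>rho X\<close> are constant in t, and (t +
    c)^r has derivative r (t + c)^(r - 1).\<close>
  have "fps_deriv (\<Sum>p<length L. zp (snd (L ! p)) r * site_op p X v s) =
      (\<Sum>p<length L. zp (snd (L ! p)) r * site_op p X (\<lambda>s. fps_deriv (v s)) s
        + of_int r * zp (snd (L ! p)) (r - 1) * site_op p X v s)"
    by (simp add: fps_deriv_sum fps_deriv_zp site_op_def)
  with tau_loop show ?case
    by (simp add: free_op_diff free_op_mult free_op_const free_op_letter site_op_def sum_negf
        sum.distrib sum_distrib_left ac_simps flip: fps_of_int fps_const_neg)
qed (simp_all add: free_op_diff free_op_mult free_op_letter site_op_def)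

lemma free_op_ideal: "x \<in> relation_ideal \<Longrightarrow> free_op L x v s = 0"
proof (induction arbitrary: v s rule: relation_ideal.induct)
  case (relator x a b)
  then have "free_op L x (free_op L b v) = (\<lambda>s. 0)" by (simp add: fun_eq_iff free_op_relators)
  moreover have "free_op L a (\<lambda>s. 0) s = 0"
    using word_op_linear[of L _ _ _ "{}"] by (simp add: free_op_def)
  ultimately show ?case by (simp add: free_op_mult)
qed (simp_all add: free_op_add)

section \<open>The action of the quotient algebra\<close>

lift_definition rep :: "config \<Rightarrow> uea \<Rightarrow> vec_fps \<Rightarrow> vec_fps" is free_op
proof -
  fix L x y assume "x - y \<in> relation_ideal"
  then show "free_op L x = free_op L y"
    using free_op_ideal[of "x - y" L] by (auto simp: fun_eq_iff free_op_diff)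
qed

lemma rep_mult: "rep L (x * y) v = rep L x (rep L y v)"
  by transfer (rule free_op_mult)

lemma rep_add: "rep L (x + y) v s = rep L x v s + rep L y v s"
  by transfer (rule free_op_add)

lemma rep_0 [simp]: "rep L 0 v s = 0"
  by transfer simp

lemma rep_1 [simp]: "rep L 1 v s = v s"
  by transfer (simp add: free_op_const flip: const_1)

lemma rep_cscale: "rep L (cscale c x) v s = fps_const c * rep L x v s"
  by transfer (simp add: free_op_mult free_op_const)

lemma rep_loop: "rep L (loop X r) v = gen_op L (Loop X r) v"
  by transfer (rule free_op_letter)

lemma rep_tau: "rep L tau v = (\<lambda>s. - fps_deriv (v s))"
  by transfer (simp add: free_op_letter)

subsection \<open>Lowest weight vectors and characters\<close>

text \<open>The vectors e_3 (x) e_3 and e_3 (x) e_7 - e_7 (x) e_3. Elements of n_- kill e_3 and send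
  e_7 to a multiple of e_3, so both are killed.\<close>

definition lw :: "bool \<Rightarrow> site \<Rightarrow> complex" where
  "lw a j = (if a then (if j = (3, 3) then 1 else 0)
     else (if j = (3, 7) then 1 else 0) - (if j = (7, 3) then 1 else 0))"

definition lw_weight :: "bool \<Rightarrow> mat7 \<Rightarrow> complex" where
  "lw_weight a X = (if a then 2 * X $ 3 $ 3 else X $ 3 $ 3 + X $ 7 $ 7)"

lemma rho_lw_sum:
  "(\<Sum>j\<in>UNIV. rho X i j * lw a j) = (if a then rho X i (3, 3) else rho X i (3, 7) - rho X i (7, 3))"
  by (simp add: lw_def right_diff_distrib sum_subtractf if_distrib[of "\<lambda>x. _ * x"] cong: if_cong)

lemma columns_lie_n_minus:
  assumes "X \<in> lie_n_minus"
  shows "X $ a $ 3 = 0 \<and> (a \<noteq> 3 \<longrightarrow> X $ a $ 7 = 0)"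
  using assms unfolding lie_n_minus_def
proof (induction rule: mat7.span_induct)
  show "mat7.subspace {X. X $ a $ 3 = 0 \<and> (a \<noteq> 3 \<longrightarrow> X $ a $ 7 = 0)}"
    by (rule mat7.subspaceI) (auto simp: mscale_def)
qed (auto simp: G_def G_half_def G_table_def F_def E_def)

lemma columns_lie_h:
  assumes "X \<in> lie_h"
  shows "(a \<noteq> 3 \<longrightarrow> X $ a $ 3 = 0) \<and> (a \<noteq> 7 \<longrightarrow> X $ a $ 7 = 0)"
  using assms unfolding lie_h_def
proof (induction rule: mat7.span_induct)
  show "mat7.subspace {X. (a \<noteq> 3 \<longrightarrow> X $ a $ 3 = 0) \<and> (a \<noteq> 7 \<longrightarrow> X $ a $ 7 = 0)}"
    by (rule mat7.subspaceI) (auto simp: mscale_def)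
qed (auto simp: G_values_diag F_def E_def)

lemma rho_lw_n_minus: "X \<in> lie_n_minus \<Longrightarrow> (\<Sum>j\<in>UNIV. rho X i j * lw a j) = 0"
  using columns_lie_n_minus[of X "fst i"] columns_lie_n_minus[of X "snd i"]
  unfolding rho_lw_sum by (auto simp: rho_def)

lemma rho_lw_h: "X \<in> lie_h \<Longrightarrow> (\<Sum>j\<in>UNIV. rho X i j * lw a j) = lw_weight a X * lw a i"
  using columns_lie_h[of X "fst i"] columns_lie_h[of X "snd i"]
  unfolding rho_lw_sum by (cases i) (auto simp: rho_def lw_def lw_weight_def)

definition lw_vec :: "config \<Rightarrow> vec_fps" where
  "lw_vec L s = (\<Prod>p<length L. fps_const (lw (fst (L ! p)) (s p)))"

lemma lw_vec_upd:
  assumes "p < length L"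
  shows "lw_vec L (s(p := j)) =
    fps_const (lw (fst (L ! p)) j) * (\<Prod>q\<in>{..<length L} - {p}. fps_const (lw (fst (L ! q)) (s q)))"
  using assms by (simp add: lw_vec_def prod.remove[where x = p])

lemma site_op_lw:
  assumes "p < length L" "\<And>i. (\<Sum>j\<in>UNIV. rho X i j * lw (fst (L ! p)) j) = c * lw (fst (L ! p)) i"
  shows "site_op p X (\<lambda>s. f * lw_vec L s) s = fps_const c * f * lw_vec L s"
proof -
  let ?R = "\<Prod>q\<in>{..<length L} - {p}. fps_const (lw (fst (L ! q)) (s q))"
  have "site_op p X (\<lambda>s. f * lw_vec L s) s =
      f * ?R * fps_const (\<Sum>j\<in>UNIV. rho X (s p) j * lw (fst (L ! p)) j)"
    unfolding site_op_def lw_vec_upd[OF assms(1)] fps_const_sum sum_distrib_left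
    by (simp add: ac_simps flip: fps_const_mult)
  also have "\<dots> = fps_const c * f * lw_vec L (s(p := s p))"
    unfolding assms(2) lw_vec_upd[OF assms(1)] by (simp add: ac_simps flip: fps_const_mult)
  finally show ?thesis by simp
qed

lemma rep_loop_h:
  assumes "X \<in> lie_h"
  shows "rep L (loop X r) (\<lambda>s. f * lw_vec L s) s =
    (\<Sum>p<length L. zp (snd (L ! p)) r * fps_const (lw_weight (fst (L ! p)) X)) * f * lw_vec L s"
  using assms span_mono_lie(1)
  by (auto simp: rep_loop site_op_lw[OF _ rho_lw_h[OF assms]] sum_distrib_right mult.assoc)

lemma rep_loop_n_minus:
  assumes "X \<in> lie_n_minus"
  shows "rep L (loop X r) (\<lambda>s. f * lw_vec L s) s = 0"
proof -
  have "site_op p X (\<lambda>s. f * lw_vec L s) s = fps_const 0 * f * lw_vec L s" if "p < length L" for p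
    using that rho_lw_n_minus[OF assms] by (intro site_op_lw) simp_all
  then show ?thesis by (simp add: rep_loop)
qed

lemma rep_tau_lw: "rep L tau (\<lambda>s. f * lw_vec L s) = (\<lambda>s. - fps_deriv f * lw_vec L s)"
proof -
  have "(\<Prod>p\<in>A. fps_const (h p)) = fps_const (\<Prod>p\<in>A. h p)" for h :: "nat \<Rightarrow> complex" and A
    by (induction A rule: infinite_finite_induct) simp_all
  then show ?thesis by (simp add: rep_tau lw_vec_def)
qed

lemma free_op_zero_vec: "free_op L x (\<lambda>s. 0) s = 0"
  using word_op_linear[of L _ _ _ "{}"] by (simp add: free_op_def)

lemma rep_zero_vec: "rep L u (\<lambda>s. 0) s = 0"
  by transfer (rule free_op_zero_vec)

lemma rep_n_ideal: "x \<in> n_ideal \<Longrightarrow> rep L x (lw_vec L) s = 0"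
proof (induction arbitrary: s rule: left_ideal.induct)
  case (base a x)
  then have "rep L x (lw_vec L) = (\<lambda>s. 0)"
    using rep_loop_n_minus[of _ L _ 1] by (auto simp: neg_modes_def)
  then show ?case by (simp add: rep_mult rep_zero_vec)
qed (simp_all add: rep_add)

text \<open>Eigenvalues are power series, so the condition is imposed on all multiples
  \<open>f\<close> of the lowest weight vector. This makes eigenvalues multiplicative, and it still
  applies after tau has differentiated \<open>f\<close>.\<close>

definition eigen :: "config \<Rightarrow> uea \<Rightarrow> complex fps \<Rightarrow> bool" where
  "eigen L u g \<longleftrightarrow> (\<forall>f. rep L u (\<lambda>s. f * lw_vec L s) = (\<lambda>s. g * f * lw_vec L s))"

lemma eigen_loop: "X \<in> lie_h \<Longrightarrow> eigen L (loop X r)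
    (\<Sum>p<length L. zp (snd (L ! p)) r * fps_const (lw_weight (fst (L ! p)) X))"
  by (simp add: eigen_def fun_eq_iff rep_loop_h)

lemma eigen_cscale: "eigen L u g \<Longrightarrow> eigen L (cscale c u) (fps_const c * g)"
  by (simp add: eigen_def fun_eq_iff rep_cscale mult.assoc)

lemma eigen_1: "eigen L 1 1"
  by (simp add: eigen_def fun_eq_iff)

lemma eigen_add: "eigen L u g \<Longrightarrow> eigen L v h \<Longrightarrow> eigen L (u + v) (g + h)"
  by (simp add: eigen_def fun_eq_iff rep_add distrib_right)

lemma eigen_mult: "eigen L u g \<Longrightarrow> eigen L v h \<Longrightarrow> eigen L (u * v) (g * h)"
  by (simp add: eigen_def rep_mult) (simp add: mult.assoc)

lemma eigen_U_h:
  assumes "u \<in> U_h"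
  shows "\<exists>g. eigen L u g"
  using assms unfolding U_h_def
proof (induction rule: subalgebra.induct)
  case (base x)
  then show ?case using eigen_loop by (auto simp: neg_modes_def)
qed (blast intro: eigen_cscale eigen_1 eigen_add eigen_mult)+

definition lw_state :: "config \<Rightarrow> nat \<Rightarrow> site" where
  "lw_state L p = (if fst (L ! p) then (3, 3) else (3, 7))"

lemma lw_vec_state: "lw_vec L (lw_state L) = 1"
  by (auto simp: lw_vec_def lw_state_def lw_def intro!: prod.neutral)

text \<open>The eigenvalue at t = 0, read off in a coordinate where the lowest weight vector is 1.
  In this form it is defined and additive on all of \<open>uea\<close>, and it is multiplicative on
  \<open>U_h\<close>.\<close>

definition chi :: "config \<Rightarrow> uea \<Rightarrow> complex" where
  "chi L u = fps_nth (rep L u (lw_vec L) (lw_state L)) 0"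

lemma chi_eigen: "eigen L u g \<Longrightarrow> chi L u = fps_nth g 0"
  unfolding eigen_def chi_def by (drule spec[of _ 1]) (simp add: lw_vec_state)

lemma chi_mult:
  assumes "u \<in> U_h" "v \<in> U_h"
  shows "chi L (u * v) = chi L u * chi L v"
proof -
  obtain g h where gh: "eigen L u g" "eigen L v h"
    using assms eigen_U_h by blast
  show ?thesis
    by (simp add: chi_eigen[OF gh(1)] chi_eigen[OF gh(2)] chi_eigen[OF eigen_mult[OF gh]])
qed

lemma chi_add: "chi L (u + v) = chi L u + chi L v"
  by (simp add: chi_def rep_add)

lemma chi_cscale: "chi L (cscale c u) = c * chi L u"
  by (simp add: chi_def rep_cscale)

lemma chi_1 [simp]: "chi L 1 = 1"
  by (simp add: chi_def lw_vec_state)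

lemma chi_0 [simp]: "chi L 0 = 0"
  by (simp add: chi_def)

lemma chi_sum: "chi L (sum f A) = (\<Sum>i\<in>A. chi L (f i))"
  by (induction A rule: infinite_finite_induct) (simp_all add: chi_add)

lemma chi_loop:
  assumes "X \<in> lie_h" "\<And>a c. (a, c) \<in> set L \<Longrightarrow> c \<noteq> 0"
  shows "chi L (loop X (- int k)) = (\<Sum>(a, c)\<leftarrow>L. (1 / c) ^ k * lw_weight a X)"
proof -
  have "snd (L ! p) \<noteq> 0" if "p < length L" for p
    using assms(2)[of "fst (L ! p)" "snd (L ! p)"] that by simp
  then have "chi L (loop X (- int k)) = (\<Sum>p<length L. (1 / snd (L ! p)) ^ k * lw_weight (fst (L ! p)) X)"
    by (simp add: chi_eigen[OF eigen_loop[OF assms(1)]] fps_sum_nth zp_nth_0)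
  then show ?thesis
    by (simp add: sum_list_sum_nth case_prod_unfold atLeast0LessThan)
qed

subsection \<open>Polynomial independence\<close>

lemma U_h_commute:
  assumes "x \<in> U_h" "y \<in> U_h"
  shows "x * y = y * x"
proof -
  have *: "loop X r * y = y * loop X r" if "X \<in> lie_h" "r < 0" for X r
    using assms(2) unfolding U_h_def
  proof (induction rule: subalgebra.induct)
    case (base y)
    then show ?case using that commute_lie_h[of X _ _ r] by (auto simp: neg_modes_def)
  next
    case (scalar c)
    show ?case by (simp add: cscale_mult_left cscale_mult_right)
  next
    case (mult x y)
    then show ?case by (metis mult.assoc)
  qed (simp add: algebra_simps)
  show ?thesis
    using assms(1) unfolding U_h_def
  proof (induction rule: subalgebra.induct)
    case (base x)
    then show ?case using * by (auto simp: neg_modes_def)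
  next
    case (scalar c)
    show ?case by (simp add: cscale_mult_left cscale_mult_right)
  next
    case (mult x y)
    then show ?case by (metis mult.assoc)
  qed (simp add: algebra_simps)
qed

text \<open>Coefficients are indexed by all naturals and vanish beyond \<open>K\<close>, so
  polynomials of different degrees can be added termwise.\<close>

definition is_poly_in :: "uea set \<Rightarrow> uea \<Rightarrow> uea \<Rightarrow> bool" where
  "is_poly_in A z u \<longleftrightarrow> (\<exists>p K. (\<forall>k. p k \<in> A) \<and> (\<forall>k>K. p k = 0) \<and> u = (\<Sum>k\<le>K. p k * z ^ k))"

lemma is_poly_in_const: "0 \<in> A \<Longrightarrow> a \<in> A \<Longrightarrow> is_poly_in A z a"
  unfolding is_poly_in_def by (rule exI[of _ "\<lambda>k. if k = 0 then a else 0"], rule exI[of _ 0]) simp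

lemma is_poly_in_add:
  assumes "is_poly_in (subalgebra S) z u" "is_poly_in (subalgebra S) z v"
  shows "is_poly_in (subalgebra S) z (u + v)"
proof -
  have ext: "(\<Sum>k\<le>K. p k * z ^ k) = (\<Sum>k\<le>K'. p k * z ^ k)" if "\<forall>k>K. p k = 0" "K \<le> K'"
    for p :: "nat \<Rightarrow> uea" and K K'
    using that by (intro sum.mono_neutral_left) auto
  obtain p K where p: "\<forall>k. p k \<in> subalgebra S" "\<forall>k>K. p k = 0" "u = (\<Sum>k\<le>K. p k * z ^ k)"
    using assms(1) unfolding is_poly_in_def by blast
  obtain q M where q: "\<forall>k. q k \<in> subalgebra S" "\<forall>k>M. q k = 0" "v = (\<Sum>k\<le>M. q k * z ^ k)"
    using assms(2) unfolding is_poly_in_def by blast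
  have "u + v = (\<Sum>k\<le>max K M. (p k + q k) * z ^ k)"
    using ext[OF p(2), of "max K M"] ext[OF q(2), of "max K M"] p(3) q(3)
    by (simp add: distrib_right sum.distrib)
  moreover have "\<forall>k. p k + q k \<in> subalgebra S" "\<forall>k>max K M. p k + q k = 0"
    using p q by (auto intro: subalgebra.add)
  ultimately show ?thesis
    unfolding is_poly_in_def by (intro exI[of _ "\<lambda>k. p k + q k"] exI[of _ "max K M"]) simp
qed

lemma is_poly_in_mult_const:
  assumes "a \<in> subalgebra S" "is_poly_in (subalgebra S) z u"
  shows "is_poly_in (subalgebra S) z (a * u)"
proof -
  obtain p K where p: "\<forall>k. p k \<in> subalgebra S" "\<forall>k>K. p k = 0" "u = (\<Sum>k\<le>K. p k * z ^ k)"
    using assms(2) unfolding is_poly_in_def by blast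
  then have "a * u = (\<Sum>k\<le>K. (a * p k) * z ^ k)"
    by (simp add: sum_distrib_left mult.assoc)
  with p show ?thesis
    unfolding is_poly_in_def using subalgebra.mult[OF assms(1)]
    by (intro exI[of _ "\<lambda>k. a * p k"] exI[of _ K]) auto
qed

lemma is_poly_in_mult_var:
  assumes "\<And>a. a \<in> subalgebra S \<Longrightarrow> z * a = a * z" "is_poly_in (subalgebra S) z u"
  shows "is_poly_in (subalgebra S) z (z * u)"
proof -
  obtain p K where p: "\<forall>k. p k \<in> subalgebra S" "\<forall>k>K. p k = 0" "u = (\<Sum>k\<le>K. p k * z ^ k)"
    using assms(2) unfolding is_poly_in_def by blast
  have "z * u = (\<Sum>k\<le>K. p k * z ^ Suc k)"
    using assms(1) p(1) by (simp add: p(3) sum_distrib_left flip: mult.assoc)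
  also have "\<dots> = (\<Sum>k\<le>Suc K. (case k of 0 \<Rightarrow> 0 | Suc m \<Rightarrow> p m) * z ^ k)"
    by (subst sum.atMost_Suc_shift) simp
  finally show ?thesis
    unfolding is_poly_in_def using p subalgebra_0
    by (intro exI[of _ "\<lambda>k. case k of 0 \<Rightarrow> 0 | Suc m \<Rightarrow> p m"] exI[of _ "Suc K"])
      (auto split: nat.split)
qed

lemma is_poly_in_insert:
  assumes comm: "\<And>a. a \<in> subalgebra S \<Longrightarrow> z * a = a * z"
    and u: "u \<in> subalgebra (insert z S)"
  shows "is_poly_in (subalgebra S) z u"
proof -
  let ?M = "is_poly_in (subalgebra S) z"
  \<comment> \<open>The induction runs over left multiplication by \<open>u\<close>; a product of
    two elements then needs no product of two polynomials.\<close>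
  have "?M (u * m)" if "?M m" for m
    using u that
  proof (induction arbitrary: m rule: subalgebra.induct)
    case (base x)
    then show ?case
      using is_poly_in_mult_var[OF comm] is_poly_in_mult_const[OF subalgebra.base] by blast
  next
    case (scalar c)
    then show ?case using is_poly_in_mult_const[OF subalgebra.scalar] by blast
  next
    case (add x y)
    then show ?case by (simp add: distrib_right is_poly_in_add)
  next
    case (mult x y)
    then show ?case by (simp add: mult.assoc)
  qed
  moreover have "?M 1"
    using is_poly_in_const subalgebra_0 subalgebra_of_int[of 1] by simp
  ultimately show ?thesis by force
qed

text \<open>
  A polynomial vanishing on \<open>\<nat>\<^sup>d\<close> is zero; here the polynomial is an element of the subalgebra
  generated by \<open>z 0, \<dots>, z (d - 1)\<close> and its values are given by the characters \<open>\<psi>\<close>.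
\<close>

lemma subalgebra_eq_0I:
  fixes \<psi> :: "(nat \<Rightarrow> nat) \<Rightarrow> uea \<Rightarrow> complex"
  assumes z: "\<And>i. i < d \<Longrightarrow> z i \<in> U_h"
    and \<psi>_add: "\<And>n u v. \<psi> n (u + v) = \<psi> n u + \<psi> n v"
    and \<psi>_mult: "\<And>n u v. u \<in> U_h \<Longrightarrow> v \<in> U_h \<Longrightarrow> \<psi> n (u * v) = \<psi> n u * \<psi> n v"
    and \<psi>_scalar: "\<And>n c. \<psi> n (cscale c 1) = c"
    and \<psi>_z: "\<And>n i. i < d \<Longrightarrow> \<psi> n (z i) = of_nat (n i)"
    and u: "u \<in> subalgebra (z ` {..<m})" "m \<le> d" "\<And>n. \<psi> n u = 0"
  shows "u = 0"
  using u
proof (induction m arbitrary: u)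
  case 0
  have "\<exists>c. u = cscale c 1"
    using 0(1)
  proof (induction rule: subalgebra.induct)
    case (add x y)
    then show ?case by (metis uea.scale_left_distrib)
  next
    case (mult x y)
    then show ?case by (metis cscale_mult_left mult_1 uea.scale_scale)
  qed auto
  then show ?case using 0(3) \<psi>_scalar by force
next
  case (Suc m)
  let ?A = "subalgebra (z ` {..<m})"
  have sub: "a \<in> U_h" if "a \<in> ?A" for a
    using that unfolding U_h_def
    by (rule subalgebra_mono) (use z Suc(3) in \<open>auto simp: U_h_def\<close>)
  have zm: "z m \<in> U_h" using z Suc(3) by simp
  have "is_poly_in ?A (z m) u"
    by (rule is_poly_in_insert)
      (use Suc(2) sub zm in \<open>auto simp: lessThan_Suc intro: U_h_commute\<close>)
  then obtain p K where p: "\<And>k. p k \<in> ?A" "u = (\<Sum>k\<le>K. p k * z m ^ k)"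
    unfolding is_poly_in_def by blast
  have indep: "\<psi> n a = \<psi> n' a" if "a \<in> ?A" "\<And>i. i < m \<Longrightarrow> n i = n' i" for a n n'
    using that(1)
  proof (induction rule: subalgebra.induct)
    case (base x)
    then show ?case using that(2) \<psi>_z Suc(3) by auto
  qed (use sub in \<open>simp_all add: \<psi>_scalar \<psi>_add \<psi>_mult\<close>)
  have \<psi>_pow: "\<psi> n (z m ^ k) = of_nat (n m) ^ k" for n k
  proof (induction k)
    case 0
    show ?case using \<psi>_scalar[of n 1] by simp
  next
    case (Suc k)
    then show ?case
      using \<psi>_mult[OF zm] subalgebra_power[of "z m"] zm \<psi>_z \<open>Suc m \<le> d\<close> by (simp add: U_h_def)
  qed
  have \<psi>_sum: "\<psi> n (sum f A) = (\<Sum>k\<in>A. \<psi> n (f k))" for n A and f :: "nat \<Rightarrow> uea"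
    using \<psi>_scalar[of n 0] by (induction A rule: infinite_finite_induct) (simp_all add: \<psi>_add)
  have "p k = 0" if "k \<le> K" for k
  proof (rule Suc.IH)
    show "p k \<in> ?A" "m \<le> d" using p(1) Suc(3) by auto
    fix n
    \<comment> \<open>Changing \<open>n\<close> at \<open>m\<close> alone leaves the values of the
      coefficients fixed (\<open>indep\<close>), so the value of \<open>u\<close> becomes a
      polynomial in one variable that vanishes at every natural number.\<close>
    have "(\<Sum>k\<le>K. \<psi> n (p k) * of_nat x ^ k) = 0" for x
    proof -
      have "\<psi> (n(m := x)) (p k * z m ^ k) = \<psi> n (p k) * of_nat x ^ k" for k
        using \<psi>_mult[OF sub[OF p(1)], of "z m ^ k"] zm subalgebra_power[of "z m"]
          indep[OF p(1)[of k], where n = "n(m := x)" and n' = n]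
        by (simp add: \<psi>_pow U_h_def)
      then have "(\<Sum>k\<le>K. \<psi> n (p k) * of_nat x ^ k) = \<psi> (n(m := x)) u"
        unfolding p(2) \<psi>_sum by (intro sum.cong refl) (rule sym)
      then show ?thesis by (simp only: Suc(4))
    qed
    then have "range of_nat \<subseteq> {x. (\<Sum>k\<le>K. \<psi> n (p k) * x ^ k) = 0}"
      by auto
    moreover have "infinite (range (of_nat :: nat \<Rightarrow> complex))"
      by (rule range_inj_infinite) (rule inj_of_nat)
    ultimately have "infinite {x. (\<Sum>k\<le>K. \<psi> n (p k) * x ^ k) = 0}"
      using finite_subset by blast
    then show "\<psi> n (p k) = 0"
      using polyfun_rootbound_finite[where c = "\<lambda>k. \<psi> n (p k)" and n = K] that by blast
  qed
  then show ?case by (simp add: p(2))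
qed

text \<open>Only the modes X[-k] with k >= 1 are available, so the polynomials must have no constant
  term. This makes 0 an additional node and raises the degree from N - 1 to N.\<close>

lemma lagrange_basis:
  fixes x :: "nat \<Rightarrow> complex"
  assumes "inj x" "\<And>j. x j \<noteq> 0"
  shows "\<exists>P. \<forall>j<N. degree (P j) \<le> N \<and> coeff (P j) 0 = 0 \<and>
    (\<forall>i<N. poly (P j) (x i) = (if i = j then 1 else 0))"
proof -
  define Q where "Q = (\<lambda>j. pCons 0 (\<Prod>i\<in>{..<N} - {j}. [:- x i, 1:]))"
  have deg: "degree (Q j) \<le> N" if "j < N" for j
  proof -
    have "degree (\<Prod>i\<in>{..<N} - {j}. [:- x i, 1:]) \<le> (\<Sum>i\<in>{..<N} - {j}. degree [:- x i, 1:])"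
      using degree_prod_sum_le[of "{..<N} - {j}" "\<lambda>i. [:- x i, 1:]"] by (simp add: o_def)
    also have "\<dots> = N - 1" using that by simp
    finally have "degree (\<Prod>i\<in>{..<N} - {j}. [:- x i, 1:]) \<le> N - 1" .
    then have "degree (Q j) \<le> Suc (N - 1)"
      unfolding Q_def by (meson Suc_le_mono degree_pCons_le order_trans)
    then show ?thesis using that by simp
  qed
  have nz: "poly (Q j) (x j) \<noteq> 0" if "j < N" for j
    using assms by (auto simp: Q_def poly_prod inj_def)
  show ?thesis
  proof (rule exI[of _ "\<lambda>j. smult (inverse (poly (Q j) (x j))) (Q j)"], intro allI impI conjI)
    fix j assume j: "j < N"
    show "degree (smult (inverse (poly (Q j) (x j))) (Q j)) \<le> N"
      using deg[OF j] by (meson degree_smult_le order_trans)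
    show "coeff (smult (inverse (poly (Q j) (x j))) (Q j)) 0 = 0"
      by (simp add: Q_def)
    fix i assume "i < N"
    then show "poly (smult (inverse (poly (Q j) (x j))) (Q j)) (x i) = (if i = j then 1 else 0)"
    proof (cases "i = j")
      case True
      then show ?thesis using nz[OF j] by simp
    next
      case False
      with \<open>i < N\<close> have "poly (Q j) (x i) = 0" by (auto simp: Q_def poly_prod)
      with False show ?thesis by simp
    qed
  qed
qed

text \<open>The basis of h dual to the two weights of \<open>lw_weight\<close>, whose values on
  (G_11, G_22) are (-2, -2) and (-3, 0).\<close>

definition y_mat :: "bool \<Rightarrow> mat7" where
  "y_mat a = (if a then (- 1 / 2) *\<^sub>R G 2 2 else (1 / 3) *\<^sub>R (G 2 2 - G 1 1))"

lemma y_mat_in_lie_h: "y_mat a \<in> lie_h"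
  unfolding y_mat_def lie_h_def
  by (cases a)
    (simp_all only: if_True if_False scaleR_mat7_span mat7.span_diff mat7.span_base insertI1 insertI2)

lemma lw_weight_y_mat: "lw_weight b (y_mat a) = (if a = b then 1 else 0)"
  using diag_entries[of R3] diag_entries[of R7]
  by (simp add: lw_weight_def y_mat_def scaleR_conv_of_real[where 'a = complex])

lemma G_y_mat: "G 1 1 = (- 2) *\<^sub>R y_mat True + (- 3) *\<^sub>R y_mat False" "G 2 2 = (- 2) *\<^sub>R y_mat True"
  by (simp_all add: y_mat_def)

definition y_gens :: "nat \<Rightarrow> uea set" where
  "y_gens N = {loop (y_mat a) (- int k) | a k. k \<in> {1..N}}"

lemma loop_in_y_gens:
  assumes "X \<in> lie_h" "k \<ge> 1"
  shows "loop X (- int k) \<in> subalgebra (y_gens k)"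
proof -
  have y: "loop (y_mat a) (- int k) \<in> subalgebra (y_gens k)" for a
    using assms(2) by (auto simp: y_gens_def intro!: subalgebra.base)
  have "X \<in> lie_g \<and> loop X (- int k) \<in> subalgebra (y_gens k)"
    using assms(1) unfolding lie_h_def
  proof (induction rule: mat7.span_induct)
    show "mat7.subspace {X. X \<in> lie_g \<and> loop X (- int k) \<in> subalgebra (y_gens k)}"
      by (rule mat7.subspaceI)
        (auto simp: loop_0 loop_add loop_mscale mat7.subspace_0[OF lie_g_subspace]
          mat7.subspace_add[OF lie_g_subspace] mat7.subspace_scale[OF lie_g_subspace]
          intro: subalgebra_0 subalgebra.add subalgebra_cscale)
  next
    have yg: "y_mat a \<in> lie_g" for a
      using y_mat_in_lie_h span_mono_lie(1) by blast
    have "loop ((- 2) *\<^sub>R y_mat True + (- 3) *\<^sub>R y_mat False) (- int k)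
        = (- 2) *\<^sub>R loop (y_mat True) (- int k) + (- 3) *\<^sub>R loop (y_mat False) (- int k)"
      by (simp only: loop_add scaleR_in_lie_g yg loop_scaleR[OF yg])
    moreover have "loop ((- 2) *\<^sub>R y_mat True) (- int k) = (- 2) *\<^sub>R loop (y_mat True) (- int k)"
      by (rule loop_scaleR[OF yg])
    ultimately have "loop (G 1 1) (- int k) \<in> subalgebra (y_gens k)" "loop (G 2 2) (- int k) \<in> subalgebra (y_gens k)"
      unfolding G_y_mat using y by (auto intro!: subalgebra.add subalgebra_scaleR simp del: scaleR_minus_left)
    then show "X \<in> lie_g \<and> loop X (- int k) \<in> subalgebra (y_gens k)" if "X \<in> {G 1 1, G 2 2}" for X
      using that by (auto simp: G_in_lie_g)
  qed
  then show ?thesis by blast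
qed

lemma y_gens_mono: "N \<le> M \<Longrightarrow> x \<in> subalgebra (y_gens N) \<Longrightarrow> x \<in> subalgebra (y_gens M)"
  by (erule subalgebra_mono) (force simp: y_gens_def intro: subalgebra.base)

lemma U_h_y_gens:
  assumes "u \<in> U_h"
  shows "\<exists>N. u \<in> subalgebra (y_gens N)"
  using assms unfolding U_h_def
proof (induction rule: subalgebra.induct)
  case (base x)
  then obtain X r where x: "x = loop X r" "X \<in> lie_h" "r < 0" by (auto simp: neg_modes_def)
  then have "r = - int (nat (- r))" "nat (- r) \<ge> 1" by simp_all
  then show ?case using loop_in_y_gens[OF x(2), of "nat (- r)"] x(1) by metis
next
  case (add x y)
  then obtain N M where "x \<in> subalgebra (y_gens N)" "y \<in> subalgebra (y_gens M)" by blast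
  then have "x + y \<in> subalgebra (y_gens (max N M))"
    using y_gens_mono[of N "max N M"] y_gens_mono[of M "max N M"] by (simp add: subalgebra.add)
  then show ?case by blast
next
  case (mult x y)
  then obtain N M where "x \<in> subalgebra (y_gens N)" "y \<in> subalgebra (y_gens M)" by blast
  then have "x * y \<in> subalgebra (y_gens (max N M))"
    using y_gens_mono[of N "max N M"] y_gens_mono[of M "max N M"] by (simp add: subalgebra.mult)
  then show ?case by blast
qed (blast intro: subalgebra.scalar)

definition multi_config :: "nat \<Rightarrow> (nat \<Rightarrow> bool \<times> complex) \<Rightarrow> (nat \<Rightarrow> nat) \<Rightarrow> config" where
  "multi_config d t n = concat (map (\<lambda>i. replicate (n i) (t i)) [0..<d])"

lemma sum_multi_config: "(\<Sum>e\<leftarrow>multi_config d t n. f e) = (\<Sum>i<d. of_nat (n i) * f (t i))"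
  for f :: "_ \<Rightarrow> complex"
  by (induction d) (simp_all add: multi_config_def sum_list_replicate)

text \<open>
  The points $c$ are the inverses of $N$ distinct numbers, and Lagrange interpolation yields generators
  \<open>z i\<close> whose eigenvalues are the multiplicities of the sites.
\<close>

lemma U_h_eq_0I:
  assumes u: "u \<in> U_h" and chi0: "\<And>L. (\<And>a c. (a, c) \<in> set L \<Longrightarrow> c \<noteq> 0) \<Longrightarrow> chi L u = 0"
  shows "u = 0"
proof -
  obtain N where uN: "u \<in> subalgebra (y_gens N)" using U_h_y_gens[OF u] by blast
  define x :: "nat \<Rightarrow> complex" where "x = (\<lambda>j. of_nat (Suc j))"
  have x: "inj x" "x j \<noteq> 0" for j
    unfolding x_def by (simp_all add: inj_def del: of_nat_Suc)
  obtain P where P: "\<And>j. j < N \<Longrightarrow> degree (P j) \<le> N" "\<And>j. j < N \<Longrightarrow> coeff (P j) 0 = 0"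
    "\<And>i j. i < N \<Longrightarrow> j < N \<Longrightarrow> poly (P j) (x i) = (if i = j then 1 else 0)"
    using lagrange_basis[OF x, of N] by blast
  have poly_P: "poly (P j) c = (\<Sum>k=1..N. coeff (P j) k * c ^ k)" if "j < N" for j c
  proof -
    have "poly (P j) c = (\<Sum>k\<le>N. coeff (P j) k * c ^ k)"
      using P(1)[OF that] by (rule poly_as_sum_of_monoms'[THEN arg_cong[where f = "\<lambda>p. poly p c"], unfolded poly_sum poly_monom, symmetric])
    also have "\<dots> = (\<Sum>k=1..N. coeff (P j) k * c ^ k)"
      using P(2)[OF that] by (intro sum.mono_neutral_right) (auto simp: not_less_eq_eq)
    finally show ?thesis .
  qed
  \<comment> \<open>The index \<open>i\<close> encodes the node \<open>i div 2\<close> and the type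
    \<open>even i\<close>. At the point 1 / x_l the mode X[-k] has the value x_l^k times a weight,
    so \<open>z i\<close> evaluates \<open>P (i div 2)\<close> at the nodes.\<close>
  define z where "z = (\<lambda>i. \<Sum>k=1..N. cscale (coeff (P (i div 2)) k) (loop (y_mat (even i)) (- int k)))"
  define t where "t = (\<lambda>i. (even i, 1 / x (i div 2)))"
  have z_U_h: "z i \<in> U_h" for i
    unfolding z_def U_h_def
    by (intro subalgebra_sum subalgebra_cscale subalgebra.base loop_in_neg_modes y_mat_in_lie_h) simp
  have chi_z: "chi (multi_config (2 * N) t n) (z i) = of_nat (n i)" if "i < 2 * N" for n i
  proof -
    have t_nz: "c \<noteq> 0" if "(a, c) \<in> set (multi_config (2 * N) t n)" for a c
      using that x(2) by (auto simp: multi_config_def t_def)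
    have "chi (multi_config (2 * N) t n) (z i) =
        (\<Sum>k=1..N. coeff (P (i div 2)) k * (\<Sum>l<2 * N. of_nat (n l) *
          ((x (l div 2)) ^ k * lw_weight (even l) (y_mat (even i)))))"
      unfolding z_def chi_sum chi_cscale
      by (simp add: chi_loop[OF y_mat_in_lie_h t_nz] sum_multi_config t_def)
    also have "\<dots> = (\<Sum>l<2 * N. of_nat (n l) * (if even i = even l then 1 else 0) * poly (P (i div 2)) (x (l div 2)))"
      using that unfolding sum_distrib_left
      by (subst sum.swap) (simp add: poly_P lw_weight_y_mat sum_distrib_left ac_simps)
    also have "\<dots> = (\<Sum>l<2 * N. if l = i then of_nat (n l) else 0)"
    proof (intro sum.cong refl)
      fix l assume "l \<in> {..<2 * N}"
      then show "of_nat (n l) * (if even i = even l then 1 else 0) * poly (P (i div 2)) (x (l div 2))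
          = (if l = i then of_nat (n l) else 0)"
        using P(3)[of "l div 2" "i div 2"] that by (auto elim!: evenE oddE)
    qed
    also have "\<dots> = of_nat (n i)" using that by simp
    finally show ?thesis .
  qed
  have "y_gens N \<subseteq> subalgebra (z ` {..<2 * N})"
  proof
    fix v assume "v \<in> y_gens N"
    then obtain a k where v: "v = loop (y_mat a) (- int k)" and k: "k \<in> {1..N}"
      by (auto simp: y_gens_def)
    let ?i = "\<lambda>j. 2 * j + (if a then 0 else 1)"
    \<comment> \<open>Interpolation inverts the passage from modes to \<open>z\<close>: both sides
      have degree at most N and agree at the N nodes and, as k >= 1, at 0.\<close>
    have interp: "(\<Sum>j<N. smult (x j ^ k) (P j)) = monom 1 k"
    proof (rule poly_eqI_degree[where A = "insert 0 (x ` {..<N})"])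
      have card: "card (insert 0 (x ` {..<N})) = Suc N"
        using x by (subst card_insert_disjoint) (auto simp: card_image inj_on_subset)
      show "degree (\<Sum>j<N. smult (x j ^ k) (P j)) < card (insert 0 (x ` {..<N}))"
        unfolding card less_Suc_eq_le using P(1)
        by (intro degree_sum_le) (auto intro: order_trans[OF degree_smult_le])
      show "degree (monom 1 k :: complex poly) < card (insert 0 (x ` {..<N}))"
        unfolding card using k by (auto simp: degree_monom_eq)
      show "poly (\<Sum>j<N. smult (x j ^ k) (P j)) c = poly (monom 1 k) c"
        if "c \<in> insert 0 (x ` {..<N})" for c
        using that P(2,3) k
        by (auto simp: poly_sum poly_monom poly_0_coeff_0 if_distrib[of "\<lambda>y. _ * y"] cong: if_cong)
    qed
    have "(\<Sum>j<N. cscale (x j ^ k) (z (?i j))) =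
        (\<Sum>l=1..N. cscale (coeff (\<Sum>j<N. smult (x j ^ k) (P j)) l) (loop (y_mat a) (- int l)))"
      by (simp add: z_def uea.scale_sum_right uea.scale_sum_left coeff_sum sum.swap[of _ "{..<N}"])
    also have "\<dots> = (\<Sum>l=1..N. if l = k then loop (y_mat a) (- int l) else 0)"
      unfolding interp by (intro sum.cong refl) simp
    also have "\<dots> = v" using k by (simp add: v)
    finally have "v = (\<Sum>j<N. cscale (x j ^ k) (z (?i j)))" by simp
    also have "\<dots> \<in> subalgebra (z ` {..<2 * N})"
      by (intro subalgebra_sum subalgebra_cscale subalgebra.base) auto
    finally show "v \<in> subalgebra (z ` {..<2 * N})" .
  qed
  with uN have uz: "u \<in> subalgebra (z ` {..<2 * N})"
    by (rule subalgebra_mono)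
  show ?thesis
  proof (rule subalgebra_eq_0I[where d = "2 * N" and \<psi> = "\<lambda>n. chi (multi_config (2 * N) t n)", OF _ _ _ _ _ uz])
    show "chi (multi_config (2 * N) t n) u = 0" for n
      using x(2) by (intro chi0) (auto simp: multi_config_def t_def)
  qed (simp_all add: z_U_h chi_add chi_mult chi_cscale chi_z)
qed

lemma U_h_n_ideal:
  assumes "u \<in> U_h" "u \<in> n_ideal"
  shows "u = 0"
  by (rule U_h_eq_0I[OF assms(1)]) (simp add: chi_def rep_n_ideal[OF assms(2)])

lemma hc_eqI:
  assumes "u \<in> centralizer_h" "v \<in> U_h" "u \<simeq> v"
  shows "hc u = v"
  unfolding hc_def
proof (rule the_equality)
  show "v \<in> U_h \<and> u - v \<in> J"
    using assms by (simp add: J_def cong_n_def centralizer_diff U_h_centralizer)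
  fix v' assume v': "v' \<in> U_h \<and> u - v' \<in> J"
  then have "(u - v) - (u - v') \<in> n_ideal"
    using assms(3) by (auto simp only: J_def cong_n_def intro!: n_ideal_diff)
  then have "v' - v \<in> n_ideal" by simp
  moreover have "v' - v \<in> U_h"
    using v' assms(2) by (simp add: U_h_def subalgebra_diff)
  ultimately show "v' = v" using U_h_n_ideal by fastforce
qed

lemma tau_independent:
  assumes a: "\<And>i. i \<le> K \<Longrightarrow> a i \<in> U_h" and eq: "(\<Sum>i\<le>K. a i * tau ^ i) = 0" and "k \<le> K"
  shows "a k = 0"
proof (rule U_h_eq_0I)
  show "a k \<in> U_h" using a \<open>k \<le> K\<close> by simp
  fix L :: config
  have tau_pow: "rep L (tau ^ i) (\<lambda>s. f * lw_vec L s) = (\<lambda>s. (fps_const ((- 1) ^ i) * (fps_deriv ^^ i) f) * lw_vec L s)" for i f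
  proof (induction i)
    case (Suc i)
    then show ?case
      using rep_tau_lw[of L "fps_const ((- 1) ^ i) * (fps_deriv ^^ i) f"]
      by (simp add: rep_mult mult.assoc) (simp flip: fps_const_neg)
  qed (simp add: fun_eq_iff)
  define g where "g = (\<lambda>i. SOME g. eigen L (a i) g)"
  have g: "eigen L (a i) (g i)" if "i \<le> K" for i
    unfolding g_def by (rule someI_ex[OF eigen_U_h[OF a[OF that]]])
  \<comment> \<open>At t = 0 the i-th derivative of t^k / k! is 1 for i = k and 0 otherwise, which
    selects the coefficient \<open>a k\<close>.\<close>
  define f :: "complex fps" where "f = fps_const (1 / fact k) * fps_X ^ k"
  have f: "fps_nth ((fps_deriv ^^ i) f) 0 = (if i = k then 1 else 0)" for i
    by (simp add: fps_0th_higher_deriv f_def fps_X_power_nth)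
  have rep_sum: "rep L (sum h A) v s = (\<Sum>i\<in>A. rep L (h i) v s)" for h :: "nat \<Rightarrow> uea" and A v s
    by (induction A rule: infinite_finite_induct) (simp_all add: rep_add)
  have "0 = rep L (\<Sum>i\<le>K. a i * tau ^ i) (\<lambda>s. f * lw_vec L s) (lw_state L)"
    by (simp add: eq)
  also have "\<dots> = (\<Sum>i\<le>K. g i * (fps_const ((- 1) ^ i) * (fps_deriv ^^ i) f))"
    unfolding rep_sum
    by (intro sum.cong refl) (use g in \<open>simp add: rep_mult tau_pow eigen_def lw_vec_state\<close>)
  finally have "fps_nth 0 0 = fps_nth (\<Sum>i\<le>K. g i * (fps_const ((- 1) ^ i) * (fps_deriv ^^ i) f)) 0"
    by (simp only:)
  also have "\<dots> = (\<Sum>i\<le>K. if i = k then fps_nth (g i) 0 * (- 1) ^ i else 0)"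
    unfolding fps_sum_nth by (intro sum.cong refl) (simp add: f)
  finally have "fps_nth (g k) 0 = 0" using \<open>k \<le> K\<close> by simp
  then show "chi L (a k) = 0"
    using chi_eigen[OF g[OF \<open>k \<le> K\<close>]] by simp
qed

subsection \<open>Differential polynomials in the Cartan currents\<close>

primrec cartan :: "trie \<Rightarrow> bool" where
  "cartan (Leaf c) \<longleftrightarrow> True"
| "cartan (Node x r s t) \<longleftrightarrow> \<not> pos x \<and> \<not> neg x \<and> cartan s \<and> cartan t"

lemma cartan_val: "cartan t \<Longrightarrow> val t \<in> U_h"
  using lp_in_U_h unfolding U_h_def
  by (induction t) (auto intro: subalgebra_of_int subalgebra.add subalgebra.mult)

lemma cartan_add: "cartan s \<Longrightarrow> cartan t \<Longrightarrow> cartan (add s t)"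
  by (induction s t rule: add.induct) (auto simp: Let_def)

lemma cartan_scale: "cartan t \<Longrightarrow> cartan (scale c t)"
  by (induction t) auto

lemma cartan_smul: "cartan t \<Longrightarrow> cartan (smul c t)"
  by (simp add: smul_def cartan_scale)

lemma br_cartan: "\<not> pos x \<Longrightarrow> \<not> neg x \<Longrightarrow> \<not> pos y \<Longrightarrow> \<not> neg y \<Longrightarrow> br x y = []"
  by (cases x; cases y) (simp_all add: pos_def neg_def)

text \<open>Cartan letters have empty brackets and none is discarded at a leaf, so here
  \<open>act\<close> computes the product itself and not only its class modulo the left
  ideal.\<close>

lemma act_cartan:
  assumes "\<not> pos x" "\<not> neg x" "cartan t"
  shows "cartan (act x r t) \<and> val (act x r t) = lp x r * val t"
  using assms
proof (induction x r t rule: act.induct)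
  case (2 x r y q s t)
  note h = "2.prems"(1,2) and y = "2.prems"(3)
  then have br: "br x y = []" by (simp add: br_cartan)
  show ?case
  proof (cases "bas_no x < bas_no y \<or> x = y \<and> r \<le> q")
    case True
    then show ?thesis using h y by simp
  next
    case False
    then have n: "\<not> (\<not> neg x \<and> \<not> pos y \<and> (bas_no x < bas_no y \<or> x = y \<and> r \<le> q))" by blast
    have "act x r (Node y q s t) = add (cons y q (act x r s)) (act x r t)"
      by (subst act.simps(2)) (simp only: h(1) n if_False br foldr.simps id_apply)
    moreover have "cartan (act x r s) \<and> val (act x r s) = lp x r * val s"
      and "cartan (act x r t) \<and> val (act x r t) = lp x r * val t"
      using "2.IH"(1,3)[OF h(1) n h] y by simp_all
    ultimately show ?thesis
      using y lp_commute[of x r y q]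
      by (auto simp: cartan_add cons_def br distrib_left simp flip: mult.assoc)
        (simp add: mult.assoc)
  qed
qed auto

primrec mul :: "trie \<Rightarrow> trie \<Rightarrow> trie" where
  "mul (Leaf c) u = smul c u"
| "mul (Node x r s t) u = add (act x r (mul s u)) (mul t u)"

primrec der :: "trie \<Rightarrow> trie" where
  "der (Leaf c) = Leaf 0"
| "der (Node x r s t) = add (add (act x r (der s)) (scale (Int.Pos r) (act x (r + num.One) s))) (der t)"

lemma mul_cartan: "cartan s \<Longrightarrow> cartan t \<Longrightarrow> cartan (mul s t) \<and> val (mul s t) = val s * val t"
proof (induction s)
  case (Node x r s s')
  then show ?case
    using act_cartan[of x "mul s t" r] by (simp add: cartan_add distrib_right mult.assoc)
qed (simp add: cartan_smul)

lemma D_mult: "D (u * v) = D u * v + u * D v"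
  by (simp add: D_def algebra_simps)

lemma D_add: "D (u + v) = D u + D v"
  by (simp add: D_def algebra_simps)

lemma D_scaleR: "D (c *\<^sub>R u) = c *\<^sub>R D u"
  by (simp add: D_def scaleR_diff_right)

lemma D_of_int: "D (of_int c) = 0"
  by (simp add: D_def mult_of_int_commute)

lemma D_lp: "D (lp x r) = numeral r * lp x (r + num.One)"
proof -
  have "cscale (numeral r) u = numeral r * u" for u
    using scaleR_of_int[of "numeral r" u] by (simp add: scaleR_uea_def)
  moreover have "- numeral r - 1 = - (numeral (r + num.One) :: int)"
    unfolding numeral_add numeral_One by linarith
  ultimately show ?thesis
    using tau_bracket[OF bas_in_lie_g, of x "- numeral r"] unfolding D_def lp_def by (simp only: of_int_minus of_int_numeral minus_minus)
qed

lemma der_cartan: "cartan t \<Longrightarrow> cartan (der t) \<and> val (der t) = D (val t)"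
proof (induction t)
  case (Node x r s t)
  then show ?case
    using act_cartan[of x "der s" r] act_cartan[of x s "r + num.One"]
    by (simp add: cartan_add cartan_scale val_scale D_add D_mult D_lp mult.assoc add.commute)
qed (simp add: D_of_int)

subsection \<open>The elements $w_i$\<close>

text \<open>
  A list \<open>[p\<^sub>0, p\<^sub>1, \<dots>]\<close> encodes \<open>p\<^sub>0 + p\<^sub>1 \<tau> + \<dots>\<close>.  The factors are multiplied by \<open>3\<close> to clear the
  denominators of \<open>g1\<close> and \<open>g2\<close>.
\<close>

primrec op_val :: "trie list \<Rightarrow> uea" where
  "op_val [] = 0"
| "op_val (p # ps) = val p + op_val ps * tau"

text \<open>Since 3 tau p = 3 p tau + 3 D p, a coefficient p also contributes 3 p to the next power
  of tau; \<open>c\<close> carries this contribution along.\<close>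

primrec times_factor :: "int \<Rightarrow> int \<Rightarrow> trie \<Rightarrow> trie list \<Rightarrow> trie list" where
  "times_factor a b c [] = [c]"
| "times_factor a b c (p # ps) =
    add (add (scale 3 (der p)) (add (smul a (act H1 num.One p)) (smul b (act H2 num.One p)))) c
    # times_factor a b (scale 3 p) ps"

lemma op_val_times_factor:
  assumes "\<forall>p \<in> set ps. cartan p"
  shows "op_val (times_factor a b c ps) =
    val c + (3 * tau + of_int a * lp H1 num.One + of_int b * lp H2 num.One) * op_val ps"
  using assms
proof (induction ps arbitrary: c)
  case (Cons p ps)
  have H: "\<not> pos H1" "\<not> neg H1" "\<not> pos H2" "\<not> neg H2" by (simp_all add: pos_def neg_def)
  have p: "cartan p" using Cons.prems by simp
  have "tau * val p = val p * tau + D (val p)" by (simp add: D_def)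
  then have "3 * tau * val p = 3 * (val p * tau) + 3 * D (val p)"
    by (simp add: mult.assoc distrib_left)
  with Cons show ?case
    using der_cartan[OF p] act_cartan[OF H(1,2) p, of num.One] act_cartan[OF H(3,4) p, of num.One]
    by (simp add: val_scale algebra_simps)
qed simp

lemma cartan_times_factor:
  assumes "\<forall>p \<in> set ps. cartan p" "cartan c"
  shows "\<forall>p \<in> set (times_factor a b c ps). cartan p"
  using assms
proof (induction ps arbitrary: c)
  case (Cons p ps)
  have H: "\<not> pos H1" "\<not> neg H1" "\<not> pos H2" "\<not> neg H2" by (simp_all add: pos_def neg_def)
  have p: "cartan p" using Cons.prems by simp
  show ?case
    using Cons.IH[of "scale 3 p"] cartan_scale[OF p, of 3] Cons.prems der_cartan[OF p]
      act_cartan[OF H(1,2) p, of num.One] act_cartan[OF H(3,4) p, of num.One]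
    by (simp add: cartan_add cartan_scale cartan_smul)
qed simp

text \<open>Seven factors, each multiplied by 3, give 3^7 = 2187 times the operator. The pairs are
  the coefficients of g_1 and g_2; position k of the result belongs to tau^k, so 2187
  \<open>w i\<close> stands at position \<open>7 - i\<close>.\<close>

definition w_list :: "trie list" where
  "w_list = foldr (\<lambda>(a, b). times_factor a b (Leaf 0))
     [(-2, -1), (-1, -2), (-1, 1), (0, 0), (1, -1), (1, 2), (2, 1)] [Leaf 1]"

lemma cartan_w_list: "p \<in> set w_list \<Longrightarrow> cartan p"
proof -
  have "\<forall>p\<in>set (foldr (\<lambda>(a, b). times_factor a b (Leaf 0)) fs [Leaf 1]). cartan p" for fs
    by (induction fs) (auto dest: cartan_times_factor[where c = "Leaf 0"])
  then show "p \<in> set w_list \<Longrightarrow> cartan p" by (simp add: w_list_def del: foldr.simps)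
qed

text \<open>The term in tau^6 is absent because the seven linear forms in g_1 and g_2 add up to
  zero. The lemma also supplies the length of \<open>w_list\<close>.\<close>

lemma w_list_leading: "drop 6 w_list = [Leaf 0, Leaf 2187]"
  by code_simp

lemma op_val_w_list:
  "(tau - 2 *\<^sub>R g1 - g2) * (tau - g1 - 2 *\<^sub>R g2) * (tau - g1 + g2) * tau *
   (tau + g1 - g2) * (tau + g1 + 2 *\<^sub>R g2) * (tau + 2 *\<^sub>R g1 + g2) = (1 / 2187) *\<^sub>R op_val w_list"
proof -
  let ?L = "\<lambda>(a, b). 3 * tau + of_int a * lp H1 num.One + of_int b * lp H2 num.One"
  have ev: "op_val (foldr (\<lambda>(a, b). times_factor a b (Leaf 0)) fs [Leaf 1]) = prod_list (map ?L fs)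
     \<and> (\<forall>p\<in>set (foldr (\<lambda>(a, b). times_factor a b (Leaf 0)) fs [Leaf 1]). cartan p)" for fs
    by (induction fs) (auto dest: cartan_times_factor[where c = "Leaf 0"] simp: op_val_times_factor)
  let ?M = "\<lambda>(a, b). tau + of_int a *\<^sub>R g1 + of_int b *\<^sub>R g2"
  have f: "3 * tau + of_int a * lp H1 num.One + of_int b * lp H2 num.One
      = 3 *\<^sub>R (tau + of_int a *\<^sub>R g1 + of_int b *\<^sub>R g2)" for a b
    using scaleR_of_int[of 3 tau] by (simp add: lp_def scaleR_right_distrib flip: scaleR_of_int)
  have "prod_list (map ?L fs) = 3 ^ length fs *\<^sub>R prod_list (map ?M fs)" for fs
    by (induction fs) (auto simp: f)
  then have "op_val w_list = 2187 *\<^sub>R prod_list (map ?M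
      [(-2, -1), (-1, -2), (-1, 1), (0, 0), (1, -1), (1, 2), (2, 1)])"
    unfolding w_list_def by (simp only: ev) simp
  also have "prod_list (map ?M [(-2, -1), (-1, -2), (-1, 1), (0, 0), (1, -1), (1, 2), (2, 1)]) =
      (tau - 2 *\<^sub>R g1 - g2) * (tau - g1 - 2 *\<^sub>R g2) * (tau - g1 + g2) * tau *
      (tau + g1 - g2) * (tau + g1 + 2 *\<^sub>R g2) * (tau + 2 *\<^sub>R g1 + g2)"
    by (simp add: mult.assoc)
  finally show ?thesis by simp
qed

lemma op_val_sum: "op_val ps = (\<Sum>i<length ps. val (ps ! i) * tau ^ i)"
  by (induction ps) (simp_all add: sum.lessThan_Suc_shift sum_distrib_right mult.assoc power_commutes
      del: sum.lessThan_Suc)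

lemma w_eq:
  assumes "i \<in> {2..7}"
  shows "w i = (1 / 2187) *\<^sub>R val (w_list ! (7 - i))"
proof -
  define P where "P = (\<lambda>w' :: nat \<Rightarrow> uea. (\<forall>i\<in>{2..7}. w' i \<in> U_h) \<and> (\<forall>i. i \<notin> {2..7} \<longrightarrow> w' i = 0) \<and>
      (tau - 2 *\<^sub>R g1 - g2) * (tau - g1 - 2 *\<^sub>R g2) * (tau - g1 + g2) * tau *
      (tau + g1 - g2) * (tau + g1 + 2 *\<^sub>R g2) * (tau + 2 *\<^sub>R g1 + g2) =
      tau ^ 7 + w' 2 * tau ^ 5 + w' 3 * tau ^ 4 + w' 4 * tau ^ 3 + w' 5 * tau ^ 2 + w' 6 * tau + w' 7)"
  define v where "v = (\<lambda>i::nat. if i \<in> {2..7} then (1 / 2187) *\<^sub>R val (w_list ! (7 - i)) else 0)"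
  have expand: "tau ^ 7 + u 2 * tau ^ 5 + u 3 * tau ^ 4 + u 4 * tau ^ 3 + u 5 * tau ^ 2 + u 6 * tau + u 7
      = tau ^ 7 + (\<Sum>i\<le>5. u (7 - i) * tau ^ i)" for u :: "nat \<Rightarrow> uea"
    by (simp add: eval_nat_numeral algebra_simps)
  have len: "length w_list = 8"
    using arg_cong[OF w_list_leading, of length] by simp
  have lead: "w_list ! 6 = Leaf 0" "w_list ! 7 = Leaf 2187"
    using arg_cong[OF w_list_leading, of "\<lambda>l. l ! 0"] arg_cong[OF w_list_leading, of "\<lambda>l. l ! 1"] len
    by simp_all
  have "P v"
    unfolding P_def
  proof (intro conjI)
    show "\<forall>i\<in>{2..7}. v i \<in> U_h"
      using cartan_val[OF cartan_w_list[OF nth_mem]] by (auto simp: v_def U_h_def len intro!: subalgebra_scaleR)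
    show "\<forall>i. i \<notin> {2..7} \<longrightarrow> v i = 0" by (simp add: v_def)
    have "op_val w_list = (\<Sum>i\<le>5. val (w_list ! i) * tau ^ i) + 2187 * tau ^ 7"
      unfolding op_val_sum len using lead by (simp add: eval_nat_numeral flip: lessThan_Suc_atMost)
    moreover have "(1 / 2187) *\<^sub>R (2187 * u) = u" for u :: uea
      using scaleR_of_int[of 2187 u] by (simp flip: scaleR_of_int)
    ultimately show "(tau - 2 *\<^sub>R g1 - g2) * (tau - g1 - 2 *\<^sub>R g2) * (tau - g1 + g2) * tau *
      (tau + g1 - g2) * (tau + g1 + 2 *\<^sub>R g2) * (tau + 2 *\<^sub>R g1 + g2) =
      tau ^ 7 + v 2 * tau ^ 5 + v 3 * tau ^ 4 + v 4 * tau ^ 3 + v 5 * tau ^ 2 + v 6 * tau + v 7"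
      unfolding op_val_w_list expand
      by (auto simp: v_def scaleR_right_distrib scaleR_sum_right add.commute intro!: sum.cong)
  qed
  moreover have "u = v" if "P u" for u
  proof
    fix j
    \<comment> \<open>The leading terms tau^7 cancel, which leaves a relation between 1, ..., tau^5
      over \<open>U_h\<close>.\<close>
    have d: "(\<Sum>i\<le>5. (u (7 - i) - v (7 - i)) * tau ^ i) = 0"
      using that \<open>P v\<close> unfolding P_def expand by (simp add: left_diff_distrib sum_subtractf)
    show "u j = v j"
    proof (cases "j \<in> {2..7}")
      case True
      have "u (7 - (7 - j)) - v (7 - (7 - j)) = 0"
        by (rule tau_independent[OF _ d])
          (use that \<open>P v\<close> True in \<open>auto simp: P_def U_h_def intro!: subalgebra_diff\<close>)
      with True show ?thesis by simp
    next
      case False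
      with that \<open>P v\<close> show ?thesis by (simp add: P_def)
    qed
  qed
  ultimately have "w = v"
    unfolding w_def P_def by (rule the_equality)
  then have "w i = v i" by (rule fun_cong)
  with assms show ?thesis by (simp add: v_def)
qed

subsection \<open>Evaluation of the Segal-Sugawara vectors\<close>

text \<open>
  Column \<open>i\<close> of $G[-1]^k$, applied to the vacuum, is \<open>vk\<close>.  The chains \<open>col0, \<dots>, col5\<close> and
  \<open>defects0, \<dots>, defects\<close> pass each intermediate result as an argument so that rewriting evaluates it
  only once.
\<close>

abbreviation (input) "n1 \<equiv> num.One"
abbreviation (input) "n2 \<equiv> num.Bit0 num.One"
abbreviation (input) "n3 \<equiv> num.Bit1 num.One"

definition col5 :: "row \<Rightarrow> trie list \<Rightarrow> trie list \<Rightarrow> trie list \<Rightarrow> trie list \<Rightarrow> trie list \<Rightarrow> trie list \<Rightarrow> trie list" where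
  "col5 i v0 v1 v2 v3 v4 v5 =
    [row_act i n1 v1,
     row_act i n1 v2,
     add (row_act i n1 v3) (row_act i n2 v2),
     add (row_act i n1 v4) (row_act i n2 v3),
     add (row_act i n1 v5)
       (add (scale 5 (row_act i n2 v4))
       (add (scale 14 (row_act i n3 v3))
       (add (scale 456 (row_act i n3 (step n3 v0)))
       (add (scale (- 639) (row_act i n2 (step n2 (step n2 v0))))
       (add (scale 31 (row_act i n2 (step n2 v2)))
         (scale (- 312) (row_act i n3 (step n2 v1))))))))]"

definition "col4 i v0 v1 v2 v3 v4 = col5 i v0 v1 v2 v3 v4 (step n1 v4)"
definition "col3 i v0 v1 v2 v3 = col4 i v0 v1 v2 v3 (step n1 v3)"
definition "col2 i v0 v1 v2 = col3 i v0 v1 v2 (step n1 v2)"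
definition "col1 i v0 v1 = col2 i v0 v1 (step n1 v1)"
definition "col0 i v0 = col1 i v0 (step n1 v0)"

primrec sum_cols :: "row list \<Rightarrow> trie list" where
  "sum_cols [] = replicate 5 (Leaf 0)"
| "sum_cols (i # is) = map2 add (col0 i (unit_col i)) (sum_cols is)"

definition images :: "trie list" where
  "images = sum_cols rows"

text \<open>With \<open>p = 2187 w\<^sub>2\<close> and \<open>q = 2187 w\<^sub>6\<close>: the five identities multiplied by a common denominator.\<close>

definition defects :: "trie list \<Rightarrow> trie \<Rightarrow> trie \<Rightarrow> trie \<Rightarrow> trie \<Rightarrow> trie \<Rightarrow> trie \<Rightarrow> trie list" where
  "defects S q p p1 p2 p3 p4 =
    [add (scale 2187 (S ! 0)) (scale 6 p),
     add (scale 2187 (S ! 1)) (scale (- 18) p1),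
     add (scale (2187 * 2187) (S ! 2)) (add (scale (- 9) (mul p p)) (scale (36 * 2187) p2)),
     add (scale (2187 * 2187) (S ! 3)) (add (scale 63 (mul p p1)) (scale (- 72 * 2187) p3)),
     add (scale (2 * 2187 * 2187 * 2187) (S ! 4))
       (add (scale (- 324 * 2187 * 2187) q) (add (scale 33 (mul p (mul p p)))
       (add (scale (- 63 * 2187) (mul p1 p1)) (add (scale (- 180 * 2187) (mul p p2))
         (scale (1152 * 2187 * 2187) p4)))))]"

definition "defects3 S q p p1 p2 p3 = defects S q p p1 p2 p3 (der p3)"
definition "defects2 S q p p1 p2 = defects3 S q p p1 p2 (der p2)"
definition "defects1 S q p p1 = defects2 S q p p1 (der p1)"
definition "defects0 S q p = defects1 S q p (der p)"

text \<open>A letter from n_+ left over in \<open>images\<close> would remain visible in these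
  tries. The evaluation thus yields the five identities and at the same time shows that only Cartan
  currents survive.\<close>

lemma defects_vanish: "defects0 images (w_list ! 1) (w_list ! 5) = replicate 5 (Leaf 0)"
  by code_simp

lemma length_col0: "length (col0 i v) = 5"
  by (simp add: col0_def col1_def col2_def col3_def col4_def col5_def)

lemma val_images:
  assumes "n < 5"
  shows "val (images ! n) = (\<Sum>i\<in>UNIV. val (col0 i (unit_col i) ! n))"
proof -
  have "length (sum_cols is) = 5 \<and> val (sum_cols is ! n) = (\<Sum>i\<leftarrow>is. val (col0 i (unit_col i) ! n))" for "is"
    by (induction "is") (use assms in \<open>simp_all add: length_col0\<close>)
  from this[of rows] show ?thesis
    by (simp add: images_def rows_def UNIV_row del: sum_cols.simps)
qed

lemma conj_dg_mpow: "conj_dg (mpow A n) = mpow (conj_dg A) n"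
  by (induction n) (simp_all add: conj_dg_mat_1 conj_dg_mult)

lemma Ghat_unfold: "conj_dg (Gmat (- 1)) = Ghat n1" "conj_dg (Gmat (- 2)) = Ghat n2" "conj_dg (Gmat (- 3)) = Ghat n3"
  by (simp_all add: Ghat_def)

lemma images_cong:
  "val (images ! 0) \<simeq> S2" "val (images ! 1) \<simeq> S3" "val (images ! 2) \<simeq> S4"
  "val (images ! 3) \<simeq> S5" "val (images ! 4) \<simeq> S6"
proof -
  define M1 where "M1 = Ghat n1 ** mat 1"
  define M2 where "M2 = Ghat n1 ** M1"
  define M3 where "M3 = Ghat n1 ** M2"
  define M4 where "M4 = Ghat n1 ** M3"
  define M5 where "M5 = Ghat n1 ** M4"
  define v1 where "v1 = (\<lambda>i. step n1 (unit_col i))"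
  define v2 where "v2 = (\<lambda>i. step n1 (v1 i))"
  define v3 where "v3 = (\<lambda>i. step n1 (v2 i))"
  define v4 where "v4 = (\<lambda>i. step n1 (v3 i))"
  define v5 where "v5 = (\<lambda>i. step n1 (v4 i))"
  note M_defs = M1_def M2_def M3_def M4_def M5_def
  note v_defs = v1_def v2_def v3_def v4_def v5_def
  have r0: "repr_col (unit_col i) (mat 1) i" for i by (rule repr_unit_col)
  have r1: "repr_col (v1 i) M1 i" for i unfolding v1_def M1_def by (intro repr_step r0)
  have r2: "repr_col (v2 i) M2 i" for i unfolding v2_def M2_def by (intro repr_step r1)
  have r3: "repr_col (v3 i) M3 i" for i unfolding v3_def M3_def by (intro repr_step r2)
  have r4: "repr_col (v4 i) M4 i" for i unfolding v4_def M4_def by (intro repr_step r3)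
  have r5: "repr_col (v5 i) M5 i" for i unfolding v5_def M5_def by (intro repr_step r4)
  have col: "col0 i (unit_col i) = col5 i (unit_col i) (v1 i) (v2 i) (v3 i) (v4 i) (v5 i)" for i
    by (simp only: col0_def col1_def col2_def col3_def col4_def v_defs)
  \<comment> \<open>The trace is invariant under conjugation, so each trace may be computed from the
    integral matrices \<open>Ghat\<close>.\<close>
  have tr: "trace A = trace (conj_dg A)" for A by (rule trace_conj_dg[symmetric])
  have "S2 = trace (Ghat n1 ** M1)"
    unfolding S2_def
    by (subst tr) (simp add: conj_dg_mpow conj_dg_mult Ghat_unfold M_defs numeral_2_eq_2)
  then show "val (images ! 0) \<simeq> S2"
    using trace_repr[OF r1, of n1] by (simp add: val_images col col5_def)
  have "S3 = trace (Ghat n1 ** M2)"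
    unfolding S3_def
    by (subst tr) (simp add: conj_dg_mpow conj_dg_mult Ghat_unfold M_defs eval_nat_numeral)
  then show "val (images ! 1) \<simeq> S3"
    using trace_repr[OF r2, of n1] by (simp add: val_images col col5_def)
  have "S4 = trace (Ghat n1 ** M3) + trace (Ghat n2 ** M2)"
    unfolding S4_def
    by (subst (1 2) tr) (simp add: conj_dg_mpow conj_dg_mult Ghat_unfold M_defs eval_nat_numeral)
  then show "val (images ! 2) \<simeq> S4"
    using cong_n_add[OF trace_repr[OF r3, of n1] trace_repr[OF r2, of n2]]
    by (simp add: val_images col col5_def sum.distrib)
  have "S5 = trace (Ghat n1 ** M4) + trace (Ghat n2 ** M3)"
    unfolding S5_def
    by (subst (1 2) tr) (simp add: conj_dg_mpow conj_dg_mult Ghat_unfold M_defs eval_nat_numeral)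
  then show "val (images ! 3) \<simeq> S5"
    using cong_n_add[OF trace_repr[OF r4, of n1] trace_repr[OF r3, of n2]]
    by (simp add: val_images col col5_def sum.distrib)
  have sc: "(numeral k :: real) *\<^sub>R x = of_int (numeral k) * x" for k and x :: uea
    by (simp add: scaleR_conv_of_real)
  have S6_eq: "S6 = trace (Ghat n1 ** M5) + (of_int 5 * trace (Ghat n2 ** M4) + (of_int 14 * trace (Ghat n3 ** M3)
      + (of_int 456 * trace (Ghat n3 ** (Ghat n3 ** mat 1))
      + (of_int (- 639) * trace (Ghat n2 ** (Ghat n2 ** (Ghat n2 ** mat 1)))
      + (of_int 31 * trace (Ghat n2 ** (Ghat n2 ** M2))
      + of_int (- 312) * trace (Ghat n3 ** (Ghat n2 ** M1)))))))"
    unfolding S6_def sc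
    by (subst (1 2 3 4 5 6 7) tr)
      (simp add: conj_dg_mpow conj_dg_mult Ghat_unfold M_defs eval_nat_numeral matrix_mul_assoc
        del: of_int_numeral)
  have images_eq: "val (images ! 4) = (\<Sum>i\<in>UNIV. val (row_act i n1 (v5 i)))
      + (of_int 5 * (\<Sum>i\<in>UNIV. val (row_act i n2 (v4 i))) + (of_int 14 * (\<Sum>i\<in>UNIV. val (row_act i n3 (v3 i)))
      + (of_int 456 * (\<Sum>i\<in>UNIV. val (row_act i n3 (step n3 (unit_col i))))
      + (of_int (- 639) * (\<Sum>i\<in>UNIV. val (row_act i n2 (step n2 (step n2 (unit_col i)))))
      + (of_int 31 * (\<Sum>i\<in>UNIV. val (row_act i n2 (step n2 (v2 i))))
      + of_int (- 312) * (\<Sum>i\<in>UNIV. val (row_act i n3 (step n2 (v1 i)))))))))"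
    by (simp add: val_images col col5_def val_scale sum.distrib sum_distrib_left sum_negf sum_subtractf)
  show "val (images ! 4) \<simeq> S6"
    unfolding S6_eq images_eq
    by (intro cong_n_add cong_n_of_int trace_repr repr_step r0 r1 r2 r3 r4 r5)
qed

lemma solve_scaled:
  fixes a x :: uea
  assumes "of_int c * a + x = 0" "c \<noteq> 0"
  shows "a = (- 1 / real_of_int c) *\<^sub>R x"
proof -
  have "x = - (of_int c *\<^sub>R a)"
    using assms(1) by (simp add: scaleR_of_int add_eq_0_iff)
  then show ?thesis using assms(2) by simp
qed

theorem theoremB:
  shows "hc S2 = - 6 *\<^sub>R w 2
    \<and> hc S3 = 18 *\<^sub>R D (w 2)
    \<and> hc S4 = 9 *\<^sub>R (w 2)^2 - 36 *\<^sub>R (D ^^ 2) (w 2)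
    \<and> hc S5 = - 63 *\<^sub>R (w 2 * D (w 2)) + 72 *\<^sub>R (D ^^ 3) (w 2)
    \<and> hc S6 = 162 *\<^sub>R w 6 - (33/2) *\<^sub>R (w 2)^3 + (63/2) *\<^sub>R (D (w 2))^2
        + 90 *\<^sub>R (w 2 * (D ^^ 2) (w 2)) - 576 *\<^sub>R (D ^^ 4) (w 2)"
proof -
  define p where "p = w_list ! 5"
  define q where "q = w_list ! 1"
  have len: "length w_list = 8"
    using arg_cong[OF w_list_leading, of length] by simp
  have c: "cartan p" "cartan q"
    unfolding p_def q_def by (rule cartan_w_list, simp add: len)+
  note c1 = der_cartan[OF c(1)]
  note c2 = der_cartan[OF c1[THEN conjunct1]]
  note c3 = der_cartan[OF c2[THEN conjunct1]]
  note c4 = der_cartan[OF c3[THEN conjunct1]]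
  let ?P = "val p" and ?Q = "val q"
  have vals: "val (der p) = D ?P" "val (der (der p)) = D (D ?P)" "val (der (der (der p))) = D (D (D ?P))"
    "val (der (der (der (der p)))) = D (D (D (D ?P)))"
    "val (mul p p) = ?P * ?P" "val (mul p (mul p p)) = ?P * (?P * ?P)" "val (mul p (der p)) = ?P * D ?P"
    "val (mul (der p) (der p)) = D ?P * D ?P" "val (mul p (der (der p))) = ?P * D (D ?P)"
    using c c1 c2 c3 c4 mul_cartan by simp_all
  have "map val (defects0 images q p) = [0, 0, 0, 0, 0]"
    unfolding p_def q_def defects_vanish by (simp add: eval_nat_numeral)
  then have eqs:
    "of_int 2187 * val (images ! 0) + of_int 6 * ?P = 0"
    "of_int 2187 * val (images ! 1) + of_int (- 18) * D ?P = 0"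
    "of_int (2187 * 2187) * val (images ! 2) + (of_int (- 9) * (?P * ?P) + of_int (36 * 2187) * D (D ?P)) = 0"
    "of_int (2187 * 2187) * val (images ! 3)
      + (of_int 63 * (?P * D ?P) + of_int (- 72 * 2187) * D (D (D ?P))) = 0"
    "of_int (2 * 2187 * 2187 * 2187) * val (images ! 4) + (of_int (- 324 * 2187 * 2187) * ?Q
      + (of_int 33 * (?P * (?P * ?P)) + (of_int (- 63 * 2187) * (D ?P * D ?P)
      + (of_int (- 180 * 2187) * (?P * D (D ?P)) + of_int (1152 * 2187 * 2187) * D (D (D (D ?P))))))) = 0"
    by (simp_all only: defects0_def defects1_def defects2_def defects3_def defects_def list.map
        val_add val_scale vals list.inject)
  have U: "?P \<in> U_h" "?Q \<in> U_h" "D ?P \<in> U_h" "D (D ?P) \<in> U_h" "D (D (D ?P)) \<in> U_h" "D (D (D (D ?P))) \<in> U_h"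
    using c c1 c2 c3 c4 cartan_val by metis+
  have w: "w 2 = (1 / 2187) *\<^sub>R ?P" "w 6 = (1 / 2187) *\<^sub>R ?Q"
    by (simp_all add: w_eq p_def q_def)
  have hc_val: "hc u = val (images ! n)" if "u \<in> centralizer_h" "val (images ! n) \<simeq> u" "val (images ! n) \<in> U_h" for u n
    using that by (intro hc_eqI cong_n_sym[OF that(2)])
  \<comment> \<open>Solving for the images also places them in \<open>U_h\<close>, as
    \<open>hc_eqI\<close> requires.\<close>
  have sol:
    "val (images ! 0) = (- 6 / 2187) *\<^sub>R ?P"
    "val (images ! 1) = (18 / 2187) *\<^sub>R D ?P"
    "val (images ! 2) = (9 / 2187 ^ 2) *\<^sub>R (?P * ?P) + (- 36 / 2187) *\<^sub>R D (D ?P)"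
    "val (images ! 3) = (- 63 / 2187 ^ 2) *\<^sub>R (?P * D ?P) + (72 / 2187) *\<^sub>R D (D (D ?P))"
    "val (images ! 4) = (162 / 2187) *\<^sub>R ?Q + (- 33 / 2 / 2187 ^ 3) *\<^sub>R (?P * (?P * ?P))
      + (63 / 2 / 2187 ^ 2) *\<^sub>R (D ?P * D ?P) + (90 / 2187 ^ 2) *\<^sub>R (?P * D (D ?P))
      + (- 576 / 2187) *\<^sub>R D (D (D (D ?P)))"
    using eqs[THEN solve_scaled]
    by (simp_all only: scaleR_of_int[symmetric] scaleR_right_distrib scaleR_scaleR) simp_all
  have im: "val (images ! 0) \<in> U_h" "val (images ! 1) \<in> U_h" "val (images ! 2) \<in> U_h"
    "val (images ! 3) \<in> U_h" "val (images ! 4) \<in> U_h"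
    unfolding U_h_def sol by (intro subalgebra_scaleR subalgebra.add subalgebra.mult U[unfolded U_h_def])+
  have hc: "hc S2 = val (images ! 0)" "hc S3 = val (images ! 1)" "hc S4 = val (images ! 2)"
    "hc S5 = val (images ! 3)" "hc S6 = val (images ! 4)"
    by (intro hc_val Segal_Sugawara_centralizer images_cong im)+
  show ?thesis
    unfolding hc sol w
    by (simp add: D_scaleR eval_nat_numeral)
qed

end
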